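(* Let $p$ be a prime. Let $G$ be a non-principal ultraproduct of the groups $((\mathbb Z/p^n\mathbb Z)^n:n<\omega)$ in the language of groups, viewed as the $\mathbf D$-sort structure $M$ of the corresponding ultraproduct $K^*$. Then $\mathrm{Th}(G)$ is stable but not superstable, and $G$ satisfies (A) and $(\mathrm{DC}_L)$.
   Context: Setting: for a class of finite $L$-structures, $L^+$ is the two-sorted language with a sort $\mathbf D$ carrying $L$, a sort $\mathbf{OF}$ carrying the ordered field language with $\log$, and for each $L$-formula $\phi(\bar x,\bar y)$ ($|\bar x|=r,|\bar y|=s$) a function symbol $f_\phi:\mathbf D^s\to\mathbf{OF}$ interpreted in each finite structure $N$ by $f_\phi(\bar a)=|\phi(N^r,\bar a)|$ (with $\mathbf{OF}$ the real field with $\log$). $K^*$ is the ultraproduct of these, with $\mathbf{OF}$-sort $\mathbb R^*$; $M$ is the $L$-structure on the $\mathbf D$-sort. For definable $X=\phi(M^r,\bar a)$, $|X|=f_\phi(\bar a)$ and $\delta(X)=\log|X|+C\in\mathbb R^*/C$, $C$ the convex hull of $\mathbb Z$ in $\mathbb R^*$; for partial types $\delta(X)=\inf\{\delta(D):D\supseteq X\text{ definable}\}$ in the semigroup of cuts. (A): for every $L$-formula $\phi(\bar x,\bar y)$ there is no sequence $(p_i)_{i\in\omega}$ of finite consistent sets of instances $\phi(\bar x,\bar b)$ with $p_i\subseteq p_{i+1}$ and $\delta(p_i)>\delta(p_{i+1})$ for all $i$. $(\mathrm{DC}_L)$: for all $L$-formulas $\phi(\bar x,\bar y),\psi(\bar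 x,\bar z)$ there is an $L$-formula $\chi(\bar y,\bar z)$ with $M\models\chi(\bar a,\bar b)$ iff $\delta(\phi(\bar x,\bar a))\le\delta(\psi(\bar x,\bar b))$. *)

theory Defs
  imports Complex_Main "HOL-Computational_Algebra.Primes"
    "HOL-Algebra.Elementary_Groups" "HOL-Algebra.Product_Groups"
begin

section \<open>First-order logic in the language of groups\<close>

datatype gterm = Var nat | Unit | Inv gterm | Mul gterm gterm

datatype gform = Eq gterm gterm | Neg gform | Conj gform gform | Exi nat gform

primrec tvars :: "gterm \<Rightarrow> nat set" where
  "tvars (Var i) = {i}"
| "tvars Unit = {}"
| "tvars (Inv t) = tvars t"
| "tvars (Mul t u) = tvars t \<union> tvars u"

primrec fvars :: "gform \<Rightarrow> nat set" where
  "fvars (Eq t u) = tvars t \<union> tvars u"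
| "fvars (Neg \<phi>) = fvars \<phi>"
| "fvars (Conj \<phi> \<psi>) = fvars \<phi> \<union> fvars \<psi>"
| "fvars (Exi i \<phi>) = fvars \<phi> - {i}"

primrec tval :: "'a monoid \<Rightarrow> (nat \<Rightarrow> 'a) \<Rightarrow> gterm \<Rightarrow> 'a" where
  "tval G e (Var i) = e i"
| "tval G e Unit = \<one>\<^bsub>G\<^esub>"
| "tval G e (Inv t) = inv\<^bsub>G\<^esub> (tval G e t)"
| "tval G e (Mul t u) = tval G e t \<otimes>\<^bsub>G\<^esub> tval G e u"

primrec sat :: "'a monoid \<Rightarrow> (nat \<Rightarrow> 'a) \<Rightarrow> gform \<Rightarrow> bool" where
  "sat G e (Eq t u) = (tval G e t = tval G e u)"
| "sat G e (Neg \<phi>) = (\<not> sat G e \<phi>)"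
| "sat G e (Conj \<phi> \<psi>) = (sat G e \<phi> \<and> sat G e \<psi>)"
| "sat G e (Exi i \<phi>) = (\<exists>a\<in>carrier G. sat G (e(i := a)) \<phi>)"

definition tuples :: "nat \<Rightarrow> 'a set \<Rightarrow> 'a list set" where
  "tuples n A = {v. length v = n \<and> set v \<subseteq> A}"

text \<open>A formula \<open>\<phi>(x, y)\<close> with \<open>|x| = r\<close> and \<open>|y| = s\<close> is a formula whose free variables are
  among \<open>0, ..., r + s - 1\<close>, the first \<open>r\<close> of them being \<open>x\<close>.\<close>

definition form2 :: "nat \<Rightarrow> nat \<Rightarrow> gform \<Rightarrow> bool" where
  "form2 r s \<phi> \<longleftrightarrow> fvars \<phi> \<subseteq> {..<r + s}"

definition holds :: "'a monoid \<Rightarrow> gform \<Rightarrow> 'a list \<Rightarrow> 'a list \<Rightarrow> bool" where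
  "holds G \<phi> a b \<longleftrightarrow> sat G (nth (a @ b)) \<phi>"

definition defset :: "'a monoid \<Rightarrow> nat \<Rightarrow> gform \<Rightarrow> 'a list \<Rightarrow> 'a list set" where
  "defset G r \<phi> b = {a \<in> tuples r (carrier G). holds G \<phi> a b}"


section \<open>Theories, stability and superstability\<close>

definition Th :: "'a monoid \<Rightarrow> gform set" where
  "Th G = {\<phi>. fvars \<phi> = {} \<and> sat G (\<lambda>_. \<one>\<^bsub>G\<^esub>) \<phi>}"

text \<open>Only theories containing the group axioms are considered, so that every model is a group and
  the symbol \<open>Inv\<close> is necessarily interpreted by \<open>m_inv\<close>.\<close>

definition is_model :: "'a monoid \<Rightarrow> gform set \<Rightarrow> bool" where
  "is_model N T \<longleftrightarrow> group N \<and> (\<forall>\<phi>\<in>T. sat N (\<lambda>_. \<one>\<^bsub>N\<^esub>) \<phi>)"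

text \<open>HOL cannot quantify over types inside a formula, so the models of a theory are those whose
  carrier is a subset of a type \<open>'u\<close>, passed as an argument. The language is countable; for infinite
  \<open>'u\<close> the notions below do not depend on \<open>'u\<close>, by Loewenheim-Skolem.\<close>

definition order_property :: "'a monoid \<Rightarrow> nat \<Rightarrow> nat \<Rightarrow> gform \<Rightarrow> bool" where
  "order_property N r s \<phi> \<longleftrightarrow>
     (\<exists>a b. (\<forall>i::nat. a i \<in> tuples r (carrier N) \<and> b i \<in> tuples s (carrier N)) \<and>
            (\<forall>i j. holds N \<phi> (a i) (b j) \<longleftrightarrow> i < j))"

definition stable_theory :: "'u itself \<Rightarrow> gform set \<Rightarrow> bool" where
  "stable_theory _ T \<longleftrightarrow>
     (\<forall>(N :: 'u monoid) r s \<phi>. is_model N T \<and> form2 r s \<phi> \<longrightarrow> \<not> order_property N r s \<phi>)"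

definition elem_embedding :: "('a \<Rightarrow> 'b) \<Rightarrow> 'a monoid \<Rightarrow> 'b monoid \<Rightarrow> bool" where
  "elem_embedding h N N' \<longleftrightarrow>
     h ` carrier N \<subseteq> carrier N' \<and>
     (\<forall>\<phi> e. range e \<subseteq> carrier N \<longrightarrow> (sat N e \<phi> \<longleftrightarrow> sat N' (h \<circ> e) \<phi>))"

definition same_type :: "'a monoid \<Rightarrow> 'a set \<Rightarrow> 'a list \<Rightarrow> 'a list \<Rightarrow> bool" where
  "same_type N A b c \<longleftrightarrow> length b = length c \<and>
     (\<forall>t \<theta>. form2 (length b) t \<theta> \<longrightarrow> (\<forall>a\<in>tuples t A. holds N \<theta> b a \<longleftrightarrow> holds N \<theta> c a))"

text \<open>In place of a monster model, dividing and forking refer to elementary extensions \<open>N'\<close> of \<open>N\<close>,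
  presented as elementary embeddings \<open>h\<close>. A partial type in \<open>r\<close> variables is a set of pairs
  \<open>(\<phi>, b)\<close>, standing for the formulas \<open>\<phi>(x, b)\<close>.\<close>

definition divides_over :: "'u monoid \<Rightarrow> nat \<Rightarrow> 'u set \<Rightarrow> gform \<Rightarrow> 'u list \<Rightarrow> bool" where
  "divides_over N r A \<phi> b \<longleftrightarrow>
     (\<exists>(N' :: 'u monoid) h k c. group N' \<and> elem_embedding h N N' \<and>
        (\<forall>i::nat. c i \<in> tuples (length b) (carrier N') \<and>
                  same_type N' (h ` A) (c i) (map h b)) \<and>
        (\<forall>I. finite I \<and> card I = k \<longrightarrow>
             \<not> (\<exists>x\<in>tuples r (carrier N'). \<forall>i\<in>I. holds N' \<phi> x (c i))))"

definition forks_over :: "'u monoid \<Rightarrow> nat \<Rightarrow> 'u set \<Rightarrow> (gform \<times> 'u list) set \<Rightarrow> bool" where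
  "forks_over N r A p \<longleftrightarrow>
     (\<exists>(N' :: 'u monoid) h p0 D. group N' \<and> elem_embedding h N N' \<and>
        finite p0 \<and> p0 \<subseteq> p \<and> finite D \<and>
        (\<forall>(\<psi>, d)\<in>D. form2 r (length d) \<psi> \<and> set d \<subseteq> carrier N' \<and> divides_over N' r (h ` A) \<psi> d) \<and>
        (\<forall>x\<in>tuples r (carrier N').
           (\<forall>(\<phi>, b)\<in>p0. holds N' \<phi> x (map h b)) \<longrightarrow> (\<exists>(\<psi>, d)\<in>D. holds N' \<psi> x d)))"

definition instances :: "nat \<Rightarrow> 'a set \<Rightarrow> (gform \<times> 'a list) set" where
  "instances r B = {(\<phi>, b). form2 r (length b) \<phi> \<and> set b \<subseteq> B}"

definition complete_type :: "'a monoid \<Rightarrow> nat \<Rightarrow> 'a set \<Rightarrow> (gform \<times> 'a list) set \<Rightarrow> bool" where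
  "complete_type N r B p \<longleftrightarrow>
     p \<subseteq> instances r B \<and>
     (\<forall>p0. finite p0 \<and> p0 \<subseteq> p \<longrightarrow>
        (\<exists>x\<in>tuples r (carrier N). \<forall>(\<phi>, b)\<in>p0. holds N \<phi> x b)) \<and>
     (\<forall>(\<phi>, b)\<in>instances r B. (\<phi>, b) \<in> p \<or> (Neg \<phi>, b) \<in> p)"

text \<open>Superstability is stability together with supersimplicity: no complete type over a set \<open>B\<close>
  forks over all finite subsets of \<open>B\<close>. The definition by \<open>\<lambda>\<close>-stability for all large \<open>\<lambda>\<close> is not
  usable here, since HOL provides no type of cardinality \<open>\<beth>\<^sub>\<omega>\<close>.\<close>

definition superstable_theory :: "'u itself \<Rightarrow> gform set \<Rightarrow> bool" where
  "superstable_theory U T \<longleftrightarrow> stable_theory U T \<and>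
     (\<forall>(N :: 'u monoid) r B p. is_model N T \<and> B \<subseteq> carrier N \<and> complete_type N r B p \<longrightarrow>
        (\<exists>A. finite A \<and> A \<subseteq> B \<and> \<not> forks_over N r A p))"


section \<open>Ultraproducts\<close>

definition nonprincipal_ultrafilter :: "'i filter \<Rightarrow> bool" where
  "nonprincipal_ultrafilter U \<longleftrightarrow>
     U \<noteq> bot \<and>
     (\<forall>P. eventually P U \<or> eventually (\<lambda>n. \<not> P n) U) \<and>
     (\<forall>n. \<not> eventually (\<lambda>k. k = n) U)"

definition uclass :: "'i filter \<Rightarrow> ('i \<Rightarrow> 'a set) \<Rightarrow> ('i \<Rightarrow> 'a) \<Rightarrow> ('i \<Rightarrow> 'a) set" where
  "uclass U X f = {g \<in> Pi UNIV X. eventually (\<lambda>n. g n = f n) U}"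

definition urep :: "('i \<Rightarrow> 'a) set \<Rightarrow> 'i \<Rightarrow> 'a" where
  "urep \<alpha> = (SOME f. f \<in> \<alpha>)"

definition ultraproduct :: "'i filter \<Rightarrow> ('i \<Rightarrow> 'a monoid) \<Rightarrow> ('i \<Rightarrow> 'a) set monoid" where
  "ultraproduct U G =
     \<lparr>carrier = uclass U (\<lambda>n. carrier (G n)) ` Pi UNIV (\<lambda>n. carrier (G n)),
      monoid.mult = (\<lambda>\<alpha> \<beta>. uclass U (\<lambda>n. carrier (G n)) (\<lambda>n. urep \<alpha> n \<otimes>\<^bsub>G n\<^esub> urep \<beta> n)),
      one = uclass U (\<lambda>n. carrier (G n)) (\<lambda>n. \<one>\<^bsub>G n\<^esub>)\<rparr>"


section \<open>Pseudofinite cardinality and dimension\<close>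

text \<open>The ordered field sort of the ultraproduct is the ultrapower of the reals. Of its structure
  only the additive group, the order and the logarithm are needed.\<close>

type_synonym 'i hyper = "('i \<Rightarrow> real) set"

definition hyperreal :: "'i filter \<Rightarrow> 'i hyper monoid" where
  "hyperreal U = ultraproduct U (\<lambda>_. \<lparr>carrier = UNIV, monoid.mult = (+), one = 0\<rparr>)"

definition hclass :: "'i filter \<Rightarrow> ('i \<Rightarrow> real) \<Rightarrow> 'i hyper" where
  "hclass U = uclass U (\<lambda>_. UNIV)"

definition hle :: "'i filter \<Rightarrow> 'i hyper \<Rightarrow> 'i hyper \<Rightarrow> bool" where
  "hle U \<alpha> \<beta> \<longleftrightarrow> eventually (\<lambda>n. urep \<alpha> n \<le> urep \<beta> n) U"

definition hlog :: "'i filter \<Rightarrow> 'i hyper \<Rightarrow> 'i hyper" where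
  "hlog U \<alpha> = hclass U (\<lambda>n. ln (urep \<alpha> n))"

definition convex_hull_ints :: "'i filter \<Rightarrow> 'i hyper set" where
  "convex_hull_ints U =
     {\<alpha> \<in> carrier (hyperreal U).
        \<exists>k m :: int. hle U (hclass U (\<lambda>_. of_int k)) \<alpha> \<and> hle U \<alpha> (hclass U (\<lambda>_. of_int m))}"

text \<open>The interpretation in the ultraproduct of the function symbol \<open>f\<^sub>\<phi>\<close> with
  \<open>f\<^sub>\<phi>(b) = |\<phi>(N\<^sup>r, b)|\<close> in every finite structure \<open>N\<close>.\<close>

definition ucard ::
  "'i filter \<Rightarrow> ('i \<Rightarrow> 'a monoid) \<Rightarrow> nat \<Rightarrow> gform \<Rightarrow> ('i \<Rightarrow> 'a) set list \<Rightarrow> 'i hyper" where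
  "ucard U G r \<phi> b = hclass U (\<lambda>n. real (card (defset (G n) r \<phi> (map (\<lambda>\<beta>. urep \<beta> n) b))))"

text \<open>Dimensions are cosets of the convex hull \<open>C\<close> of the integers in the hyperreals, together with
  \<open>None\<close>, which is the dimension \<open>-\<infinity>\<close> of the empty set.\<close>

type_synonym 'i dim = "'i hyper set option"

definition dims :: "'i filter \<Rightarrow> 'i dim set" where
  "dims U = insert None (Some ` carrier (hyperreal U Mod convex_hull_ints U))"

definition dim_le :: "'i filter \<Rightarrow> 'i dim \<Rightarrow> 'i dim \<Rightarrow> bool" where
  "dim_le U v w \<longleftrightarrow>
     (case v of None \<Rightarrow> True
      | Some P \<Rightarrow> (case w of None \<Rightarrow> False
                  | Some Q \<Rightarrow> (\<exists>\<alpha>\<in>P. \<exists>\<beta>\<in>Q. hle U \<alpha> \<beta>)))"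

definition delta ::
  "'i filter \<Rightarrow> ('i \<Rightarrow> 'a monoid) \<Rightarrow> nat \<Rightarrow> gform \<Rightarrow> ('i \<Rightarrow> 'a) set list \<Rightarrow> 'i dim" where
  "delta U G r \<phi> b =
     (if ucard U G r \<phi> b = hclass U (\<lambda>_. 0) then None
      else Some (convex_hull_ints U #>\<^bsub>hyperreal U\<^esub> hlog U (ucard U G r \<phi> b)))"

text \<open>Cuts are represented by their upper halves, so the infimum of a family of dimensions is the
  set of all dimensions lying above some member of it, and the order on cuts is reverse inclusion.\<close>

definition delta_cut ::
  "'i filter \<Rightarrow> ('i \<Rightarrow> 'a monoid) \<Rightarrow> nat \<Rightarrow> ('i \<Rightarrow> 'a) set list set \<Rightarrow> 'i dim set" where
  "delta_cut U G r X =
     {w \<in> dims U. \<exists>s \<psi> b. form2 r s \<psi> \<and> b \<in> tuples s (carrier (ultraproduct U G)) \<and>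
        X \<subseteq> defset (ultraproduct U G) r \<psi> b \<and> dim_le U (delta U G r \<psi> b) w}"

definition cut_less :: "'i dim set \<Rightarrow> 'i dim set \<Rightarrow> bool" where
  "cut_less P Q \<longleftrightarrow> Q \<subset> P"

text \<open>A set of instances of a fixed formula \<open>\<phi>(x, y)\<close> is given by the set of its parameter
  tuples.\<close>

definition realizations ::
  "'a monoid \<Rightarrow> nat \<Rightarrow> gform \<Rightarrow> 'a list set \<Rightarrow> 'a list set" where
  "realizations M r \<phi> p = {x \<in> tuples r (carrier M). \<forall>b\<in>p. holds M \<phi> x b}"

definition condition_A :: "'i filter \<Rightarrow> ('i \<Rightarrow> 'a monoid) \<Rightarrow> bool" where
  "condition_A U G \<longleftrightarrow>
     (let M = ultraproduct U G in
      \<forall>r s \<phi>. form2 r s \<phi> \<longrightarrow>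
        \<not> (\<exists>p. \<forall>i::nat.
              finite (p i) \<and> p i \<subseteq> tuples s (carrier M) \<and>
              realizations M r \<phi> (p i) \<noteq> {} \<and>
              p i \<subseteq> p (Suc i) \<and>
              cut_less (delta_cut U G r (realizations M r \<phi> (p (Suc i))))
                       (delta_cut U G r (realizations M r \<phi> (p i)))))"

definition condition_DC :: "'i filter \<Rightarrow> ('i \<Rightarrow> 'a monoid) \<Rightarrow> bool" where
  "condition_DC U G \<longleftrightarrow>
     (let M = ultraproduct U G in
      \<forall>r s t \<phi> \<psi>. form2 r s \<phi> \<and> form2 r t \<psi> \<longrightarrow>
        (\<exists>\<chi>. form2 s t \<chi> \<and>
           (\<forall>a\<in>tuples s (carrier M). \<forall>b\<in>tuples t (carrier M).
              holds M \<chi> a b \<longleftrightarrow> dim_le U (delta U G r \<phi> a) (delta U G r \<psi> b))))"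


section \<open>The groups \<open>(\<int>/p\<^sup>n\<int>)\<^sup>n\<close>\<close>

definition Zpn_pow :: "nat \<Rightarrow> nat \<Rightarrow> (nat \<Rightarrow> int) monoid" where
  "Zpn_pow p n = product_group {..<n} (\<lambda>_. integer_mod_group (p ^ n))"

end

(* Multiplication by p gives (Z/p^n)^n the chain of subgroups tor j = {x. p^j x = 0}, of order p^(nj), and the
   subgroup of multiples of p^k is tor (n - k). A first-order formula is, uniformly for large n, a boolean
   combination of conditions "t is in tor k" or "t is in tor (n - k)" on linear combinations t of the variables.
   Indeed in one variable these define cosets of members of the chain, any two of which are nested or
   disjoint, and proper inclusions have index at least p^n, so that finitely many smaller cosets never exhaust
   a larger one. The same elimination counts solutions: a definable set has size p^(n(un + v)) up to
   a bounded factor, where (u, v) is determined by the parameters through finitely many such conditions.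

   By Los's theorem this gives (DC). For conjunctions of instances of a single formula only the shapes of the
   conditions matter, hence (u, v) takes finitely many values, which is (A). Stability follows with Ramsey's
   theorem, because a condition f(x) = g(y) modulo a subgroup cannot order an infinite sequence.
   Superstability fails along the cosets b_k + p^k G with b_k = e_0 + p e_1 + ... + p^(k-1) e_(k-1): permuting the
   coordinates shows that each of them divides over the previous parameters. *)

theory Submission
  imports Defs "HOL-Library.Product_Lexorder" "HOL-Library.Option_ord" "HOL-Library.Ramsey"
    "HOL-Library.Countable_Set"
begin

subsection \<open>Terms and formulas\<close>

text \<open>Elimination is semantic. Instead of a normal form for formulas, \<open>det S N F\<close>
  says that \<open>F n e\<close> depends only on which of the finitely many atoms in
  \<open>S\<close> hold, in the same way for all \<open>n \<ge> N\<close>. As \<open>F\<close> may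
  take values in any type, truth values and levels \<open>(u, v)\<close> pass through one
  back-and-forth argument between different \<open>n\<close>, and only \<open>definable\<close>
  returns to formulas. The quantified variable may carry any integer coefficient. Its part prime to
  p acts invertibly, so only its p-adic valuation matters, which shifts the level of a coset.
  Thresholds for \<open>n\<close> and factors of proportionality grow with the number of atoms. This
  is harmless for (A): dimensions absorb bounded factors, and only the levels have to come from a
  finite set fixed beforehand. Stability speaks of models on an arbitrary infinite type, whereas the
  ultraproduct has a type of its own. Universal closures carry the elimination to all models of the
  theory; for the failure of superstability a countable elementary submodel is moved to the given
  type.\<close>

lemma finite_tvars [simp]: "finite (tvars t)"
  by (induction t) auto

lemma finite_fvars [simp]: "finite (fvars \<phi>)"
  by (induction \<phi>) auto

lemma tval_cong: "(\<And>i. i \<in> tvars t \<Longrightarrow> e i = e' i) \<Longrightarrow> tval G e t = tval G e' t"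
  by (induction t) auto

lemma sat_cong: "(\<And>i. i \<in> fvars \<phi> \<Longrightarrow> e i = e' i) \<Longrightarrow> sat G e \<phi> \<longleftrightarrow> sat G e' \<phi>"
proof (induction \<phi> arbitrary: e e')
  case (Eq t u)
  then have "tval G e t = tval G e' t" "tval G e u = tval G e' u"
    by (auto intro: tval_cong)
  then show ?case by simp
next
  case (Neg \<phi>)
  from Neg.IH[of e e'] Neg.prems show ?case by simp
next
  case (Conj \<phi> \<psi>)
  from Conj.IH(1)[of e e'] Conj.IH(2)[of e e'] Conj.prems show ?case by simp
next
  case (Exi i \<phi>)
  have "sat G (e(i := a)) \<phi> = sat G (e'(i := a)) \<phi>" for a
    by (rule Exi.IH) (use Exi.prems in auto)
  then show ?case by simp
qed

lemma tval_closed: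
  assumes "group G" "\<And>i. i \<in> tvars t \<Longrightarrow> e i \<in> carrier G"
  shows "tval G e t \<in> carrier G"
proof -
  interpret group G by fact
  show ?thesis using assms(2) by (induction t) auto
qed

lemma tval_hom:
  assumes "group G" "group H" "h \<in> hom G H" "\<And>i. i \<in> tvars t \<Longrightarrow> e i \<in> carrier G"
  shows "tval H (h \<circ> e) t = h (tval G e t)"
proof -
  interpret group_hom G H h by (simp add: assms group_hom_def group_hom_axioms_def)
  show ?thesis using assms(4)
  proof (induction t)
    case (Inv t)
    then show ?case using tval_closed[OF assms(1), of t e] by simp
  next
    case (Mul t u)
    then show ?case using tval_closed[OF assms(1), of t e] tval_closed[OF assms(1), of u e] by simp
  qed auto
qed

lemma sat_iso:
  assumes "group G" "group H" "h \<in> iso G H" "\<And>i. i \<in> fvars \<phi> \<Longrightarrow> e i \<in> carrier G"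
  shows "sat H (h \<circ> e) \<phi> \<longleftrightarrow> sat G e \<phi>"
  using assms(4)
proof (induction \<phi> arbitrary: e)
  have hom: "h \<in> hom G H" and bij: "bij_betw h (carrier G) (carrier H)"
    using assms(3) by (auto simp: iso_def)
  case (Eq t u)
  have "tval G e t \<in> carrier G" "tval G e u \<in> carrier G"
    using Eq assms(1) by (auto intro!: tval_closed)
  then show ?case
    using Eq tval_hom[OF assms(1,2) hom, of t e] tval_hom[OF assms(1,2) hom, of u e] bij
    by (simp only: sat.simps fvars.simps Un_iff) (metis bij_betw_def inj_on_def)
next
  case (Exi i \<phi>)
  have bij: "bij_betw h (carrier G) (carrier H)"
    using assms(3) by (auto simp: iso_def)
  have "sat H (h \<circ> e(i := a)) \<phi> = sat G (e(i := a)) \<phi>" if "a \<in> carrier G" for a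
    by (rule Exi.IH) (use Exi.prems that in auto)
  moreover have "h \<circ> e(i := a) = (h \<circ> e)(i := h a)" for a by auto
  ultimately have "sat H ((h \<circ> e)(i := h a)) \<phi> = sat G (e(i := a)) \<phi>"
    if "a \<in> carrier G" for a using that by metis
  moreover have "carrier H = h ` carrier G" using bij by (auto simp: bij_betw_def)
  ultimately show ?case unfolding sat.simps by (metis (no_types, lifting) imageE imageI)
qed auto

section \<open>Terms as integer linear forms\<close>

primrec tpow :: "gterm \<Rightarrow> nat \<Rightarrow> gterm" where
  "tpow t 0 = Unit"
| "tpow t (Suc k) = Mul (tpow t k) t"

definition tipow :: "gterm \<Rightarrow> int \<Rightarrow> gterm" where
  "tipow t z = (if z < 0 then Inv (tpow t (nat (- z))) else tpow t (nat z))"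

lemma tvars_tpow: "tvars (tpow t k) \<subseteq> tvars t"
  by (induction k) auto

lemma tvars_tipow: "tvars (tipow t z) \<subseteq> tvars t"
  using tvars_tpow by (simp add: tipow_def)

lemma tval_tpow: "tval G e (tpow t k) = tval G e t [^]\<^bsub>G\<^esub> k"
  by (induction k) auto

lemma tval_tipow: "tval G e (tipow t z) = tval G e t [^]\<^bsub>G\<^esub> z"
  by (simp add: tipow_def int_pow_def2 tval_tpow del: pow_nat)

text \<open>In an abelian group a term is a linear form with integer coefficients.
  \<open>coef\<close> and \<open>rest\<close> split off one variable; \<open>tval_split\<close> is
  the resulting identity.\<close>

primrec coef :: "nat \<Rightarrow> gterm \<Rightarrow> int" where
  "coef i (Var j) = (if i = j then 1 else 0)"
| "coef i Unit = 0"
| "coef i (Inv t) = - coef i t"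
| "coef i (Mul t u) = coef i t + coef i u"

primrec rest :: "nat \<Rightarrow> gterm \<Rightarrow> gterm" where
  "rest i (Var j) = (if i = j then Unit else Var j)"
| "rest i Unit = Unit"
| "rest i (Inv t) = Inv (rest i t)"
| "rest i (Mul t u) = Mul (rest i t) (rest i u)"

primrec tren :: "(nat \<Rightarrow> nat) \<Rightarrow> gterm \<Rightarrow> gterm" where
  "tren f (Var j) = Var (f j)"
| "tren f Unit = Unit"
| "tren f (Inv t) = Inv (tren f t)"
| "tren f (Mul t u) = Mul (tren f t) (tren f u)"

lemma tvars_rest [simp]: "tvars (rest i t) = tvars t - {i}"
  by (induction t) auto

lemma coef_rest: "coef j (rest i t) = (if j = i then 0 else coef j t)"
  by (induction t) auto

lemma coef_tpow: "coef j (tpow t k) = int k * coef j t"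
  by (induction k) (auto simp: algebra_simps)

lemma coef_tipow: "coef j (tipow t z) = z * coef j t"
  by (auto simp: tipow_def coef_tpow)

lemma tval_tren: "tval G e (tren f t) = tval G (e \<circ> f) t"
  by (induction t) auto

lemma tvars_tren: "tvars (tren f t) = f ` tvars t"
  by (induction t) auto

lemma coef_tren:
  assumes "\<And>j. f j = i \<longleftrightarrow> j = i"
  shows "coef i (tren f t) = coef i t"
proof -
  have "i = f j \<longleftrightarrow> i = j" for j using assms by metis
  then show ?thesis by (induction t) auto
qed

lemma tval_mult:
  assumes "comm_group G"
    and "\<And>i. i \<in> tvars t \<Longrightarrow> e i \<in> carrier G" "\<And>i. i \<in> tvars t \<Longrightarrow> e' i \<in> carrier G"
  shows "tval G (\<lambda>i. e i \<otimes>\<^bsub>G\<^esub> e' i) t = tval G e t \<otimes>\<^bsub>G\<^esub> tval G e' t"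
proof -
  interpret comm_group G by fact
  show ?thesis using assms(2,3)
  proof (induction t)
    case (Inv t)
    then show ?case using tval_closed[OF is_group, of t e] tval_closed[OF is_group, of t e']
      by (simp add: inv_mult)
  next
    case (Mul t u)
    then show ?case
      using tval_closed[OF is_group, of t e] tval_closed[OF is_group, of t e']
        tval_closed[OF is_group, of u e] tval_closed[OF is_group, of u e']
      by (simp add: m_ac)
  qed auto
qed

lemma tval_split:
  assumes "comm_group G" "\<And>i. i \<in> tvars t \<Longrightarrow> e i \<in> carrier G" "a \<in> carrier G"
  shows "tval G (e(i := a)) t = a [^]\<^bsub>G\<^esub> coef i t \<otimes>\<^bsub>G\<^esub> tval G e (rest i t)"
proof -
  interpret comm_group G by fact
  show ?thesis using assms(2)
  proof (induction t)
    case (Inv t)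
    have c: "tval G e (rest i t) \<in> carrier G"
      using Inv by (intro tval_closed) (auto simp: is_group)
    then show ?case using Inv assms(3) by (simp add: inv_mult int_pow_neg)
  next
    case (Mul t u)
    have c: "tval G e (rest i t) \<in> carrier G" "tval G e (rest i u) \<in> carrier G"
      using Mul by (auto intro!: tval_closed simp: is_group)
    then show ?case using Mul assms(3) by (simp add: int_pow_mult m_ac)
  qed (use assms(3) in auto)
qed

subsection \<open>The torsion filtration\<close>

text \<open>The exponent is an integer power, so that \<open>int_pow_pow\<close> combines it with
  the integer coefficients of terms.\<close>

definition torn :: "'a monoid \<Rightarrow> nat \<Rightarrow> nat \<Rightarrow> 'a set" where
  "torn G p j = {x \<in> carrier G. x [^]\<^bsub>G\<^esub> (int p ^ j) = \<one>\<^bsub>G\<^esub>}"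

text \<open>What the elimination uses of a free module of rank n over Z/p^n: its exponent, the
  divisibility of \<open>p ^ m\<close>-torsion elements by \<open>p ^ (n - m)\<close>, and the
  orders of the torsion subgroups.\<close>

locale homog = comm_group G for G :: "'a monoid" (structure) +
  fixes p n :: nat
  assumes prime_p: "prime p"
    and exponent: "x \<in> carrier G \<Longrightarrow> x [^] (int p ^ n) = \<one>"
    and root: "x \<in> torn G p m \<Longrightarrow> m \<le> n \<Longrightarrow> \<exists>y\<in>carrier G. x = y [^] (int p ^ (n - m))"
    and card_torn': "m \<le> n \<Longrightarrow> card (torn G p m) = p ^ (n * m)"
begin

abbreviation tor :: "nat \<Rightarrow> 'a set" where "tor \<equiv> torn G p"
abbreviation v :: "int \<Rightarrow> nat" where "v \<equiv> multiplicity (int p)"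

lemma prime_int_p: "prime (int p)" using prime_p by simp

lemma tor_carrier: "x \<in> tor j \<Longrightarrow> x \<in> carrier G"
  by (simp add: torn_def)

lemma tor_subgroup: "subgroup (tor j) G"
  by (rule subgroupI) (auto simp: torn_def int_pow_distrib int_pow_inv)

lemma tor_mono: assumes "i \<le> j" shows "tor i \<subseteq> tor j"
proof -
  have "int p ^ j = int p ^ i * int p ^ (j - i)" using assms by (simp flip: power_add)
  then show ?thesis by (auto simp: torn_def simp flip: int_pow_pow)
qed

lemma tor_top: assumes "n \<le> j" shows "tor j = carrier G"
  using tor_mono[OF assms] exponent by (auto simp: torn_def)

lemma finite_carrier: "finite (carrier G)"
proof -
  have "card (tor n) > 0" using card_torn'[of n] prime_p prime_gt_0_nat by simp
  then show ?thesis by (metis card_gt_0_iff tor_top order_refl)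
qed

lemma card_tor: "card (tor j) = p ^ (n * min j n)"
  using card_torn'[of "min j n"] tor_top[of j] tor_top[of n] by (cases "j \<le> n") (auto simp: min_def)

lemma decomp:
  assumes "c \<noteq> 0"
  obtains d where "c = int p ^ v c * d" "coprime d (int p)"
proof -
  obtain d where d: "c = int p ^ v c * d" "\<not> int p dvd d"
    using multiplicity_decompose'[of c "int p"] assms prime_int_p not_prime_unit by blast
  then show ?thesis using prime_imp_coprime[OF prime_int_p] that by (metis coprime_commute)
qed

lemma bezout:
  assumes "coprime d (int p)"
  obtains a b where "a * d + b * int p ^ n = 1"
  using assms bezout_int[of d "int p ^ n"] coprime_power_right_iff[of d "int p" n]
  by (metis coprime_imp_gcd_eq_1)

text \<open>By Bezout, d is invertible modulo the exponent \<open>p ^ n\<close>, so the d-th power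
  map is bijective; this lemma and \<open>unit_root\<close> are the two halves.\<close>

lemma unit_pow_eq_one:
  assumes "coprime d (int p)" "x \<in> carrier G"
  shows "x [^] d = \<one> \<longleftrightarrow> x = \<one>"
proof
  assume x: "x [^] d = \<one>"
  obtain a b where ab: "a * d + b * int p ^ n = 1" using bezout assms(1) .
  have "x = x [^] (d * a + int p ^ n * b)" using ab assms by (simp add: mult.commute)
  also have "\<dots> = \<one>" using assms x exponent by (simp add: int_pow_mult flip: int_pow_pow)
  finally show "x = \<one>" .
qed simp

lemma unit_root:
  assumes "coprime d (int p)" "y \<in> carrier G"
  shows "\<exists>x\<in>carrier G. x [^] d = y"
proof -
  obtain a b where ab: "a * d + b * int p ^ n = 1" using bezout assms(1) .
  have "y = y [^] (a * d + int p ^ n * b)" using ab assms by (simp add: mult.commute)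
  also have "\<dots> = (y [^] a) [^] d" using assms exponent by (simp add: int_pow_mult flip: int_pow_pow)
  finally show ?thesis using assms by (metis int_pow_closed)
qed

text \<open>The part of c prime to p acts invertibly, and the remaining power of p raises the level
  by its exponent.\<close>

lemma tor_pow_iff:
  assumes "c \<noteq> 0" "x \<in> carrier G"
  shows "x [^] c \<in> tor j \<longleftrightarrow> x \<in> tor (j + v c)"
proof -
  obtain d where d: "c = int p ^ v c * d" "coprime d (int p)" using decomp assms(1) .
  have "c * int p ^ j = int p ^ (j + v c) * d"
    by (metis d(1) power_add mult.assoc mult.commute)
  then have "(x [^] c) [^] (int p ^ j) = x [^] (int p ^ (j + v c) * d)"
    using assms(2) by (simp add: int_pow_pow)
  also have "\<dots> = (x [^] (int p ^ (j + v c))) [^] d" using assms by (simp add: int_pow_pow)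
  finally show ?thesis using unit_pow_eq_one[OF d(2), of "x [^] (int p ^ (j + v c))"] assms
    by (simp add: torn_def)
qed

lemma pow_in_tor:
  assumes "c \<noteq> 0" "x \<in> carrier G"
  shows "x [^] c \<in> tor (n - v c)"
  using assms tor_top[of "n - v c + v c"] by (simp add: tor_pow_iff)

lemma tor_root:
  assumes "c \<noteq> 0" "y \<in> tor (n - v c)"
  shows "\<exists>x\<in>carrier G. x [^] c = y"
proof (cases "v c \<le> n")
  case True
  obtain d where d: "c = int p ^ v c * d" "coprime d (int p)" using decomp assms(1) .
  obtain z where z: "z \<in> carrier G" "y = z [^] (int p ^ v c)"
    using root[of y "n - v c"] assms(2) True by auto
  obtain x where x: "x \<in> carrier G" "x [^] d = z" using unit_root[OF d(2) z(1)] by blast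
  have "x [^] c = (x [^] d) [^] (int p ^ v c)"
    using d(1) x(1) by (metis int_pow_pow mult.commute)
  then show ?thesis using x z by auto
next
  case False
  \<comment> \<open>Truncated subtraction makes the level 0 here, and \<open>tor 0\<close> is
    trivial.\<close>
  then have "y = \<one>" using assms(2) by (auto simp: torn_def)
  then show ?thesis by (intro bexI[of _ \<one>]) auto
qed

text \<open>Solvability means that t lies in the product of \<open>tor j\<close> with the group of
  c-th powers, which is \<open>tor (n - v c)\<close>; in a chain the product of two subgroups is the
  larger one.\<close>

lemma solvable_iff:
  assumes "c \<noteq> 0" "t \<in> carrier G"
  shows "(\<exists>a\<in>carrier G. a [^] c \<otimes> t \<in> tor j) \<longleftrightarrow> t \<in> tor j \<or> t \<in> tor (n - v c)"
proof
  assume "\<exists>a\<in>carrier G. a [^] c \<otimes> t \<in> tor j"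
  then obtain a where a: "a \<in> carrier G" "a [^] c \<otimes> t \<in> tor j" by blast
  define m where "m = max j (n - v c)"
  interpret T: subgroup "tor m" G by (rule tor_subgroup)
  have "a [^] c \<otimes> t \<in> tor m" "a [^] c \<in> tor m"
    using a pow_in_tor[OF assms(1) a(1)] tor_mono[of j m] tor_mono[of "n - v c" m]
    by (auto simp: m_def)
  then have "inv (a [^] c) \<otimes> (a [^] c \<otimes> t) \<in> tor m" by simp
  then have "t \<in> tor m" using a assms by (simp flip: m_assoc)
  then show "t \<in> tor j \<or> t \<in> tor (n - v c)" by (auto simp: m_def max_def split: if_splits)
next
  assume "t \<in> tor j \<or> t \<in> tor (n - v c)"
  then show "\<exists>a\<in>carrier G. a [^] c \<otimes> t \<in> tor j"
  proof
    assume "t \<in> tor j"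
    then show ?thesis using assms by (intro bexI[of _ \<one>]) auto
  next
    assume "t \<in> tor (n - v c)"
    then have "inv t \<in> tor (n - v c)" by (rule subgroup.m_inv_closed[OF tor_subgroup])
    then obtain a where "a \<in> carrier G" "a [^] c = inv t" using tor_root[OF assms(1)] by blast
    then show ?thesis using assms by (intro bexI[of _ a]) (auto simp: torn_def)
  qed
qed

text \<open>Translation by one solution b identifies the solutions with
  \<open>tor (j + v c)\<close>; the minimum with n caps the level at the whole group.\<close>

lemma card_coset:
  assumes "c \<noteq> 0" "t \<in> carrier G" "b \<in> carrier G" "b [^] c \<otimes> t \<in> tor j"
  shows "card {a \<in> carrier G. a [^] c \<otimes> t \<in> tor j} = p ^ (n * min (j + v c) n)"
proof -
  interpret T: subgroup "tor j" G by (rule tor_subgroup)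
  have iff: "(b \<otimes> x) [^] c \<otimes> t \<in> tor j \<longleftrightarrow> x \<in> tor (j + v c)" if "x \<in> carrier G" for x
  proof -
    have "(b \<otimes> x) [^] c \<otimes> t = x [^] c \<otimes> (b [^] c \<otimes> t)"
      using assms that by (simp add: int_pow_distrib m_ac)
    moreover have "x [^] c \<otimes> (b [^] c \<otimes> t) \<in> tor j \<longleftrightarrow> x [^] c \<in> tor j"
    proof
      assume "x [^] c \<otimes> (b [^] c \<otimes> t) \<in> tor j"
      then have "x [^] c \<otimes> (b [^] c \<otimes> t) \<otimes> inv (b [^] c \<otimes> t) \<in> tor j" using assms by simp
      then show "x [^] c \<in> tor j" using assms that by (simp add: m_assoc)
    qed (use assms in simp)
    ultimately show ?thesis using tor_pow_iff[OF assms(1) that] by simp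
  qed
  have "bij_betw (\<lambda>x. b \<otimes> x) (tor (j + v c)) {a \<in> carrier G. a [^] c \<otimes> t \<in> tor j}"
  proof (rule bij_betw_imageI)
    show "inj_on (\<lambda>x. b \<otimes> x) (tor (j + v c))"
      using assms tor_carrier by (auto simp: inj_on_def)
    show "(\<lambda>x. b \<otimes> x) ` tor (j + v c) = {a \<in> carrier G. a [^] c \<otimes> t \<in> tor j}"
    proof (intro Set.set_eqI iffI)
      fix a assume a: "a \<in> {a \<in> carrier G. a [^] c \<otimes> t \<in> tor j}"
      have "a = b \<otimes> (inv b \<otimes> a)" using a assms by (simp flip: m_assoc)
      moreover from this have "inv b \<otimes> a \<in> tor (j + v c)"
        using a assms iff[of "inv b \<otimes> a"] by simp
      ultimately show "a \<in> (\<lambda>x. b \<otimes> x) ` tor (j + v c)" by blast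
    qed (use assms iff tor_carrier in auto)
  qed
  from bij_betw_same_card[OF this] show ?thesis by (simp add: card_tor)
qed

lemma card_coset_le:
  assumes "c \<noteq> 0" "t \<in> carrier G"
  shows "card {a \<in> carrier G. a [^] c \<otimes> t \<in> tor j} \<le> p ^ (n * min (j + v c) n)"
proof (cases "\<exists>b\<in>carrier G. b [^] c \<otimes> t \<in> tor j")
  case True
  then show ?thesis using card_coset[OF assms] by auto
next
  case False
  then have "{a \<in> carrier G. a [^] c \<otimes> t \<in> tor j} = {}" by blast
  then show ?thesis by (simp only: card.empty)
qed

lemma v_div_gcd:
  assumes "c \<noteq> 0" "d \<noteq> 0"
  shows "v (c div gcd c d) = v c - v d"
proof -
  have c: "c = gcd c d * (c div gcd c d)" by simp
  have nz: "gcd c d \<noteq> 0" "c div gcd c d \<noteq> 0" using assms c by (simp, metis mult_zero_right)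
  have "v c = v (gcd c d) + v (c div gcd c d)"
    by (subst c, rule prime_elem_multiplicity_mult_distrib) (use nz prime_int_p in auto)
  moreover have "v (gcd c d) = min (v c) (v d)"
    using assms prime_int_p by (intro multiplicity_gcd) auto
  ultimately show ?thesis by (simp add: min_def split: if_splits)
qed

text \<open>Since the subgroups \<open>tor j\<close> form a chain, two cosets \<open>{a. a [^] c \<otimes> t \<in> tor j}\<close> are nested or
  disjoint; which of the two is decided by the parameters \<open>t\<close>.\<close>

lemma coset_compare:
  assumes nz: "c \<noteq> 0" "d \<noteq> 0" and a: "a \<in> carrier G" and tu: "t \<in> carrier G" "u \<in> carrier G"
    and in1: "a [^] c \<otimes> t \<in> tor i" and le: "i + v c \<le> j + v d"
  shows "a [^] d \<otimes> u \<in> tor j \<longleftrightarrow>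
    t [^] (d div gcd c d) \<otimes> inv (u [^] (c div gcd c d)) \<in> tor (j - (v c - v d))"
proof -
  \<comment> \<open>The cofactors satisfy \<open>c * \<alpha> = d * \<beta>\<close>, so the powers
    of \<open>a\<close> cancel between \<open>x [^] \<alpha>\<close> and
    \<open>y [^] \<beta>\<close>, leaving a condition on the parameters.\<close>
  define \<alpha> \<beta> where "\<alpha> = d div gcd c d" and "\<beta> = c div gcd c d"
  have \<alpha>\<beta>: "\<alpha> \<noteq> 0" "\<beta> \<noteq> 0" "c * \<alpha> = d * \<beta>"
  proof -
    have *: "c = gcd c d * \<beta>" "d = gcd c d * \<alpha>" by (auto simp: \<alpha>_def \<beta>_def)
    show "\<alpha> \<noteq> 0" "\<beta> \<noteq> 0" using * nz by auto
    show "c * \<alpha> = d * \<beta>" by (subst *(1), subst (2) *(2)) simp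
  qed
  have va: "v \<alpha> = v d - v c" using v_div_gcd[OF nz(2,1)] by (simp add: \<alpha>_def gcd.commute)
  have vb: "v \<beta> = v c - v d" using v_div_gcd[OF nz] by (simp add: \<beta>_def)
  define k where "k = j - (v c - v d)"
  interpret T: subgroup "tor k" G by (rule tor_subgroup)
  define x y z where "x = a [^] c \<otimes> t" and "y = a [^] d \<otimes> u" and "z = t [^] \<alpha> \<otimes> inv (u [^] \<beta>)"
  have cl: "x \<in> carrier G" "y \<in> carrier G" "z \<in> carrier G"
    using a tu by (auto simp: x_def y_def z_def)
  have "x [^] \<alpha> = a [^] (c * \<alpha>) \<otimes> t [^] \<alpha>"
    using a tu by (simp add: x_def int_pow_distrib int_pow_pow)
  moreover have "y [^] \<beta> = a [^] (c * \<alpha>) \<otimes> u [^] \<beta>"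
    using a tu \<alpha>\<beta> by (simp add: y_def int_pow_distrib int_pow_pow)
  ultimately have xyz: "x [^] \<alpha> = y [^] \<beta> \<otimes> z"
    using a tu by (simp add: z_def m_ac) (simp add: m_assoc[symmetric])
  \<comment> \<open>At least one of \<open>v \<alpha>\<close> and \<open>v \<beta>\<close> is 0, and
    \<open>le\<close> keeps the subtraction in \<open>k\<close> from truncating.\<close>
  have "i \<le> k + v \<alpha>" using le va by (simp add: k_def)
  then have xa: "x [^] \<alpha> \<in> tor k"
    using in1 tor_pow_iff[OF \<alpha>\<beta>(1) cl(1), of k] tor_mono[of i "k + v \<alpha>"] by (auto simp: x_def)
  have "k + v \<beta> = j" using le vb by (simp add: k_def)
  then have "y \<in> tor j \<longleftrightarrow> y [^] \<beta> \<in> tor k" using tor_pow_iff[OF \<alpha>\<beta>(2) cl(2), of k] by simp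
  also have "\<dots> \<longleftrightarrow> z \<in> tor k"
  proof
    assume "z \<in> tor k"
    then have "x [^] \<alpha> \<otimes> inv z \<in> tor k" using xa by simp
    then show "y [^] \<beta> \<in> tor k" using cl xyz by (simp add: m_assoc)
  next
    assume "y [^] \<beta> \<in> tor k"
    then have "inv (y [^] \<beta>) \<otimes> x [^] \<alpha> \<in> tor k" using xa by simp
    then show "z \<in> tor k" using cl xyz by (simp flip: m_assoc)
  qed
  finally show ?thesis by (simp add: y_def z_def \<alpha>_def \<beta>_def k_def)
qed

end

subsection \<open>The groups \<open>(\<int>/p\<^sup>n\<int>)\<^sup>n\<close>\<close>

lemma group_Zpn [simp]: "group (Zpn_pow p n)"
  by (simp add: Zpn_pow_def)

lemma comm_group_Zpn: "comm_group (Zpn_pow p n)"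
proof (rule group.group_comm_groupI)
  show "x \<otimes>\<^bsub>Zpn_pow p n\<^esub> y = y \<otimes>\<^bsub>Zpn_pow p n\<^esub> x" for x y
    by (simp add: Zpn_pow_def add.commute cong: restrict_cong)
qed simp

lemma carrier_Zpn:
  assumes "p > 0"
  shows "carrier (Zpn_pow p n) = (\<Pi>\<^sub>E i\<in>{..<n}. {0..<int p ^ n})"
  using assms by (simp add: Zpn_pow_def carrier_integer_mod_group)

lemma one_Zpn: "\<one>\<^bsub>Zpn_pow p n\<^esub> = (\<lambda>i\<in>{..<n}. 0)"
  by (simp add: Zpn_pow_def)

lemma mult_Zpn: "x \<otimes>\<^bsub>Zpn_pow p n\<^esub> y = (\<lambda>i\<in>{..<n}. (x i + y i) mod int p ^ n)"
  by (simp add: Zpn_pow_def)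

lemma nat_pow_Zpn:
  assumes "x \<in> carrier (Zpn_pow p n)" "p > 0"
  shows "x [^]\<^bsub>Zpn_pow p n\<^esub> (k::nat) = (\<lambda>i\<in>{..<n}. (int k * x i) mod int p ^ n)"
proof (induction k)
  case 0
  then show ?case by (simp add: one_Zpn cong: restrict_cong)
next
  case (Suc k)
  interpret group "Zpn_pow p n" by simp
  show ?case
    using Suc by (auto simp: mult_Zpn restrict_def fun_eq_iff mod_simps algebra_simps)
qed

lemma pow_Zpn:
  assumes "x \<in> carrier (Zpn_pow p n)" "p > 0"
  shows "x [^]\<^bsub>Zpn_pow p n\<^esub> (int p ^ j) = (\<lambda>i\<in>{..<n}. (int p ^ j * x i) mod int p ^ n)"
  using nat_pow_Zpn[OF assms, of "p ^ j"] int_pow_int[of "Zpn_pow p n" x "p ^ j"] by simp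

lemma torn_Zpn:
  assumes "p > 0" "m \<le> n"
  shows "torn (Zpn_pow p n) p m = (\<Pi>\<^sub>E i\<in>{..<n}. (\<lambda>z. int p ^ (n - m) * z) ` {0..<int p ^ m})"
    (is "?L = ?R")
proof -
  have pn: "int p ^ n = int p ^ m * int p ^ (n - m)" using assms by (simp flip: power_add)
  have 1: "int p ^ m * y mod int p ^ n = 0 \<longleftrightarrow> int p ^ (n - m) dvd y" for y
    using assms unfolding pn by (simp flip: dvd_eq_mod_eq_0)
  have 2: "{y \<in> {0..<int p ^ n}. int p ^ (n - m) dvd y} = (\<lambda>z. int p ^ (n - m) * z) ` {0..<int p ^ m}"
    (is "?A = ?B")
  proof (intro Set.set_eqI iffI)
    fix y assume "y \<in> ?A"
    then obtain z where z: "y = int p ^ (n - m) * z" and y: "0 \<le> y" "y < int p ^ n" by auto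
    have pos: "int p ^ (n - m) > 0" using assms by simp
    have "0 \<le> z" using y(1) z pos by (simp add: zero_le_mult_iff)
    moreover have "z < int p ^ m" using y(2) pos by (simp add: z pn mult.commute[of "int p ^ m"])
    ultimately show "y \<in> ?B" using z by auto
  next
    fix y assume "y \<in> ?B"
    then obtain z where z: "y = int p ^ (n - m) * z" and zz: "0 \<le> z" "z < int p ^ m"
      by (meson atLeastLessThan_iff imageE)
    have pos: "int p ^ (n - m) > 0" using assms by simp
    show "y \<in> ?A" using zz pos by (simp add: z pn mult.commute[of "int p ^ m"])
  qed
  have "?L = (\<Pi>\<^sub>E i\<in>{..<n}. {y \<in> {0..<int p ^ n}. int p ^ (n - m) dvd y})" (is "_ = ?M")
  proof (intro Set.set_eqI iffI)
    fix x assume x: "x \<in> ?L"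
    then have xc: "x \<in> carrier (Zpn_pow p n)" by (simp add: torn_def)
    have "(\<lambda>i\<in>{..<n}. (int p ^ m * x i) mod int p ^ n) = (\<lambda>i\<in>{..<n}. 0)"
      using x pow_Zpn[OF xc assms(1), of m] by (simp add: torn_def one_Zpn)
    from fun_cong[OF this] have "(int p ^ m * x i) mod int p ^ n = 0" if "i < n" for i
      using that by (metis lessThan_iff restrict_apply')
    then show "x \<in> ?M" using xc 1 assms by (auto simp: carrier_Zpn PiE_iff)
  next
    fix x assume x: "x \<in> ?M"
    then have xc: "x \<in> carrier (Zpn_pow p n)" using assms by (auto simp: carrier_Zpn PiE_iff)
    have "(\<lambda>i\<in>{..<n}. (int p ^ m * x i) mod int p ^ n) = (\<lambda>i\<in>{..<n}. 0)"
      using x 1 by (auto simp: PiE_iff intro!: restrict_ext)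
    then show "x \<in> ?L" using xc pow_Zpn[OF xc assms(1), of m] by (simp add: torn_def one_Zpn)
  qed
  then show ?thesis by (simp only: 2)
qed

lemma homog_Zpn:
  assumes "prime p"
  shows "homog (Zpn_pow p n) p n"
proof -
  have p0: "p > 0" using assms prime_gt_0_nat by blast
  interpret comm_group "Zpn_pow p n" by (rule comm_group_Zpn)
  show ?thesis
  proof (unfold_locales)
    fix x assume x: "x \<in> carrier (Zpn_pow p n)"
    show "x [^]\<^bsub>Zpn_pow p n\<^esub> (int p ^ n) = \<one>\<^bsub>Zpn_pow p n\<^esub>"
      unfolding pow_Zpn[OF x p0] one_Zpn by (auto intro!: restrict_ext)
  next
    fix x m assume x: "x \<in> torn (Zpn_pow p n) p m" and m: "m \<le> n"
    then have x': "x \<in> (\<Pi>\<^sub>E i\<in>{..<n}. (\<lambda>z. int p ^ (n - m) * z) ` {0..<int p ^ m})"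
      using torn_Zpn p0 by simp
    then have "\<forall>i\<in>{..<n}. \<exists>z\<in>{0..<int p ^ m}. x i = int p ^ (n - m) * z"
      by (auto simp: PiE_iff)
    then obtain z where z: "\<And>i. i < n \<Longrightarrow> z i \<in> {0..<int p ^ m}" "\<And>i. i < n \<Longrightarrow> x i = int p ^ (n - m) * z i"
      by (metis lessThan_iff)
    have le: "int p ^ m \<le> int p ^ n" using m p0 by (simp add: power_increasing)
    have zc: "restrict z {..<n} \<in> carrier (Zpn_pow p n)"
      using z(1) le by (fastforce simp: carrier_Zpn[OF p0])
    have xc: "x \<in> carrier (Zpn_pow p n)" using x by (simp add: torn_def)
    have "x = restrict z {..<n} [^]\<^bsub>Zpn_pow p n\<^esub> (int p ^ (n - m))"
    proof
      fix i
      show "x i = (restrict z {..<n} [^]\<^bsub>Zpn_pow p n\<^esub> (int p ^ (n - m))) i"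
        unfolding pow_Zpn[OF zc p0]
        using z(2)[of i, symmetric] xc by (auto simp: carrier_Zpn[OF p0] PiE_iff extensional_def)
    qed
    then show "\<exists>y\<in>carrier (Zpn_pow p n). x = y [^]\<^bsub>Zpn_pow p n\<^esub> (int p ^ (n - m))"
      using zc by blast
  next
    fix m assume m: "m \<le> n"
    have "card ((\<lambda>z. int p ^ (n - m) * z) ` {0..<int p ^ m}) = p ^ m"
      using p0 by (subst card_image) (auto simp: inj_on_def nat_power_eq)
    then show "card (torn (Zpn_pow p n) p m) = p ^ (n * m)"
      by (simp add: torn_Zpn[OF p0 m] card_PiE power_mult[symmetric] mult.commute)
  qed (rule assms)
qed

subsection \<open>Atoms and their elimination\<close>

declare split_paired_All [simp del] split_paired_Ex [simp del]

text \<open>The atom \<open>(b, k, t)\<close> says that \<open>p\<^sup>k\<close> divides \<open>t\<close> (if \<open>b\<close>) or that \<open>p\<^sup>k t = 0\<close> (if not \<open>b\<close>). In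
  \<open>(\<int>/p\<^sup>n\<int>)\<^sup>n\<close> with \<open>n \<ge> k\<close> both say that \<open>t\<close> lies in a term of the torsion filtration.\<close>

type_synonym atom = "bool \<times> nat \<times> gterm"

definition lev :: "nat \<Rightarrow> bool \<Rightarrow> nat \<Rightarrow> nat" where
  "lev n b k = (if b then n - k else k)"

text \<open>\<open>(u, v)\<close> stands for the level \<open>un + v\<close> of the filtration of \<open>(\<int>/p\<^sup>n\<int>)\<^sup>n\<close>.\<close>

definition hv :: "nat \<Rightarrow> nat \<times> int \<Rightarrow> int" where
  "hv n q = int (fst q) * int n + snd q"

text \<open>Always true, with a nonzero coefficient at i. Adding it to a set of atoms makes the
  minimum in \<open>mh\<close> range over a nonempty set.\<close>

definition triv :: "nat \<Rightarrow> atom" where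
  "triv i = (True, 0, Var i)"

text \<open>A difference in u contributes at least n, which outweighs the fixed second components
  once n is large.\<close>

lemma eventually_lex:
  "eventually (\<lambda>n. hv n q \<le> hv n q' \<longleftrightarrow> q \<le> q') sequentially"
proof -
  obtain u v u' v' where q: "q = (u, v)" "q' = (u', v')" by (cases q, cases q') auto
  have *: "hv n (u, v) < hv n (u', v')" if "u < u'" "nat (\<bar>v\<bar> + \<bar>v'\<bar> + 1) \<le> n" for u v u' v' n
  proof -
    have "int u * int n + int n \<le> int u' * int n"
      using that(1) mult_right_mono[of "int u + 1" "int u'" "int n"] by (simp add: algebra_simps)
    then show ?thesis using that(2) by (simp add: hv_def)
  qed
  show ?thesis
  proof (rule eventually_sequentiallyI)
    fix n assume n: "nat (\<bar>v\<bar> + \<bar>v'\<bar> + 1) \<le> n"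
    consider "u < u'" | "u = u'" | "u' < u" by linarith
    then show "hv n q \<le> hv n q' \<longleftrightarrow> q \<le> q'"
    proof cases
      case 1
      then show ?thesis using *[OF 1 n] q by simp
    next
      case 2
      then show ?thesis using q by (simp add: hv_def)
    next
      case 3
      have "nat (\<bar>v'\<bar> + \<bar>v\<bar> + 1) \<le> n" using n by (simp add: add.commute)
      from *[OF 3 this] show ?thesis using q 3 by simp
    qed
  qed
qed

locale zpn =
  fixes p :: nat
  assumes prime_p: "prime p"
begin

abbreviation Gn :: "nat \<Rightarrow> (nat \<Rightarrow> int) monoid" where "Gn \<equiv> Zpn_pow p"
abbreviation vp :: "int \<Rightarrow> nat" where "vp \<equiv> multiplicity (int p)"

lemma p_pos: "p > 0" and p_gt_1: "p > 1"
  using prime_p prime_gt_0_nat prime_gt_1_nat by auto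

lemma homog: "homog (Gn n) p n"
  by (rule homog_Zpn[OF prime_p])

definition atm :: "nat \<Rightarrow> (nat \<Rightarrow> nat \<Rightarrow> int) \<Rightarrow> atom \<Rightarrow> bool" where
  "atm n e \<alpha> = (case \<alpha> of (b, k, t) \<Rightarrow> tval (Gn n) e t \<in> torn (Gn n) p (lev n b k))"

definition env :: "nat \<Rightarrow> (nat \<Rightarrow> nat \<Rightarrow> int) \<Rightarrow> bool" where
  "env n e \<longleftrightarrow> (\<forall>i. e i \<in> carrier (Gn n))"

abbreviation agree where
  "agree S n e n' e' \<equiv> \<forall>\<alpha>\<in>S. atm n e \<alpha> \<longleftrightarrow> atm n' e' \<alpha>"

text \<open>The two sides may live in different groups \<open>Gn n\<close> and \<open>Gn n'\<close>;
  this uniformity lets one finite pattern of atoms speak for almost all factors of the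
  ultraproduct.\<close>

definition det :: "atom set \<Rightarrow> nat \<Rightarrow> (nat \<Rightarrow> (nat \<Rightarrow> nat \<Rightarrow> int) \<Rightarrow> 'b) \<Rightarrow> bool" where
  "det S N F \<longleftrightarrow> (\<forall>n\<ge>N. \<forall>n'\<ge>N. \<forall>e e'. env n e \<longrightarrow> env n' e' \<longrightarrow> agree S n e n' e' \<longrightarrow> F n e = F n' e')"

text \<open>For large \<open>n\<close> the solutions of the atom in the variable \<open>i\<close>, if there are any, form a coset of
  the term of level \<open>hgt\<close> of the torsion filtration.\<close>

definition hgt :: "nat \<Rightarrow> atom \<Rightarrow> nat \<times> int" where
  "hgt i \<alpha> = (case \<alpha> of (b, k, t) \<Rightarrow>
     if b then (1, min 0 (int (vp (coef i t)) - int k)) else (0, int k + int (vp (coef i t))))"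

definition acoef :: "nat \<Rightarrow> atom \<Rightarrow> int" where
  "acoef i \<alpha> = coef i (snd (snd \<alpha>))"

text \<open>The parameter condition of \<open>coset_compare\<close> as an atom. Lowering the level
  by \<open>w\<close> means \<open>k' + w\<close> for levels counted down from n and
  \<open>k' - w\<close> for levels counted up from 0.\<close>

definition cmp :: "nat \<Rightarrow> atom \<Rightarrow> atom \<Rightarrow> atom" where
  "cmp i \<alpha> \<beta> = (case \<alpha> of (b, k, t) \<Rightarrow> case \<beta> of (b', k', t') \<Rightarrow>
     let c = coef i t; d = coef i t'; w = vp c - vp d in
     (b', if b' then k' + w else k' - w,
      Mul (tipow (rest i t) (d div gcd c d)) (Inv (tipow (rest i t') (c div gcd c d)))))"

definition solv :: "nat \<Rightarrow> atom \<Rightarrow> atom" where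
  "solv i \<alpha> = (case \<alpha> of (b, k, t) \<Rightarrow> (True, vp (coef i t), rest i t))"

definition arest :: "nat \<Rightarrow> atom \<Rightarrow> atom" where
  "arest i \<alpha> = (case \<alpha> of (b, k, t) \<Rightarrow> (b, k, rest i t))"

text \<open>\<open>arest\<close> and \<open>solv\<close> are the two alternatives of
  \<open>solvable_iff\<close>, and \<open>cmp\<close> decides whether a coset contains or misses a
  smaller one. \<open>arest\<close> also takes care of atoms not involving the variable and of
  cosets that are the whole group or empty.\<close>

definition elim :: "nat \<Rightarrow> atom set \<Rightarrow> atom set" where
  "elim i S = arest i ` S \<union> solv i ` S \<union> {cmp i \<alpha> \<beta> | \<alpha> \<beta>. \<alpha> \<in> S \<and> \<beta> \<in> S}"

text \<open>The first condition makes \<open>hgt\<close> the true level, the second makes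
  lexicographic comparison of levels correct, and the third ensures that proper subcosets cut out by
  \<open>S\<close> fill at most half of a coset.\<close>

definition big :: "nat \<Rightarrow> atom set \<Rightarrow> nat \<Rightarrow> bool" where
  "big i S n \<longleftrightarrow> (\<forall>(b, k, t)\<in>S. k + vp (coef i t) < n) \<and>
     (\<forall>\<alpha>\<in>S. \<forall>\<beta>\<in>S. hv n (hgt i \<alpha>) \<le> hv n (hgt i \<beta>) \<longleftrightarrow> hgt i \<alpha> \<le> hgt i \<beta>) \<and>
     2 * card S \<le> p ^ n"

text \<open>The level of the smallest coset through the value \<open>e i\<close> among those cut out
  by atoms of \<open>S\<close> in the variable i.\<close>

definition mh :: "nat \<Rightarrow> atom set \<Rightarrow> nat \<Rightarrow> (nat \<Rightarrow> nat \<Rightarrow> int) \<Rightarrow> nat \<times> int" where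
  "mh i S n e = Min (hgt i ` {\<alpha>\<in>S. acoef i \<alpha> \<noteq> 0 \<and> atm n e \<alpha>})"

lemma finite_elim: "finite S \<Longrightarrow> finite (elim i S)"
  by (simp add: elim_def finite_image_set2)

lemma eventually_big:
  assumes "finite S"
  shows "eventually (big i S) sequentially"
proof -
  have "eventually (\<lambda>n. \<forall>\<alpha>\<in>S. case \<alpha> of (b, k, t) \<Rightarrow> k + vp (coef i t) < n) sequentially"
    using assms
  proof (intro eventually_ball_finite ballI)
    fix \<alpha> assume "\<alpha> \<in> S"
    obtain b k t where \<alpha>: "\<alpha> = (b, k, t)" by (cases \<alpha>) auto
    show "eventually (\<lambda>n. case \<alpha> of (b, k, t) \<Rightarrow> k + vp (coef i t) < n) sequentially"
      unfolding \<alpha> using eventually_gt_at_top by simp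
  qed auto
  moreover have "eventually (\<lambda>n. \<forall>\<alpha>\<in>S. \<forall>\<beta>\<in>S.
      hv n (hgt i \<alpha>) \<le> hv n (hgt i \<beta>) \<longleftrightarrow> hgt i \<alpha> \<le> hgt i \<beta>) sequentially"
    using assms by (intro eventually_ball_finite ballI eventually_lex) auto
  moreover have "eventually (\<lambda>n. 2 * card S \<le> p ^ n) sequentially"
  proof (rule eventually_sequentiallyI[of "2 * card S"])
    fix n assume n: "2 * card S \<le> n"
    have "n < p ^ n" using p_gt_1 by (simp add: power_gt_expt)
    then show "2 * card S \<le> p ^ n" using n by linarith
  qed
  ultimately show ?thesis by eventually_elim (auto simp: big_def)
qed

lemma env_upd: "env n e \<Longrightarrow> a \<in> carrier (Gn n) \<Longrightarrow> env n (e(i := a))"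
  by (simp add: env_def)

lemma tval_env: "env n e \<Longrightarrow> tval (Gn n) e t \<in> carrier (Gn n)"
  by (auto intro: tval_closed simp: env_def)

lemma atm_split:
  assumes "env n e" "a \<in> carrier (Gn n)"
  shows "atm n (e(i := a)) (b, k, t) \<longleftrightarrow>
    a [^]\<^bsub>Gn n\<^esub> coef i t \<otimes>\<^bsub>Gn n\<^esub> tval (Gn n) e (rest i t) \<in> torn (Gn n) p (lev n b k)"
  using assms by (simp add: atm_def env_def tval_split[OF comm_group_Zpn])

lemma atm_split0:
  assumes "env n e" "a \<in> carrier (Gn n)" "acoef i \<alpha> = 0"
  shows "atm n (e(i := a)) \<alpha> \<longleftrightarrow> atm n e (arest i \<alpha>)"
proof -
  interpret homog "Gn n" p n by (rule homog)
  obtain b k t where \<alpha>: "\<alpha> = (b, k, t)" by (cases \<alpha>) auto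
  show ?thesis using assms tval_env[OF assms(1)]
    unfolding \<alpha> atm_split[OF assms(1,2)] by (simp add: acoef_def atm_def arest_def \<alpha>)
qed

lemma hv_hgt:
  assumes "k + vp (coef i t) < n"
  shows "hv n (hgt i (b, k, t)) = int (min (lev n b k + vp (coef i t)) n)"
  using assms by (auto simp: hv_def hgt_def lev_def)

lemma atm_triv: "env n e \<Longrightarrow> atm n e (triv i)"
proof -
  interpret homog "Gn n" p n by (rule homog)
  show "env n e \<Longrightarrow> atm n e (triv i)"
    by (simp add: triv_def atm_def lev_def tor_top env_def)
qed

lemma atm_cmp:
  assumes "env n e"
  shows "atm n e (cmp i (b, k, t) (b', k', t')) \<longleftrightarrow>
    tval (Gn n) e (rest i t) [^]\<^bsub>Gn n\<^esub> (coef i t' div gcd (coef i t) (coef i t')) \<otimes>\<^bsub>Gn n\<^esub>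
      inv\<^bsub>Gn n\<^esub> (tval (Gn n) e (rest i t') [^]\<^bsub>Gn n\<^esub> (coef i t div gcd (coef i t) (coef i t')))
      \<in> torn (Gn n) p (lev n b' k' - (vp (coef i t) - vp (coef i t')))"
  by (auto simp: atm_def cmp_def Let_def tval_tipow lev_def)

text \<open>The point \<open>a\<close> lies in the coset of \<alpha>, which is not larger than that
  of \<beta>, so \<open>coset_compare\<close> applies. Height \<open>(1, 0)\<close> is separate:
  there the cap at n hides the inequality of levels, but the power of \<open>a\<close> lies in the
  subgroup anyway.\<close>

lemma atm_compare:
  assumes e: "env n e" and a: "a \<in> carrier (Gn n)" and S: "big i S n" "\<alpha> \<in> S" "\<beta> \<in> S"
    and nz: "acoef i \<alpha> \<noteq> 0" "acoef i \<beta> \<noteq> 0" and le: "hgt i \<alpha> \<le> hgt i \<beta>"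
    and t: "atm n (e(i := a)) \<alpha>"
  shows "atm n (e(i := a)) \<beta> \<longleftrightarrow>
    atm n e (if hgt i \<beta> = (1, 0) then arest i \<beta> else cmp i \<alpha> \<beta>)"
proof -
  interpret homog "Gn n" p n by (rule homog)
  obtain b k t where \<alpha>: "\<alpha> = (b, k, t)" by (cases \<alpha>) auto
  obtain b' k' t' where \<beta>: "\<beta> = (b', k', t')" by (cases \<beta>) auto
  have b1: "k + vp (coef i t) < n" and b2: "k' + vp (coef i t') < n" using S by (auto simp: big_def \<alpha> \<beta>)
  note cl = tval_env[OF e, of "rest i t"] tval_env[OF e, of "rest i t'"]
  have nz': "coef i t \<noteq> 0" "coef i t' \<noteq> 0" using nz by (auto simp: acoef_def \<alpha> \<beta>)
  show ?thesis
  proof (cases "hgt i \<beta> = (1, 0)")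
    case True
    then have bk: "b'" "k' \<le> vp (coef i t')" by (auto simp: hgt_def \<beta> split: if_splits)
    interpret T: subgroup "tor (lev n b' k')" "Gn n" by (rule tor_subgroup)
    have "n - vp (coef i t') \<le> lev n b' k'" using bk by (simp add: lev_def diff_le_mono2)
    then have *: "a [^]\<^bsub>Gn n\<^esub> coef i t' \<in> tor (lev n b' k')"
      using pow_in_tor[OF nz'(2) a] tor_mono by blast
    have "a [^]\<^bsub>Gn n\<^esub> coef i t' \<otimes>\<^bsub>Gn n\<^esub> tval (Gn n) e (rest i t') \<in> tor (lev n b' k') \<longleftrightarrow>
      tval (Gn n) e (rest i t') \<in> tor (lev n b' k')"
    proof
      assume "a [^]\<^bsub>Gn n\<^esub> coef i t' \<otimes>\<^bsub>Gn n\<^esub> tval (Gn n) e (rest i t') \<in> tor (lev n b' k')"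
      then have "inv\<^bsub>Gn n\<^esub> (a [^]\<^bsub>Gn n\<^esub> coef i t') \<otimes>\<^bsub>Gn n\<^esub>
        (a [^]\<^bsub>Gn n\<^esub> coef i t' \<otimes>\<^bsub>Gn n\<^esub> tval (Gn n) e (rest i t')) \<in> tor (lev n b' k')" using * by simp
      then show "tval (Gn n) e (rest i t') \<in> tor (lev n b' k')"
        using a cl by (simp flip: m_assoc)
    qed (use * in simp)
    then show ?thesis using True unfolding \<beta> atm_split[OF e a] by (simp add: atm_def arest_def \<beta>)
  next
    case False
    have "hv n (hgt i \<alpha>) \<le> hv n (hgt i \<beta>)" using S le by (auto simp: big_def)
    then have "min (lev n b k + vp (coef i t)) n \<le> min (lev n b' k' + vp (coef i t')) n"
      unfolding \<alpha> \<beta> hv_hgt[OF b1] hv_hgt[OF b2] by simp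
    moreover have "lev n b' k' + vp (coef i t') < n"
      using False b2 by (auto simp: hgt_def lev_def \<beta> split: if_splits)
    ultimately have "lev n b k + vp (coef i t) \<le> lev n b' k' + vp (coef i t')" by linarith
    from coset_compare[OF nz' a cl _ this]
    show ?thesis using False t
      unfolding \<alpha> \<beta> atm_split[OF e a] atm_cmp[OF e] by (simp add: atm_cmp[OF e])
  qed
qed

text \<open>If \<alpha> gives the smallest coset through both points, atoms of at least its height
  are decided by \<open>atm_compare\<close> from parameters, smaller ones fail on both sides, and
  those without the variable reduce to \<open>arest\<close>.\<close>

lemma agree_extend:
  assumes e: "env n e" "env n' e'" and a: "a \<in> carrier (Gn n)" "a' \<in> carrier (Gn n')"
    and big: "big i S n" "big i S n'" and ag: "agree (elim i S) n e n' e'"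
    and \<alpha>: "\<alpha> \<in> S" "acoef i \<alpha> \<noteq> 0" "atm n (e(i := a)) \<alpha>" "atm n' (e'(i := a')) \<alpha>"
    and low: "\<And>\<beta>. \<beta> \<in> S \<Longrightarrow> acoef i \<beta> \<noteq> 0 \<Longrightarrow> hgt i \<beta> < hgt i \<alpha> \<Longrightarrow>
      \<not> atm n (e(i := a)) \<beta> \<and> \<not> atm n' (e'(i := a')) \<beta>"
  shows "agree S n (e(i := a)) n' (e'(i := a'))"
proof
  fix \<beta> assume \<beta>: "\<beta> \<in> S"
  have in_elim: "arest i \<beta> \<in> elim i S" "cmp i \<alpha> \<beta> \<in> elim i S" using \<alpha>(1) \<beta> by (auto simp: elim_def)
  consider "acoef i \<beta> = 0" | "acoef i \<beta> \<noteq> 0" "hgt i \<beta> < hgt i \<alpha>"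
    | "acoef i \<beta> \<noteq> 0" "hgt i \<alpha> \<le> hgt i \<beta>" by fastforce
  then show "atm n (e(i := a)) \<beta> \<longleftrightarrow> atm n' (e'(i := a')) \<beta>"
  proof cases
    case 1
    then show ?thesis using ag in_elim by (simp add: atm_split0 e a)
  next
    case 2
    then show ?thesis using low[OF \<beta>] by simp
  next
    case 3
    then show ?thesis
      using atm_compare[OF e(1) a(1) big(1) \<alpha>(1) \<beta> \<alpha>(2) 3 \<alpha>(3)]
        atm_compare[OF e(2) a(2) big(2) \<alpha>(1) \<beta> \<alpha>(2) 3 \<alpha>(4)] ag in_elim by auto
  qed
qed

lemma card_atm:
  assumes "env n e" "acoef i (b, k, t) \<noteq> 0"
  shows "card {a \<in> carrier (Gn n). atm n (e(i := a)) (b, k, t)} \<le> p ^ (n * min (lev n b k + vp (coef i t)) n)"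
    and "\<exists>a\<in>carrier (Gn n). atm n (e(i := a)) (b, k, t) \<Longrightarrow>
      card {a \<in> carrier (Gn n). atm n (e(i := a)) (b, k, t)} = p ^ (n * min (lev n b k + vp (coef i t)) n)"
    and "(\<exists>a\<in>carrier (Gn n). atm n (e(i := a)) (b, k, t)) \<longleftrightarrow>
      atm n e (arest i (b, k, t)) \<or> atm n e (solv i (b, k, t))"
proof -
  interpret homog "Gn n" p n by (rule homog)
  have nz: "coef i t \<noteq> 0" using assms(2) by (simp add: acoef_def)
  note cl = tval_env[OF assms(1), of "rest i t"]
  have eq: "{a \<in> carrier (Gn n). atm n (e(i := a)) (b, k, t)} = {a \<in> carrier (Gn n).
    a [^]\<^bsub>Gn n\<^esub> coef i t \<otimes>\<^bsub>Gn n\<^esub> tval (Gn n) e (rest i t) \<in> tor (lev n b k)}"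
    using atm_split[OF assms(1)] by auto
  show "card {a \<in> carrier (Gn n). atm n (e(i := a)) (b, k, t)} \<le> p ^ (n * min (lev n b k + vp (coef i t)) n)"
    unfolding eq by (rule card_coset_le[OF nz cl])
  show "card {a \<in> carrier (Gn n). atm n (e(i := a)) (b, k, t)} = p ^ (n * min (lev n b k + vp (coef i t)) n)"
    if ex: "\<exists>a\<in>carrier (Gn n). atm n (e(i := a)) (b, k, t)"
  proof -
    obtain a where "a \<in> carrier (Gn n)" "atm n (e(i := a)) (b, k, t)" using ex by blast
    then show ?thesis unfolding eq using card_coset[OF nz cl, of a] atm_split[OF assms(1)] by auto
  qed
  have "(\<exists>a\<in>carrier (Gn n). atm n (e(i := a)) (b, k, t)) \<longleftrightarrow> (\<exists>a\<in>carrier (Gn n).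
     a [^]\<^bsub>Gn n\<^esub> coef i t \<otimes>\<^bsub>Gn n\<^esub> tval (Gn n) e (rest i t) \<in> tor (lev n b k))"
    using atm_split[OF assms(1)] by auto
  also have "\<dots> \<longleftrightarrow> atm n e (arest i (b, k, t)) \<or> atm n e (solv i (b, k, t))"
    unfolding solvable_iff[OF nz cl] by (simp add: atm_def arest_def solv_def lev_def)
  finally show "(\<exists>a\<in>carrier (Gn n). atm n (e(i := a)) (b, k, t)) \<longleftrightarrow>
      atm n e (arest i (b, k, t)) \<or> atm n e (solv i (b, k, t))" .
qed

section \<open>Points with a prescribed pattern of atoms\<close>

lemma mh_attained:
  assumes "finite S" "triv i \<in> S" "env n e"
  obtains \<alpha> where "\<alpha> \<in> S" "acoef i \<alpha> \<noteq> 0" "atm n e \<alpha>" "hgt i \<alpha> = mh i S n e"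
    "\<And>\<beta>. \<beta> \<in> S \<Longrightarrow> acoef i \<beta> \<noteq> 0 \<Longrightarrow> atm n e \<beta> \<Longrightarrow> hgt i \<alpha> \<le> hgt i \<beta>"
proof -
  define T where "T = {\<alpha>\<in>S. acoef i \<alpha> \<noteq> 0 \<and> atm n e \<alpha>}"
  have "triv i \<in> T"
    using assms atm_triv[OF assms(3), of i] by (simp add: T_def acoef_def triv_def)
  then have "hgt i ` T \<noteq> {}" by blast
  moreover have "finite (hgt i ` T)" using assms(1) by (simp add: T_def)
  ultimately have T: "finite (hgt i ` T)" "hgt i ` T \<noteq> {}" by auto
  have "mh i S n e \<in> hgt i ` T" unfolding mh_def using T Min_in T_def by blast
  then obtain \<alpha> where \<alpha>: "\<alpha> \<in> T" "hgt i \<alpha> = mh i S n e" by auto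
  moreover have "hgt i \<alpha> \<le> hgt i \<beta>" if "\<beta> \<in> T" for \<beta>
    unfolding \<alpha>(2) mh_def using T that T_def by (intro Min_le) auto
  ultimately show thesis using that[of \<alpha>] unfolding T_def by blast
qed

text \<open>The elements with the same pattern of atoms as \<open>a\<close> fill at least half of the smallest coset
  containing \<open>a\<close>, since all the smaller cosets have index at least \<open>p ^ n\<close> in it.\<close>

lemma card_pattern_ge:
  assumes fin: "finite S" and tr: "triv i \<in> S" and e: "env n e" "env n' e'"
    and a: "a \<in> carrier (Gn n)" and big: "big i S n" "big i S n'"
    and ag: "agree (elim i S) n e n' e'"
  shows "(real p ^ n') powi hv n' (mh i S n (e(i := a))) / 2
    \<le> real (card {a' \<in> carrier (Gn n'). agree S n (e(i := a)) n' (e'(i := a'))})"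
proof -
  interpret H: homog "Gn n'" p n' by (rule homog)
  have ea: "env n (e(i := a))" using e a by (simp add: env_upd)
  obtain \<alpha> where \<alpha>: "\<alpha> \<in> S" "acoef i \<alpha> \<noteq> 0" "atm n (e(i := a)) \<alpha>" "hgt i \<alpha> = mh i S n (e(i := a))"
    and min: "\<And>\<beta>. \<beta> \<in> S \<Longrightarrow> acoef i \<beta> \<noteq> 0 \<Longrightarrow> atm n (e(i := a)) \<beta> \<Longrightarrow> hgt i \<alpha> \<le> hgt i \<beta>"
    using mh_attained[OF fin tr ea] by metis
  define C where "C \<beta> = {a' \<in> carrier (Gn n'). atm n' (e'(i := a')) \<beta>}" for \<beta>
  \<comment> \<open>Atoms with strictly smaller cosets. By minimality of \<alpha> the point
    \<open>a\<close> satisfies none of them, so every point of \<open>C \<alpha>\<close> outside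
    these cosets repeats the pattern of \<open>a\<close>.\<close>
  define bad where "bad = {\<beta> \<in> S. acoef i \<beta> \<noteq> 0 \<and> hgt i \<beta> < hgt i \<alpha>}"
  define P where "P = {a' \<in> carrier (Gn n'). agree S n (e(i := a)) n' (e'(i := a'))}"
  have finP: "finite P" and finC: "finite (C \<beta>)" for \<beta>
    using H.finite_carrier by (auto simp: P_def C_def)
  \<comment> \<open>Whether the coset of \<alpha> is nonempty is decided by
    \<open>arest i \<alpha>\<close> and \<open>solv i \<alpha>\<close>, on which \<open>e\<close>
    and \<open>e'\<close> agree; on the side of \<open>e\<close> the point \<open>a\<close>
    witnesses it.\<close>
  obtain m where m: "int m = hv n' (hgt i \<alpha>)" "card (C \<alpha>) = p ^ (n' * m)"
  proof -
    obtain b k t where bkt: "\<alpha> = (b, k, t)" by (cases \<alpha>) auto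
    have "arest i \<alpha> \<in> elim i S" "solv i \<alpha> \<in> elim i S" using \<alpha>(1) by (auto simp: elim_def)
    then have "\<exists>a\<in>carrier (Gn n'). atm n' (e'(i := a)) \<alpha>"
      using card_atm(3)[OF e(1), of i b k t] card_atm(3)[OF e(2), of i b k t] \<alpha> a ag
      unfolding bkt by blast
    moreover have "k + vp (coef i t) < n'" using big(2) \<alpha>(1) by (auto simp: bkt big_def)
    ultimately show thesis using that card_atm(2)[OF e(2), of i b k t] \<alpha>(2) hv_hgt[of k i t n' b]
      by (simp add: C_def bkt)
  qed
  have bad_card: "m > 0 \<and> card (C \<beta>) \<le> p ^ (n' * (m - 1))" if "\<beta> \<in> bad" for \<beta>
  proof -
    obtain b k t where bkt: "\<beta> = (b, k, t)" by (cases \<beta>) auto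
    define m' where "m' = min (lev n' b k + vp (coef i t)) n'"
    have \<beta>: "\<beta> \<in> S" "acoef i \<beta> \<noteq> 0" "\<not> hgt i \<alpha> \<le> hgt i \<beta>" using that by (auto simp: bad_def)
    have "k + vp (coef i t) < n'" using big(2) \<beta>(1) by (auto simp: bkt big_def)
    then have hm: "hv n' (hgt i \<beta>) = int m'" using hv_hgt by (simp add: m'_def bkt)
    have "\<not> hv n' (hgt i \<alpha>) \<le> hv n' (hgt i \<beta>)" using big(2) \<alpha>(1) \<beta> by (simp add: big_def)
    then have lt: "m' < m" using hm m(1) by simp
    have "card (C \<beta>) \<le> p ^ (n' * m')"
      using card_atm(1)[OF e(2), of i b k t] \<beta>(2) by (simp add: C_def m'_def bkt)
    also have "\<dots> \<le> p ^ (n' * (m - 1))"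
      using lt p_pos by (intro power_increasing mult_left_mono) auto
    finally show ?thesis using lt by simp
  qed
  have finbad: "finite bad" using fin by (simp add: bad_def)
  have "2 * card (\<Union>\<beta>\<in>bad. C \<beta>) \<le> p ^ (n' * m)"
  proof (cases "bad = {}")
    case False
    then have m0: "m > 0" using bad_card by auto
    have "card (\<Union>\<beta>\<in>bad. C \<beta>) \<le> (\<Sum>\<beta>\<in>bad. card (C \<beta>))" using card_UN_le[OF finbad] by blast
    also have "\<dots> \<le> card bad * p ^ (n' * (m - 1))"
      using sum_bounded_above[of bad "\<lambda>\<beta>. card (C \<beta>)"] bad_card by auto
    also have "\<dots> \<le> card S * p ^ (n' * (m - 1))"
      using fin by (intro mult_right_mono card_mono) (auto simp: bad_def)
    finally have "2 * card (\<Union>\<beta>\<in>bad. C \<beta>) \<le> (2 * card S) * p ^ (n' * (m - 1))" by simp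
    \<comment> \<open>A drop by one level gains a factor \<open>p ^ n'\<close>, which pays for the
      number of smaller cosets and for the factor 2.\<close>
    also have "\<dots> \<le> p ^ n' * p ^ (n' * (m - 1))" using big(2) by (auto simp: big_def)
    also have "\<dots> = p ^ (n' * m)" using m0 by (cases m) (simp_all add: power_add)
    finally show ?thesis .
  qed auto
  moreover have "C \<alpha> - (\<Union>\<beta>\<in>bad. C \<beta>) \<subseteq> P"
  proof
    fix a' assume a': "a' \<in> C \<alpha> - (\<Union>\<beta>\<in>bad. C \<beta>)"
    then have a'c: "a' \<in> carrier (Gn n')" by (simp add: C_def)
    have "agree S n (e(i := a)) n' (e'(i := a'))"
    proof (rule agree_extend[OF e a a'c big ag \<alpha>(1,2,3)])
      show "atm n' (e'(i := a')) \<alpha>" using a' by (simp add: C_def)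
      show "\<not> atm n (e(i := a)) \<beta> \<and> \<not> atm n' (e'(i := a')) \<beta>"
        if "\<beta> \<in> S" "acoef i \<beta> \<noteq> 0" "hgt i \<beta> < hgt i \<alpha>" for \<beta>
      proof -
        have "\<beta> \<in> bad" using that by (simp add: bad_def)
        then have "a' \<notin> C \<beta>" using a' by blast
        then show ?thesis using min[OF that(1,2)] that(3) a'c by (auto simp: C_def)
      qed
    qed
    then show "a' \<in> P" using a'c by (simp add: P_def)
  qed
  then have "card (C \<alpha>) - card (\<Union>\<beta>\<in>bad. C \<beta>) \<le> card P"
    using finP finC finbad diff_card_le_card_Diff[of "\<Union>\<beta>\<in>bad. C \<beta>" "C \<alpha>"] card_mono[OF finP]
    by (meson finite_UN_I order_trans)
  ultimately have "p ^ (n' * m) \<le> 2 * card P" using m(2) by linarith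
  then have "real (p ^ (n' * m)) \<le> real (2 * card P)" by (simp only: of_nat_le_iff)
  then have "(real p ^ n') ^ m \<le> 2 * real (card P)" by (simp add: power_mult)
  then show ?thesis unfolding P_def \<alpha>(4)[symmetric] m(1)[symmetric] power_int_of_nat by simp
qed

text \<open>All points with this pattern lie in the smallest coset through \<open>a\<close>.\<close>

lemma card_pattern_le:
  assumes fin: "finite S" and tr: "triv i \<in> S" and e: "env n e"
    and a: "a \<in> carrier (Gn n)" and big: "big i S n"
  shows "real (card {a' \<in> carrier (Gn n). agree S n (e(i := a)) n (e(i := a'))})
    \<le> (real p ^ n) powi hv n (mh i S n (e(i := a)))"
proof -
  interpret H: homog "Gn n" p n by (rule homog)
  have ea: "env n (e(i := a))" using e a by (simp add: env_upd)
  obtain \<alpha> where \<alpha>: "\<alpha> \<in> S" "acoef i \<alpha> \<noteq> 0" "atm n (e(i := a)) \<alpha>" "hgt i \<alpha> = mh i S n (e(i := a))"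
    using mh_attained[OF fin tr ea] by metis
  obtain b k t where bkt: "\<alpha> = (b, k, t)" by (cases \<alpha>) auto
  have "card {a' \<in> carrier (Gn n). agree S n (e(i := a)) n (e(i := a'))} \<le>
    card {a' \<in> carrier (Gn n). atm n (e(i := a')) \<alpha>}"
    using \<alpha> H.finite_carrier by (intro card_mono) auto
  also have "\<dots> \<le> p ^ (n * min (lev n b k + vp (coef i t)) n)"
    using card_atm(1)[OF e, of i b k t] \<alpha>(2) by (simp add: bkt)
  finally have "real (card {a' \<in> carrier (Gn n). agree S n (e(i := a)) n (e(i := a'))}) \<le>
    real (p ^ (n * min (lev n b k + vp (coef i t)) n))" by (simp only: of_nat_le_iff)
  moreover have "k + vp (coef i t) < n" using big \<alpha>(1) by (auto simp: bkt big_def)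
  ultimately show ?thesis
    unfolding \<alpha>(4)[symmetric] bkt by (simp only: hv_hgt power_int_of_nat) (simp add: power_mult)
qed

text \<open>One step of the back-and-forth between \<open>Gn n\<close> and \<open>Gn n'\<close>: the
  lower bound on the number of suitable points is positive.\<close>

lemma agree_extend_exists:
  assumes "finite S" "triv i \<in> S" "env n e" "env n' e'"
    "a \<in> carrier (Gn n)" "big i S n" "big i S n'" "agree (elim i S) n e n' e'"
  shows "\<exists>a'\<in>carrier (Gn n'). agree S n (e(i := a)) n' (e'(i := a'))"
proof -
  have "0 < (real p ^ n') powi hv n' (mh i S n (e(i := a))) / 2" using p_pos by simp
  also note card_pattern_ge[OF assms]
  finally have "card {a' \<in> carrier (Gn n'). agree S n (e(i := a)) n' (e'(i := a'))} \<noteq> 0" by simp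
  then have "{a' \<in> carrier (Gn n'). agree S n (e(i := a)) n' (e'(i := a'))} \<noteq> {}" by force
  then show ?thesis by blast
qed

section \<open>Functions determined by finitely many atoms\<close>

lemma det_mono: "det S N F \<Longrightarrow> S \<subseteq> S' \<Longrightarrow> N \<le> N' \<Longrightarrow> det S' N' F"
  unfolding det_def by (meson le_trans subset_iff)

lemma detD: "det S N F \<Longrightarrow> N \<le> n \<Longrightarrow> N \<le> n' \<Longrightarrow> env n e \<Longrightarrow> env n' e' \<Longrightarrow> agree S n e n' e' \<Longrightarrow>
    F n e = F n' e'"
  unfolding det_def by blast

lemma det_comp:
  assumes "det S N F"
  shows "det S N (\<lambda>n e. g (F n e))"
  unfolding det_def by (intro allI impI arg_cong[of _ _ g]) (rule detD[OF assms])

lemma det_comp2: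
  assumes "det S N F" "det T M H"
  shows "det (S \<union> T) (max N M) (\<lambda>n e. g (F n e) (H n e))"
proof -
  have "det (S \<union> T) (max N M) F" "det (S \<union> T) (max N M) H"
    using assms by (auto intro: det_mono)
  then show ?thesis unfolding det_def by (intro allI impI arg_cong2[of _ _ _ _ g]) blast+
qed

text \<open>Keeping the whole set of values serves two purposes: \<open>True\<close> belongs to it
  for an existential formula, and \<open>Max\<close> of it gives the level of a sum.\<close>

lemma det_image:
  assumes fin: "finite S" and tr: "triv i \<in> S" and det: "det S N F" and N: "\<And>n. n \<ge> N \<Longrightarrow> big i S n"
  shows "det (elim i S) N (\<lambda>n e. (\<lambda>a. F n (e(i := a))) ` carrier (Gn n))"
proof -
  have "F n (e(i := a)) \<in> (\<lambda>a. F n' (e'(i := a))) ` carrier (Gn n')"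
    if n: "N \<le> n" "N \<le> n'" and e: "env n e" "env n' e'" and ag: "agree (elim i S) n e n' e'"
      and a: "a \<in> carrier (Gn n)" for n n' e e' a
  proof -
    obtain a' where a': "a' \<in> carrier (Gn n')" "agree S n (e(i := a)) n' (e'(i := a'))"
      using agree_extend_exists[OF fin tr e a N[OF n(1)] N[OF n(2)] ag] by blast
    have "F n (e(i := a)) = F n' (e'(i := a'))"
      by (rule detD[OF det n env_upd[OF e(1) a] env_upd[OF e(2) a'(1)] a'(2)])
    then show ?thesis using a' by blast
  qed
  note half = this
  show ?thesis unfolding det_def
  proof (intro allI impI equalityI image_subsetI)
    fix n n' e e' assume *: "N \<le> n" "N \<le> n'" "env n e" "env n' e'" "agree (elim i S) n e n' e'"
    then have ag: "agree (elim i S) n' e' n e" by simp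
    show "F n (e(i := a)) \<in> (\<lambda>a. F n' (e'(i := a))) ` carrier (Gn n')" if "a \<in> carrier (Gn n)" for a
      by (rule half[OF *  that])
    show "F n' (e'(i := a)) \<in> (\<lambda>a. F n (e(i := a))) ` carrier (Gn n)" if "a \<in> carrier (Gn n')" for a
      by (rule half[OF *(2,1,4,3) ag that])
  qed
qed

definition avars :: "atom set \<Rightarrow> nat set" where
  "avars S = (\<Union>\<alpha>\<in>S. tvars (snd (snd \<alpha>)))"

text \<open>Tracking variables ensures that the formulas finally built from the eliminated atoms
  have only parameters free.\<close>

lemma avars_elim: "avars (elim i S) \<subseteq> avars S - {i}"
proof -
  have 1: "tvars (snd (snd (cmp i \<alpha> \<beta>))) \<subseteq> tvars (snd (snd \<alpha>)) \<union> tvars (snd (snd \<beta>)) - {i}" for \<alpha> \<beta>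
  proof -
    obtain b k t b' k' t' where ab: "\<alpha> = (b, k, t)" "\<beta> = (b', k', t')" by (cases \<alpha>, cases \<beta>) auto
    show ?thesis
      using tvars_tipow[of "rest i t"] tvars_tipow[of "rest i t'"] by (auto simp: cmp_def Let_def ab)
  qed
  have 2: "tvars (snd (snd (arest i \<alpha>))) = tvars (snd (snd \<alpha>)) - {i}"
    "tvars (snd (snd (solv i \<alpha>))) = tvars (snd (snd \<alpha>)) - {i}" for \<alpha>
    by (cases \<alpha>, simp add: arest_def solv_def)+
  have "tvars (snd (snd \<gamma>)) \<subseteq> avars S - {i}" if \<gamma>: "\<gamma> \<in> elim i S" for \<gamma>
  proof -
    obtain \<alpha> \<beta> where \<alpha>\<beta>: "\<alpha> \<in> S" "\<beta> \<in> S"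
      and cases: "\<gamma> = arest i \<alpha> \<or> \<gamma> = solv i \<alpha> \<or> \<gamma> = cmp i \<alpha> \<beta>"
      using \<gamma> unfolding elim_def by blast
    have "tvars (snd (snd \<alpha>)) \<subseteq> avars S" "tvars (snd (snd \<beta>)) \<subseteq> avars S"
      using \<alpha>\<beta> unfolding avars_def by blast+
    then show ?thesis using cases 1[of \<alpha> \<beta>] 2[of \<alpha>] by (elim disjE) (simp_all, blast+)
  qed
  then show ?thesis unfolding avars_def[of "elim i S"] by blast
qed

lemma avars_insert: "avars (insert (triv i) S) = insert i (avars S)"
  by (auto simp: avars_def triv_def)

text \<open>Quantifier elimination without formulas. A quantifier costs one application of
  \<open>det_image\<close>, after \<open>triv i\<close> is added and the threshold raised until
  \<open>big\<close> holds.\<close>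

theorem sat_det:
  "\<exists>S N. finite S \<and> avars S \<subseteq> fvars \<phi> \<and> det S N (\<lambda>n e. sat (Gn n) e \<phi>)"
proof (induction \<phi>)
  case (Eq t u)
  \<comment> \<open>Level 0 of the filtration is the trivial subgroup, so this atom expresses
    equality.\<close>
  let ?\<alpha> = "(False, 0, Mul t (Inv u)) :: atom"
  have "sat (Gn n) e (Eq t u) \<longleftrightarrow> atm n e ?\<alpha>" if "env n e" for n e
  proof -
    interpret homog "Gn n" p n by (rule homog)
    note cl = tval_env[OF that, of t] tval_env[OF that, of u]
    have "tval (Gn n) e t = tval (Gn n) e u \<longleftrightarrow>
      tval (Gn n) e t \<otimes>\<^bsub>Gn n\<^esub> inv\<^bsub>Gn n\<^esub> tval (Gn n) e u = \<one>\<^bsub>Gn n\<^esub>"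
      using cl by (metis inv_solve_right l_one one_closed)
    then show ?thesis using cl by (simp add: atm_def torn_def lev_def)
  qed
  then have "det {?\<alpha>} 0 (\<lambda>n e. sat (Gn n) e (Eq t u))" unfolding det_def by simp
  then show ?case by (intro exI[of _ "{?\<alpha>}"] exI[of _ 0]) (auto simp: avars_def)
next
  case (Neg \<phi>)
  then obtain S N where "finite S" "avars S \<subseteq> fvars \<phi>" "det S N (\<lambda>n e. sat (Gn n) e \<phi>)" by blast
  then show ?case
    using det_comp[of S N "\<lambda>n e. sat (Gn n) e \<phi>" Not] by (intro exI[of _ S] exI[of _ N]) auto
next
  case (Conj \<phi> \<psi>)
  then obtain S N T M where "finite S" "avars S \<subseteq> fvars \<phi>" "det S N (\<lambda>n e. sat (Gn n) e \<phi>)"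
    "finite T" "avars T \<subseteq> fvars \<psi>" "det T M (\<lambda>n e. sat (Gn n) e \<psi>)" by blast
  then show ?case
    using det_comp2[of S N "\<lambda>n e. sat (Gn n) e \<phi>" T M "\<lambda>n e. sat (Gn n) e \<psi>" "(\<and>)"]
    by (intro exI[of _ "S \<union> T"] exI[of _ "max N M"]) (auto simp: avars_def)
next
  case (Exi i \<phi>)
  then obtain S N where S: "finite S" "avars S \<subseteq> fvars \<phi>" "det S N (\<lambda>n e. sat (Gn n) e \<phi>)" by blast
  let ?S = "insert (triv i) S"
  obtain M where M: "\<And>n. n \<ge> M \<Longrightarrow> big i ?S n"
    using eventually_big[of ?S i] S(1) by (auto simp: eventually_sequentially)
  have "det ?S (max N M) (\<lambda>n e. sat (Gn n) e \<phi>)" by (rule det_mono[OF S(3)]) auto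
  then have "det (elim i ?S) (max N M) (\<lambda>n e. (\<lambda>a. sat (Gn n) (e(i := a)) \<phi>) ` carrier (Gn n))"
    using S(1) M by (intro det_image) auto
  then have "det (elim i ?S) (max N M) (\<lambda>n e. True \<in> (\<lambda>a. sat (Gn n) (e(i := a)) \<phi>) ` carrier (Gn n))"
    by (rule det_comp)
  moreover have "True \<in> (\<lambda>a. sat (Gn n) (e(i := a)) \<phi>) ` carrier (Gn n) \<longleftrightarrow> sat (Gn n) e (Exi i \<phi>)" for n e
    by auto
  ultimately have "det (elim i ?S) (max N M) (\<lambda>n e. sat (Gn n) e (Exi i \<phi>))" by simp
  moreover have "avars (elim i ?S) \<subseteq> fvars (Exi i \<phi>)"
    using avars_elim[of i ?S] S(2) by (auto simp: avars_insert)
  ultimately show ?case using finite_elim[of ?S i] S(1) by blast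
qed

end

subsection \<open>Counting\<close>

text \<open>The levels produced by eliminating counted variables depend only on the coefficients of these
  variables, and not on the number of parameters. This is what bounds the dimensions in \<open>(A)\<close>.\<close>

type_synonym shape = "bool \<times> nat \<times> (nat \<Rightarrow> int)"

text \<open>The value 0 from R on erases the parameters, so that atoms differing only in them get
  equal shapes.\<close>

definition shp :: "nat \<Rightarrow> atom \<Rightarrow> shape" where
  "shp R \<alpha> = (case \<alpha> of (b, k, t) \<Rightarrow> (b, k, \<lambda>j. if j < R then coef j t else 0))"

definition dplus :: "(nat \<times> int) option \<Rightarrow> nat \<times> int \<Rightarrow> (nat \<times> int) option" where
  "dplus d h = (case d of None \<Rightarrow> None | Some q \<Rightarrow> Some (fst q + fst h, snd q + snd h))"

context zpn
begin

text \<open>The elimination can be followed on shapes, because the valuations, cofactors and levels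
  occurring in it involve only coefficients of counted variables.\<close>

definition sarest :: "nat \<Rightarrow> shape \<Rightarrow> shape" where
  "sarest i \<sigma> = (case \<sigma> of (b, k, c) \<Rightarrow> (b, k, c(i := 0)))"

definition ssolv :: "nat \<Rightarrow> shape \<Rightarrow> shape" where
  "ssolv i \<sigma> = (case \<sigma> of (b, k, c) \<Rightarrow> (True, vp (c i), c(i := 0)))"

definition scmp :: "nat \<Rightarrow> shape \<Rightarrow> shape \<Rightarrow> shape" where
  "scmp i \<sigma> \<tau> = (case \<sigma> of (b, k, c) \<Rightarrow> case \<tau> of (b', k', c') \<Rightarrow>
     let w = vp (c i) - vp (c' i); g = gcd (c i) (c' i) in
     (b', if b' then k' + w else k' - w,
      (\<lambda>j. c j * (c' i div g) - c' j * (c i div g))(i := 0)))"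

definition selim :: "nat \<Rightarrow> shape set \<Rightarrow> shape set" where
  "selim i \<Sigma> = sarest i ` \<Sigma> \<union> ssolv i ` \<Sigma> \<union> {scmp i \<sigma> \<tau> | \<sigma> \<tau>. \<sigma> \<in> \<Sigma> \<and> \<tau> \<in> \<Sigma>}"

definition shgt :: "nat \<Rightarrow> shape \<Rightarrow> nat \<times> int" where
  "shgt i \<sigma> = (case \<sigma> of (b, k, c) \<Rightarrow>
     if b then (1, min 0 (int (vp (c i)) - int k)) else (0, int k + int (vp (c i))))"

lemma finite_selim: "finite \<Sigma> \<Longrightarrow> finite (selim i \<Sigma>)"
  by (simp add: selim_def finite_image_set2)

lemma shp_arest: "i < R \<Longrightarrow> shp R (arest i \<alpha>) = sarest i (shp R \<alpha>)"
  by (cases \<alpha>) (auto simp: shp_def arest_def sarest_def coef_rest)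

lemma shp_solv: "i < R \<Longrightarrow> shp R (solv i \<alpha>) = ssolv i (shp R \<alpha>)"
  by (cases \<alpha>) (auto simp: shp_def solv_def ssolv_def coef_rest)

lemma shp_cmp: "i < R \<Longrightarrow> shp R (cmp i \<alpha> \<beta>) = scmp i (shp R \<alpha>) (shp R \<beta>)"
  by (cases \<alpha>, cases \<beta>)
    (auto simp: shp_def cmp_def scmp_def Let_def coef_tipow coef_rest fun_eq_iff mult.commute)

lemma hgt_shp: "i < R \<Longrightarrow> hgt i \<alpha> = shgt i (shp R \<alpha>)"
  by (cases \<alpha>) (auto simp: hgt_def shgt_def shp_def)

lemma shp_elim:
  assumes "i < R" "shp R ` S \<subseteq> \<Sigma>"
  shows "shp R ` elim i S \<subseteq> selim i \<Sigma>"
proof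
  fix \<gamma> assume "\<gamma> \<in> shp R ` elim i S"
  then obtain \<alpha> \<beta> where \<alpha>\<beta>: "\<alpha> \<in> S" "\<beta> \<in> S"
    and cases: "\<gamma> = shp R (arest i \<alpha>) \<or> \<gamma> = shp R (solv i \<alpha>) \<or> \<gamma> = shp R (cmp i \<alpha> \<beta>)"
    unfolding elim_def by blast
  have "shp R \<alpha> \<in> \<Sigma>" "shp R \<beta> \<in> \<Sigma>" using \<alpha>\<beta> assms by auto
  then show "\<gamma> \<in> selim i \<Sigma>"
    using cases unfolding shp_arest[OF assms(1)] shp_solv[OF assms(1)] shp_cmp[OF assms(1)] selim_def
    by blast
qed

text \<open>\<open>None\<close> marks the empty set, and \<open>K\<close> is the bounded factor that
  dimensions ignore.\<close>

definition bnd :: "real \<Rightarrow> nat \<Rightarrow> (nat \<times> int) option \<Rightarrow> real \<Rightarrow> bool" where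
  "bnd K n d c \<longleftrightarrow> (case d of None \<Rightarrow> c = 0 | Some q \<Rightarrow>
     (real p ^ n) powi hv n q / K \<le> c \<and> c \<le> K * (real p ^ n) powi hv n q)"

primrec cnt :: "nat \<Rightarrow> (nat \<Rightarrow> (nat \<Rightarrow> nat \<Rightarrow> int) \<Rightarrow> bool) \<Rightarrow> nat \<Rightarrow> (nat \<Rightarrow> nat \<Rightarrow> int) \<Rightarrow> nat" where
  "cnt 0 P n e = (if P n e then 1 else 0)"
| "cnt (Suc r) P n e = (\<Sum>a\<in>carrier (Gn n). cnt r P n (e(r := a)))"

lemma det_mh: "det S 0 (mh i S)"
  unfolding det_def mh_def by (intro allI impI arg_cong[of _ _ Min] image_cong) auto

lemma powi_mono:
  assumes "hv n q \<le> hv n q'"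
  shows "(real p ^ n) powi hv n q \<le> (real p ^ n) powi hv n q'"
  using p_pos assms by (intro power_int_increasing) auto

lemma powi_add: "(real p ^ n) powi hv n (fst q + fst h, snd q + snd h) =
  (real p ^ n) powi hv n q * (real p ^ n) powi hv n h"
proof -
  have "hv n (fst q + fst h, snd q + snd h) = hv n q + hv n h"
    by (simp add: hv_def algebra_simps)
  then show ?thesis using p_pos by (simp add: power_int_add)
qed

lemma powi_pos: "(real p ^ n) powi z > 0"
  using p_pos by simp

text \<open>Group the summands by the pattern of atoms at \<open>a\<close>. On a class
  \<open>F\<close> and \<open>mh\<close> are constant, and the class has about
  \<open>(p ^ n) powi\<close> the level \<open>mh\<close> elements, so it contributes the level
  \<open>dplus\<close>. There are at most \<open>2 ^ card S\<close> classes, so the largest level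
  dominates; \<open>ord\<close> guarantees that lexicographically larger levels are not smaller in
  size at this n.\<close>

lemma sum_bnd:
  fixes C :: "(nat \<Rightarrow> nat \<Rightarrow> int) \<Rightarrow> real"
  assumes fin: "finite S" and tr: "triv i \<in> S" and det: "det S N F" and K: "K \<ge> 1"
    and n: "n \<ge> N" "big i S n" and e: "env n e"
    and bnd: "\<And>e. env n e \<Longrightarrow> bnd K n (F n e) (C e)"
    and ord: "\<And>a b q q'. a \<in> carrier (Gn n) \<Longrightarrow> b \<in> carrier (Gn n) \<Longrightarrow>
      dplus (F n (e(i := a))) (mh i S n (e(i := a))) = Some q \<Longrightarrow>
      dplus (F n (e(i := b))) (mh i S n (e(i := b))) = Some q' \<Longrightarrow> q \<le> q' \<Longrightarrow> hv n q \<le> hv n q'"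
  shows "bnd (2 * 2 ^ card S * K) n
    (Max ((\<lambda>a. dplus (F n (e(i := a))) (mh i S n (e(i := a)))) ` carrier (Gn n)))
    (\<Sum>a\<in>carrier (Gn n). C (e(i := a)))"
proof -
  interpret homog "Gn n" p n by (rule homog)
  define A where "A = carrier (Gn n)"
  define X where "X = real p ^ n"
  define D where "D a = dplus (F n (e(i := a))) (mh i S n (e(i := a)))" for a
  define Q where "Q a = {a' \<in> A. agree S n (e(i := a)) n (e(i := a'))}" for a
  have A: "finite A" "A \<noteq> {}" using finite_carrier by (auto simp: A_def)
  have ea: "env n (e(i := a))" if "a \<in> A" for a using that e by (simp add: env_upd A_def)
  have FQ: "F n (e(i := a')) = F n (e(i := a))" if "a \<in> A" "a' \<in> Q a" for a a'
  proof -
    have "a' \<in> A" "agree S n (e(i := a)) n (e(i := a'))" using that by (auto simp: Q_def)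
    from detD[OF det n(1,1) ea[OF that(1)] ea[OF this(1)] this(2)] show ?thesis by simp
  qed
  have bndA: "bnd K n (F n (e(i := a))) (C (e(i := a)))" if "a \<in> A" for a
    by (rule bnd[OF ea[OF that]])
  have C0: "C (e(i := a)) \<ge> 0" if "a \<in> A" for a
  proof (cases "F n (e(i := a))")
    case (Some q)
    then have "X powi hv n q / K \<le> C (e(i := a))" using bndA[OF that] by (simp add: bnd_def X_def)
    moreover have "X powi hv n q / K \<ge> 0" using K powi_pos[of n "hv n q"] by (simp add: X_def)
    ultimately show ?thesis by linarith
  qed (use bndA[OF that] in \<open>simp add: bnd_def\<close>)
  have Qge: "X powi hv n (mh i S n (e(i := a))) / 2 \<le> real (card (Q a))" if "a \<in> A" for a
    using card_pattern_ge[OF fin tr e e _ n(2,2), of a] that by (simp add: Q_def X_def A_def)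
  have Qle: "real (card (Q a)) \<le> X powi hv n (mh i S n (e(i := a)))" if "a \<in> A" for a
    using card_pattern_le[OF fin tr e _ n(2), of a] that by (simp add: Q_def X_def A_def)
  have finD: "finite (D ` A)" "D ` A \<noteq> {}" using A by auto
  have Q_sub: "Q a \<subseteq> A" for a by (auto simp: Q_def)
  have goal: "bnd (2 * 2 ^ card S * K) n (Max (D ` A)) (\<Sum>a\<in>A. C (e(i := a)))"
  proof (cases "Max (D ` A)")
    case None
    have DN: "D a = None" if "a \<in> A" for a
      using Max_ge[OF finD(1), of "D a"] that None by (simp add: less_eq_option_None_is_None)
    have "F n (e(i := a)) = None" if "a \<in> A" for a
      using DN[OF that] by (cases "F n (e(i := a))") (auto simp: D_def dplus_def)
    then have "C (e(i := a)) = 0" if "a \<in> A" for a using that bndA[OF that] by (simp add: bnd_def)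
    then show ?thesis using None by (simp add: bnd_def)
  next
    case (Some q)
    have "Max (D ` A) \<in> D ` A" using finD by (rule Max_in)
    then obtain a where a: "a \<in> A" "D a = Some q" using Some by auto
    obtain q1 where q1: "F n (e(i := a)) = Some q1" using a by (auto simp: D_def dplus_def split: option.splits)
    have Xq: "X powi hv n q = X powi hv n q1 * X powi hv n (mh i S n (e(i := a)))"
      using a(2) q1 powi_add[of n q1] by (auto simp: D_def dplus_def X_def)
    \<comment> \<open>The class of a single point attaining the maximum suffices from below; the 2
      comes from \<open>card_pattern_ge\<close>.\<close>
    have "X powi hv n q / (2 * K) = (X powi hv n (mh i S n (e(i := a))) / 2) * (X powi hv n q1 / K)"
      by (simp add: Xq)
    also have "\<dots> \<le> real (card (Q a)) * (X powi hv n q1 / K)"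
      using Qge[OF a(1)] K powi_pos[of n "hv n q1"] by (intro mult_right_mono) (simp_all add: X_def)
    also have "\<dots> = (\<Sum>a'\<in>Q a. X powi hv n q1 / K)" by simp
    also have "\<dots> \<le> (\<Sum>a'\<in>Q a. C (e(i := a')))"
    proof (rule sum_mono)
      fix a' assume a': "a' \<in> Q a"
      then show "X powi hv n q1 / K \<le> C (e(i := a'))"
        using bndA[of a'] FQ[OF a(1) a'] q1 Q_sub by (auto simp: bnd_def X_def)
    qed
    also have "\<dots> \<le> (\<Sum>a'\<in>A. C (e(i := a')))"
      using A Q_sub C0 by (intro sum_mono2) auto
    finally have lower: "X powi hv n q / (2 * K) \<le> (\<Sum>a'\<in>A. C (e(i := a')))" .
    define pat where "pat a = {\<alpha>\<in>S. atm n (e(i := a)) \<alpha>}" for a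
    have patQ: "{a' \<in> A. pat a' = pat a} = Q a" for a by (auto simp: pat_def Q_def)
    have Xq0: "X powi hv n q > 0" using powi_pos by (simp add: X_def)
    have classes: "(\<Sum>a'\<in>{a' \<in> A. pat a' = T}. C (e(i := a'))) \<le> K * X powi hv n q" for T
    proof (cases "\<exists>b\<in>A. pat b = T")
      case False
      then have "{a' \<in> A. pat a' = T} = {}" by blast
      then show ?thesis using K Xq0 by (simp only: sum.empty) simp
    next
      case True
      then obtain b where b: "b \<in> A" "pat b = T" by blast
      then have eq: "{a' \<in> A. pat a' = T} = Q b" using patQ by auto
      show ?thesis
      proof (cases "F n (e(i := b))")
        case None
        have "(\<Sum>a'\<in>Q b. C (e(i := a'))) = 0"
        proof (rule sum.neutral, rule ballI)
          fix a' assume a': "a' \<in> Q b"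
          then show "C (e(i := a')) = 0" using bndA[of a'] FQ[OF b(1) a'] None Q_sub by (auto simp: bnd_def)
        qed
        then show ?thesis using K Xq0 eq by simp
      next
        case (Some q2)
        define q3 where "q3 = (fst q2 + fst (mh i S n (e(i := b))), snd q2 + snd (mh i S n (e(i := b))))"
        have D3: "D b = Some q3" by (simp add: D_def dplus_def Some q3_def)
        have "D b \<le> Max (D ` A)" using b(1) finD(1) by (intro Max_ge imageI)
        then have "q3 \<le> q" using D3 \<open>Max (D ` A) = Some q\<close> by simp
        then have "hv n q3 \<le> hv n q" using ord[of b a q3 q] a b D3 by (simp add: D_def A_def)
        then have le3: "X powi hv n q3 \<le> X powi hv n q" using powi_mono by (simp add: X_def)
        have "(\<Sum>a'\<in>Q b. C (e(i := a'))) \<le> (\<Sum>a'\<in>Q b. K * X powi hv n q2)"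
        proof (rule sum_mono)
          fix a' assume a': "a' \<in> Q b"
          then show "C (e(i := a')) \<le> K * X powi hv n q2"
            using bndA[of a'] FQ[OF b(1) a'] Some Q_sub by (auto simp: bnd_def X_def)
        qed
        also have "\<dots> = real (card (Q b)) * (K * X powi hv n q2)" by simp
        also have "\<dots> \<le> X powi hv n (mh i S n (e(i := b))) * (K * X powi hv n q2)"
          using Qle[OF b(1)] K powi_pos[of n "hv n q2"] by (intro mult_right_mono) (simp_all add: X_def)
        also have "\<dots> = K * X powi hv n q3" using powi_add[of n q2] by (simp add: q3_def X_def)
        also have "\<dots> \<le> K * X powi hv n q" using le3 K by simp
        finally show ?thesis using eq by simp
      qed
    qed
    have "(\<Sum>a'\<in>A. C (e(i := a'))) = (\<Sum>T\<in>Pow S. \<Sum>a'\<in>{a' \<in> A. pat a' = T}. C (e(i := a')))"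
      using A fin by (intro sum.group[symmetric]) (auto simp: pat_def)
    also have "\<dots> \<le> (\<Sum>T\<in>Pow S. K * X powi hv n q)" by (intro sum_mono classes)
    also have "\<dots> = 2 ^ card S * K * X powi hv n q" using fin by (simp add: card_Pow)
    finally have upper: "(\<Sum>a'\<in>A. C (e(i := a'))) \<le> 2 ^ card S * K * X powi hv n q" .
    have "(1::real) \<le> 2 ^ card S" by simp
    \<comment> \<open>The lower estimate needs \<open>2 * K\<close> and the upper one
      \<open>2 ^ card S * K\<close>; one constant covers both.\<close>
    have "X powi hv n q / (2 * 2 ^ card S * K) \<le> X powi hv n q / (2 * K)"
      using K Xq0 \<open>1 \<le> 2 ^ card S\<close> by (intro divide_left_mono mult_right_mono) auto
    moreover have "(\<Sum>a'\<in>A. C (e(i := a'))) \<le> 2 * 2 ^ card S * K * X powi hv n q"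
      by (rule order_trans[OF upper]) (use K Xq0 in simp)
    ultimately show ?thesis using lower Some by (simp add: bnd_def X_def)
  qed
  then show ?thesis by (simp add: A_def D_def)
qed

lemma mh_in:
  assumes "finite S" "triv i \<in> S" "env n e"
  shows "mh i S n e \<in> hgt i ` S"
  using mh_attained[OF assms] by (metis imageI)

text \<open>Summation over one variable: the level of the sum is the maximum of \<open>dplus\<close>
  over the values of that variable, hence determined by \<open>det_image\<close> followed by
  \<open>Max\<close>.\<close>

lemma count_step:
  fixes C :: "nat \<Rightarrow> (nat \<Rightarrow> nat \<Rightarrow> int) \<Rightarrow> real"
  assumes fin: "finite S" and tr: "triv i \<in> S" and det: "det S N F" and K: "K \<ge> 1" and W: "finite W"
    and bnd: "\<And>n e. n \<ge> N \<Longrightarrow> env n e \<Longrightarrow> F n e \<in> W \<and> bnd K n (F n e) (C n e)"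
  shows "\<exists>N' K' F'. det (elim i S) N' F' \<and> K' \<ge> 1 \<and> (\<forall>n\<ge>N'. \<forall>e. env n e \<longrightarrow>
    F' n e \<in> {dplus w h | w h. w \<in> W \<and> h \<in> hgt i ` S} \<and>
    bnd K' n (F' n e) (\<Sum>a\<in>carrier (Gn n). C n (e(i := a))))"
proof -
  define W' where "W' = {dplus w h | w h. w \<in> W \<and> h \<in> hgt i ` S}"
  have finW': "finite W'" unfolding W'_def using W fin by (intro finite_image_set2) auto
  \<comment> \<open>All levels that can occur. As they are finitely many, \<open>hv n\<close> orders
    them lexicographically from some \<open>N'\<close> on, which supplies \<open>ord\<close> in
    \<open>sum_bnd\<close>.\<close>
  define V where "V = {q. Some q \<in> W'}"
  have "finite V"
  proof -
    have "V \<subseteq> the ` W'" by (force simp: V_def)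
    then show ?thesis using finW' finite_subset by blast
  qed
  then have "eventually (\<lambda>n. \<forall>q\<in>V. \<forall>q'\<in>V. hv n q \<le> hv n q' \<longleftrightarrow> q \<le> q') sequentially"
    by (intro eventually_ball_finite ballI eventually_lex) auto
  then have "eventually (\<lambda>n. N \<le> n \<and> big i S n \<and> (\<forall>q\<in>V. \<forall>q'\<in>V. hv n q \<le> hv n q' \<longleftrightarrow> q \<le> q')) sequentially"
    using eventually_big[OF fin, of i] eventually_ge_at_top[of N] by eventually_elim auto
  then obtain N' where N': "\<And>n. n \<ge> N' \<Longrightarrow> N \<le> n \<and> big i S n \<and>
      (\<forall>q\<in>V. \<forall>q'\<in>V. hv n q \<le> hv n q' \<longleftrightarrow> q \<le> q')"
    by (auto simp: eventually_sequentially)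
  have NN': "N \<le> N'" using N' by blast
  define D where "D n e = dplus (F n e) (mh i S n e)" for n e
  define F' where "F' n e = Max ((\<lambda>a. D n (e(i := a))) ` carrier (Gn n))" for n e
  have "det S N' D"
    using det_mono[OF det_comp2[OF det det_mh[of S i], of dplus], of S N'] NN' by (simp add: D_def[abs_def])
  then have "det (elim i S) N' F'" unfolding F'_def
    using N' by (intro det_comp[of _ _ _ Max] det_image fin tr) auto
  moreover have "F' n e \<in> W' \<and> bnd (2 * 2 ^ card S * K) n (F' n e) (\<Sum>a\<in>carrier (Gn n). C n (e(i := a)))"
    if n: "n \<ge> N'" and e: "env n e" for n e
  proof
    interpret homog "Gn n" p n by (rule homog)
    have DW: "D n (e(i := a)) \<in> W'" if "a \<in> carrier (Gn n)" for a
      using bnd[of n "e(i := a)"] mh_in[OF fin tr, of n "e(i := a)"] env_upd[OF e that] N'[OF n]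
      unfolding D_def W'_def by blast
    have "F' n e \<in> (\<lambda>a. D n (e(i := a))) ` carrier (Gn n)"
      unfolding F'_def using finite_carrier by (intro Max_in) auto
    then show "F' n e \<in> W'" using DW by auto
    show "bnd (2 * 2 ^ card S * K) n (F' n e) (\<Sum>a\<in>carrier (Gn n). C n (e(i := a)))"
      unfolding F'_def D_def
    proof (rule sum_bnd[OF fin tr det K _ _ e])
      show "N \<le> n" "big i S n" using N'[OF n] by auto
      then show "bnd K n (F n e) (C n e)" if "env n e" for e using bnd that by blast
      show "hv n q \<le> hv n q'"
        if "a \<in> carrier (Gn n)" "b \<in> carrier (Gn n)"
          "dplus (F n (e(i := a))) (mh i S n (e(i := a))) = Some q"
          "dplus (F n (e(i := b))) (mh i S n (e(i := b))) = Some q'" "q \<le> q'" for a b q q'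
      proof -
        have "q \<in> V" "q' \<in> V"
          using DW[OF that(1)] DW[OF that(2)] that(3,4) by (auto simp: V_def D_def)
        then show ?thesis using N'[OF n] that(5) by blast
      qed
    qed
  qed
  moreover have "1 \<le> 2 * 2 ^ card S * K"
  proof -
    have "(1::real) \<le> 2 * 2 ^ card S" using one_le_power[of "2::real" "card S"] by linarith
    from mult_mono[OF this K] show ?thesis by simp
  qed
  ultimately show ?thesis unfolding W'_def by blast
qed

text \<open>\<open>W\<close> and \<open>\<Sigma>'\<close> are arguments, while \<open>S'\<close>,
  \<open>N'\<close>, \<open>K\<close> and \<open>F\<close> are quantified inside: values and shapes
  are to be uniform, thresholds and constants may vary.\<close>

definition counted where
  "counted W \<Sigma>' R r S P \<longleftrightarrow> (\<exists>S' N' K F. finite S' \<and> shp R ` S' \<subseteq> \<Sigma>' \<and>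
    avars S' \<subseteq> avars S - {..<r} \<and> det S' N' F \<and> K \<ge> 1 \<and>
    (\<forall>n\<ge>N'. \<forall>e. env n e \<longrightarrow> F n e \<in> W \<and> bnd K n (F n e) (real (cnt r P n e))))"

text \<open>The order of quantifiers is the point: \<open>W\<close> and \<open>\<Sigma>'\<close>
  come from the shapes alone, before the number of atoms is known. Each variable adds the shape of
  one \<open>triv\<close> atom, adds one of finitely many heights to the levels, and replaces the
  shapes by \<open>selim\<close>.\<close>

theorem count:
  assumes "finite \<Sigma>" "r \<le> R"
  shows "\<exists>W \<Sigma>'. finite W \<and> finite \<Sigma>' \<and>
    (\<forall>S N P. finite S \<longrightarrow> shp R ` S \<subseteq> \<Sigma> \<longrightarrow> det S N P \<longrightarrow> counted W \<Sigma>' R r S P)"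
  using assms(2)
proof (induction r)
  case 0
  \<comment> \<open>With nothing to count the number is 0 or 1, and 1 has level
    \<open>(0, 0)\<close>.\<close>
  let ?W = "{None, Some (0, 0)} :: (nat \<times> int) option set"
  have "counted ?W \<Sigma> R 0 S P" if "finite S" "shp R ` S \<subseteq> \<Sigma>" "det S N P" for S N P
    unfolding counted_def using that det_comp[OF that(3), of "\<lambda>b. if b then Some (0, 0) else None"]
    by (intro exI[of _ S] exI[of _ N] exI[of _ 1]
        exI[of _ "\<lambda>n e. if P n e then Some (0, 0) else None"]) (auto simp: bnd_def hv_def)
  then show ?case using assms(1) by (intro exI[of _ ?W] exI[of _ \<Sigma>]) auto
next
  case (Suc r)
  then obtain W \<Sigma>1 where IH: "finite W" "finite \<Sigma>1"
    "\<And>S N P. finite S \<Longrightarrow> shp R ` S \<subseteq> \<Sigma> \<Longrightarrow> det S N P \<Longrightarrow> counted W \<Sigma>1 R r S P"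
    by auto
  have r: "r < R" using Suc by simp
  define \<Sigma>2 where "\<Sigma>2 = insert (shp R (triv r)) \<Sigma>1"
  define W' where "W' = {dplus w h | w h. w \<in> W \<and> h \<in> shgt r ` \<Sigma>2}"
  have fin: "finite \<Sigma>2" "finite W'" "finite (selim r \<Sigma>2)"
    using IH(1,2) by (auto simp: W'_def \<Sigma>2_def finite_selim intro!: finite_image_set2)
  have "counted W' (selim r \<Sigma>2) R (Suc r) S P"
    if S: "finite S" "shp R ` S \<subseteq> \<Sigma>" "det S N P" for S N P
  proof -
    obtain S1 N1 K1 F1 where 1: "finite S1" "shp R ` S1 \<subseteq> \<Sigma>1" "avars S1 \<subseteq> avars S - {..<r}"
      "det S1 N1 F1" "K1 \<ge> 1"
      "\<And>n e. n \<ge> N1 \<Longrightarrow> env n e \<Longrightarrow> F1 n e \<in> W \<and> bnd K1 n (F1 n e) (real (cnt r P n e))"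
      using IH(3)[OF S] unfolding counted_def by blast
    let ?S = "insert (triv r) S1"
    have "det ?S N1 F1" by (rule det_mono[OF 1(4)]) auto
    then obtain N' K' F' where F': "det (elim r ?S) N' F'" "K' \<ge> 1"
      "\<And>n e. n \<ge> N' \<Longrightarrow> env n e \<Longrightarrow> F' n e \<in> {dplus w h | w h. w \<in> W \<and> h \<in> hgt r ` ?S} \<and>
        bnd K' n (F' n e) (\<Sum>a\<in>carrier (Gn n). real (cnt r P n (e(r := a))))"
      using count_step[of ?S r N1 F1 K1 W "\<lambda>n e. real (cnt r P n e)"] 1 IH(1) by auto
    have sub: "shp R ` ?S \<subseteq> \<Sigma>2" using 1(2) by (auto simp: \<Sigma>2_def)
    then have "hgt r ` ?S \<subseteq> shgt r ` \<Sigma>2" using hgt_shp[OF r] by fastforce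
    then have "{dplus w h | w h. w \<in> W \<and> h \<in> hgt r ` ?S} \<subseteq> W'" unfolding W'_def by blast
    moreover have "avars (elim r ?S) \<subseteq> avars S - {..<Suc r}"
      using avars_elim[of r ?S] 1(3) by (auto simp: avars_insert lessThan_Suc)
    ultimately show ?thesis unfolding counted_def
      using F' shp_elim[OF r sub] finite_elim[of ?S r] 1(1)
      by (intro exI[of _ "elim r ?S"] exI[of _ N'] exI[of _ K'] exI[of _ F']) fastforce
  qed
  then show ?case using fin by (intro exI[of _ W'] exI[of _ "selim r \<Sigma>2"]) auto
qed

end

subsection \<open>Ultraproducts of groups\<close>

locale ultra =
  fixes U :: "'i filter" and G :: "'i \<Rightarrow> 'a monoid"
  assumes ultrafilter: "nonprincipal_ultrafilter U" and grp: "group (G n)"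
begin

definition fam :: "('i \<Rightarrow> 'a) set" where
  "fam = Pi UNIV (\<lambda>n. carrier (G n))"

lemma fam_iff: "f \<in> fam \<longleftrightarrow> (\<forall>n. f n \<in> carrier (G n))"
  by (auto simp: fam_def)

abbreviation cls :: "('i \<Rightarrow> 'a) \<Rightarrow> ('i \<Rightarrow> 'a) set" where
  "cls \<equiv> uclass U (\<lambda>n. carrier (G n))"

abbreviation M :: "('i \<Rightarrow> 'a) set monoid" where
  "M \<equiv> ultraproduct U G"

lemma U_not_bot: "U \<noteq> bot"
  using ultrafilter by (simp add: nonprincipal_ultrafilter_def)

lemma eventually_not: "eventually (\<lambda>n. \<not> P n) U \<longleftrightarrow> \<not> eventually P U"
proof
  assume "eventually (\<lambda>n. \<not> P n) U"
  then show "\<not> eventually P U"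
    using U_not_bot eventually_conj[of P U "\<lambda>n. \<not> P n"] by (auto simp: trivial_limit_def)
qed (use ultrafilter in \<open>auto simp: nonprincipal_ultrafilter_def\<close>)

lemma cls_eq_iff:
  assumes "f \<in> fam" "g \<in> fam"
  shows "cls f = cls g \<longleftrightarrow> eventually (\<lambda>n. f n = g n) U"
proof
  assume "cls f = cls g"
  moreover have "f \<in> cls f" using assms by (simp add: uclass_def fam_def)
  ultimately have "f \<in> cls g" by simp
  then show "eventually (\<lambda>n. f n = g n) U" by (simp add: uclass_def)
next
  assume *: "eventually (\<lambda>n. f n = g n) U"
  show "cls f = cls g"
    unfolding uclass_def
  proof (intro Collect_cong conj_cong refl iffI)
    show "eventually (\<lambda>n. h n = g n) U" if "eventually (\<lambda>n. h n = f n) U" for h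
      using * that by eventually_elim simp
    show "eventually (\<lambda>n. h n = f n) U" if "eventually (\<lambda>n. h n = g n) U" for h
      using * that by eventually_elim simp
  qed
qed

lemma urep_in: "f \<in> fam \<Longrightarrow> urep (cls f) \<in> cls f"
  unfolding urep_def by (rule someI[of _ f]) (simp add: uclass_def fam_def)

lemma urep_cls: "f \<in> fam \<Longrightarrow> eventually (\<lambda>n. urep (cls f) n = f n) U"
  using urep_in[of f] by (simp add: uclass_def)

lemma carrier_M: "carrier M = cls ` fam"
  by (simp add: ultraproduct_def fam_def)

lemma urep_fam: "\<alpha> \<in> carrier M \<Longrightarrow> urep \<alpha> \<in> fam"
  using urep_in by (auto simp: carrier_M uclass_def fam_def)

lemma urep_carrier: "\<alpha> \<in> carrier M \<Longrightarrow> urep \<alpha> n \<in> carrier (G n)"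
  using urep_fam by (auto simp: fam_def)

lemma cls_urep: "\<alpha> \<in> carrier M \<Longrightarrow> cls (urep \<alpha>) = \<alpha>"
  using urep_cls urep_fam[of \<alpha>] by (auto simp: carrier_M) (metis cls_eq_iff)+

lemma mult_fam: "f \<in> fam \<Longrightarrow> g \<in> fam \<Longrightarrow> (\<lambda>n. f n \<otimes>\<^bsub>G n\<^esub> g n) \<in> fam"
  using grp by (simp add: fam_iff group.is_monoid monoid.m_closed)

lemma inv_fam: "f \<in> fam \<Longrightarrow> (\<lambda>n. inv\<^bsub>G n\<^esub> f n) \<in> fam"
  using grp by (simp add: fam_iff group.inv_closed)

lemma one_fam: "(\<lambda>n. \<one>\<^bsub>G n\<^esub>) \<in> fam"
  using grp by (auto simp: fam_def group.is_monoid monoid.one_closed)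

lemma mult_cls:
  assumes "f \<in> fam" "g \<in> fam"
  shows "cls f \<otimes>\<^bsub>M\<^esub> cls g = cls (\<lambda>n. f n \<otimes>\<^bsub>G n\<^esub> g n)"
proof -
  have u: "urep (cls f) \<in> fam" "urep (cls g) \<in> fam" using assms by (auto intro: urep_fam simp: carrier_M)
  have "eventually (\<lambda>n. urep (cls f) n \<otimes>\<^bsub>G n\<^esub> urep (cls g) n = f n \<otimes>\<^bsub>G n\<^esub> g n) U"
    using urep_cls[OF assms(1)] urep_cls[OF assms(2)] by eventually_elim simp
  then have "cls (\<lambda>n. urep (cls f) n \<otimes>\<^bsub>G n\<^esub> urep (cls g) n) = cls (\<lambda>n. f n \<otimes>\<^bsub>G n\<^esub> g n)"
    using assms u by (simp add: cls_eq_iff mult_fam)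
  then show ?thesis by (simp add: ultraproduct_def)
qed

lemma one_M: "\<one>\<^bsub>M\<^esub> = cls (\<lambda>n. \<one>\<^bsub>G n\<^esub>)"
  by (simp add: ultraproduct_def)

lemma group_M: "group M"
proof (rule groupI)
  fix x y z assume xyz: "x \<in> carrier M" "y \<in> carrier M"
  then obtain f g where fg: "f \<in> fam" "x = cls f" "g \<in> fam" "y = cls g" by (auto simp: carrier_M)
  then show "x \<otimes>\<^bsub>M\<^esub> y \<in> carrier M" by (simp add: mult_cls mult_fam carrier_M)
  show "\<one>\<^bsub>M\<^esub> \<otimes>\<^bsub>M\<^esub> x = x"
    unfolding one_M fg mult_cls[OF one_fam fg(1)]
    by (rule arg_cong[of _ _ cls]) (use fg(1) grp in \<open>auto simp: fam_def group.is_monoid fun_eq_iff Pi_iff monoid.l_one\<close>)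
  have "cls (\<lambda>n. inv\<^bsub>G n\<^esub> f n) \<otimes>\<^bsub>M\<^esub> x = \<one>\<^bsub>M\<^esub>"
    unfolding one_M fg mult_cls[OF inv_fam[OF fg(1)] fg(1)]
    by (rule arg_cong[of _ _ cls]) (use fg(1) grp in \<open>auto simp: fam_def group.l_inv fun_eq_iff Pi_iff\<close>)
  then show "\<exists>y\<in>carrier M. y \<otimes>\<^bsub>M\<^esub> x = \<one>\<^bsub>M\<^esub>" using inv_fam[OF fg(1)] carrier_M by blast
  show "x \<otimes>\<^bsub>M\<^esub> y \<otimes>\<^bsub>M\<^esub> z = x \<otimes>\<^bsub>M\<^esub> (y \<otimes>\<^bsub>M\<^esub> z)" if z: "z \<in> carrier M"
  proof -
    obtain h where h: "h \<in> fam" "z = cls h" using z by (auto simp: carrier_M)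
    have "f n \<otimes>\<^bsub>G n\<^esub> g n \<otimes>\<^bsub>G n\<^esub> h n = f n \<otimes>\<^bsub>G n\<^esub> (g n \<otimes>\<^bsub>G n\<^esub> h n)" for n
      using fg h grp[of n] by (simp add: fam_iff group.is_monoid monoid.m_assoc)
    then show ?thesis using fg h by (simp add: mult_cls mult_fam)
  qed
qed (auto simp: one_M carrier_M one_fam)

lemma inv_cls:
  assumes "f \<in> fam"
  shows "inv\<^bsub>M\<^esub> (cls f) = cls (\<lambda>n. inv\<^bsub>G n\<^esub> f n)"
proof (rule group.inv_equality[OF group_M])
  show "cls (\<lambda>n. inv\<^bsub>G n\<^esub> f n) \<otimes>\<^bsub>M\<^esub> cls f = \<one>\<^bsub>M\<^esub>"
    unfolding one_M mult_cls[OF inv_fam[OF assms] assms]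
    by (rule arg_cong[of _ _ cls]) (use assms grp in \<open>auto simp: fam_def group.l_inv fun_eq_iff Pi_iff\<close>)
qed (use assms inv_fam carrier_M in auto)

lemma tval_fam: "(\<And>i. f i \<in> fam) \<Longrightarrow> (\<lambda>n. tval (G n) (\<lambda>i. f i n) t) \<in> fam"
  using tval_closed[OF grp] by (auto simp: fam_def Pi_iff)

lemma tval_cls:
  assumes "\<And>i. f i \<in> fam"
  shows "tval M (\<lambda>i. cls (f i)) t = cls (\<lambda>n. tval (G n) (\<lambda>i. f i n) t)"
  using assms by (induction t) (auto simp: one_M inv_cls mult_cls tval_fam)

text \<open>Los's theorem, stated for given representatives so that updates of the environment
  commute with \<open>cls\<close>; \<open>los\<close> specializes it to the representatives
  \<open>urep\<close>.\<close>

theorem los_cls: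
  assumes "\<And>i. f i \<in> fam"
  shows "sat M (\<lambda>i. cls (f i)) \<phi> \<longleftrightarrow> eventually (\<lambda>n. sat (G n) (\<lambda>i. f i n) \<phi>) U"
  using assms
proof (induction \<phi> arbitrary: f)
  case (Eq t u)
  then show ?case by (simp add: tval_cls cls_eq_iff tval_fam)
next
  case (Neg \<phi>)
  then show ?case by (simp add: eventually_not)
next
  case (Conj \<phi> \<psi>)
  then show ?case by (simp add: eventually_conj_iff)
next
  case (Exi j \<phi>)
  have upd: "(\<lambda>i. cls (f i))(j := cls g) = (\<lambda>i. cls ((f(j := g)) i))"
    "(\<lambda>i. f i n)(j := g n) = (\<lambda>i. (f(j := g)) i n)" for g n by (auto simp: fun_eq_iff)
  have IH: "sat M ((\<lambda>i. cls (f i))(j := cls g)) \<phi> \<longleftrightarrow>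
    eventually (\<lambda>n. sat (G n) ((\<lambda>i. f i n)(j := g n)) \<phi>) U" if "g \<in> fam" for g
    unfolding upd by (rule Exi.IH) (use that Exi.prems in auto)
  show ?case
  proof
    assume "sat M (\<lambda>i. cls (f i)) (Exi j \<phi>)"
    then obtain g where g: "g \<in> fam" "sat M ((\<lambda>i. cls (f i))(j := cls g)) \<phi>" by (auto simp: carrier_M)
    then have "eventually (\<lambda>n. sat (G n) ((\<lambda>i. f i n)(j := g n)) \<phi>) U" by (simp add: IH)
    then show "eventually (\<lambda>n. sat (G n) (\<lambda>i. f i n) (Exi j \<phi>)) U"
      by eventually_elim (use g(1) in \<open>auto simp: fam_def\<close>)
  next
    assume *: "eventually (\<lambda>n. sat (G n) (\<lambda>i. f i n) (Exi j \<phi>)) U"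
    define g where "g n = (if sat (G n) (\<lambda>i. f i n) (Exi j \<phi>)
      then SOME a. a \<in> carrier (G n) \<and> sat (G n) ((\<lambda>i. f i n)(j := a)) \<phi> else \<one>\<^bsub>G n\<^esub>)" for n
    have gn: "g n \<in> carrier (G n) \<and> sat (G n) ((\<lambda>i. f i n)(j := g n)) \<phi>"
      if "sat (G n) (\<lambda>i. f i n) (Exi j \<phi>)" for n
    proof -
      have "\<exists>a. a \<in> carrier (G n) \<and> sat (G n) ((\<lambda>i. f i n)(j := a)) \<phi>" using that by auto
      from someI_ex[OF this] show ?thesis using that by (simp add: g_def)
    qed
    have "g n \<in> carrier (G n)" for n
      using gn[of n] grp[of n] by (auto simp: g_def group.is_monoid monoid.one_closed)
    then have g: "g \<in> fam" by (auto simp: fam_def)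
    have "eventually (\<lambda>n. sat (G n) ((\<lambda>i. f i n)(j := g n)) \<phi>) U"
      using * by eventually_elim (use gn in blast)
    then have "sat M ((\<lambda>i. cls (f i))(j := cls g)) \<phi>" using IH g by blast
    then show "sat M (\<lambda>i. cls (f i)) (Exi j \<phi>)" using g by (auto simp: carrier_M)
  qed
qed

theorem los:
  assumes "\<And>i. i \<in> fvars \<phi> \<Longrightarrow> e i \<in> carrier M"
  shows "sat M e \<phi> \<longleftrightarrow> eventually (\<lambda>n. sat (G n) (\<lambda>i. urep (e i) n) \<phi>) U"
proof -
  define f where "f i = (if i \<in> fvars \<phi> then urep (e i) else (\<lambda>n. \<one>\<^bsub>G n\<^esub>))" for i
  have f: "f i \<in> fam" for i using assms urep_fam one_fam by (simp add: f_def)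
  have "sat M e \<phi> \<longleftrightarrow> sat M (\<lambda>i. cls (f i)) \<phi>"
    by (rule sat_cong) (simp add: f_def cls_urep assms)
  also have "\<dots> \<longleftrightarrow> eventually (\<lambda>n. sat (G n) (\<lambda>i. f i n) \<phi>) U" by (rule los_cls[OF f])
  also have "(\<lambda>n. sat (G n) (\<lambda>i. f i n) \<phi>) = (\<lambda>n. sat (G n) (\<lambda>i. urep (e i) n) \<phi>)"
    by (intro ext sat_cong) (simp add: f_def)
  finally show ?thesis .
qed

abbreviation comp :: "('i \<Rightarrow> 'a) set list \<Rightarrow> 'i \<Rightarrow> 'a list" where
  "comp b n \<equiv> map (\<lambda>\<beta>. urep \<beta> n) b"

lemma comp_tuples: "b \<in> tuples s (carrier M) \<Longrightarrow> comp b n \<in> tuples s (carrier (G n))"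
  using urep_carrier by (auto simp: tuples_def)

lemma los_holds:
  assumes "form2 r s \<phi>" "a \<in> tuples r (carrier M)" "b \<in> tuples s (carrier M)"
  shows "holds M \<phi> a b \<longleftrightarrow> eventually (\<lambda>n. holds (G n) \<phi> (comp a n) (comp b n)) U"
proof -
  have len: "length (a @ b) = r + s" "set (a @ b) \<subseteq> carrier M" using assms by (auto simp: tuples_def)
  have *: "i < length (a @ b)" if "i \<in> fvars \<phi>" for i using that assms(1) len by (auto simp: form2_def)
  have "holds M \<phi> a b \<longleftrightarrow> eventually (\<lambda>n. sat (G n) (\<lambda>i. urep ((a @ b) ! i) n) \<phi>) U"
    unfolding holds_def using * len(2) nth_mem by (intro los) blast
  also have "(\<lambda>n. sat (G n) (\<lambda>i. urep ((a @ b) ! i) n) \<phi>) = (\<lambda>n. holds (G n) \<phi> (comp a n) (comp b n))"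
    unfolding holds_def using * by (intro ext sat_cong) (simp flip: map_append)
  finally show ?thesis .
qed

lemma lift_tuple:
  assumes "\<And>n. x n \<in> tuples r (carrier (G n))"
  shows "\<exists>a\<in>tuples r (carrier M). eventually (\<lambda>n. comp a n = x n) U"
proof -
  have f: "(\<lambda>n. x n ! i) \<in> fam" if "i < r" for i
    using assms that by (fastforce simp: fam_def tuples_def)
  define a where "a = map (\<lambda>i. cls (\<lambda>n. x n ! i)) [0..<r]"
  have "a \<in> tuples r (carrier M)" using f by (auto simp: a_def tuples_def carrier_M)
  moreover have "eventually (\<lambda>n. \<forall>i\<in>{..<r}. urep (cls (\<lambda>n. x n ! i)) n = x n ! i) U"
    using f by (intro eventually_ball_finite) (auto intro!: urep_cls)
  then have "eventually (\<lambda>n. comp a n = x n) U"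
  proof eventually_elim
    case (elim n)
    then show ?case using assms[of n] by (intro nth_equalityI) (auto simp: a_def tuples_def)
  qed
  ultimately show ?thesis by blast
qed

text \<open>Counterexamples chosen in almost all factors would assemble to one in the ultraproduct.
  This is what compares a definable set with its definable supersets when its cut is
  computed.\<close>

lemma defset_subset:
  assumes \<phi>: "form2 r s \<phi>" "b \<in> tuples s (carrier M)" and \<psi>: "form2 r t \<psi>" "c \<in> tuples t (carrier M)"
    and sub: "defset M r \<phi> b \<subseteq> defset M r \<psi> c"
  shows "eventually (\<lambda>n. defset (G n) r \<phi> (comp b n) \<subseteq> defset (G n) r \<psi> (comp c n)) U"
proof (rule ccontr)
  assume "\<not> ?thesis"
  then have ev: "eventually (\<lambda>n. \<not> defset (G n) r \<phi> (comp b n) \<subseteq> defset (G n) r \<psi> (comp c n)) U"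
    by (simp add: eventually_not)
  define x where "x n = (if defset (G n) r \<phi> (comp b n) \<subseteq> defset (G n) r \<psi> (comp c n)
    then replicate r \<one>\<^bsub>G n\<^esub> else SOME y. y \<in> defset (G n) r \<phi> (comp b n) - defset (G n) r \<psi> (comp c n))" for n
  have x: "x n \<in> defset (G n) r \<phi> (comp b n) - defset (G n) r \<psi> (comp c n)"
    if "\<not> defset (G n) r \<phi> (comp b n) \<subseteq> defset (G n) r \<psi> (comp c n)" for n
  proof -
    have "\<exists>y. y \<in> defset (G n) r \<phi> (comp b n) - defset (G n) r \<psi> (comp c n)" using that by blast
    from someI_ex[OF this] show ?thesis using that by (simp add: x_def)
  qed
  have "x n \<in> tuples r (carrier (G n))" for n
  proof (cases "defset (G n) r \<phi> (comp b n) \<subseteq> defset (G n) r \<psi> (comp c n)")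
    case True
    then show ?thesis using grp[of n] by (auto simp: x_def tuples_def group.is_monoid monoid.one_closed)
  next
    case False
    then show ?thesis using x[of n] by (auto simp: defset_def)
  qed
  then obtain a where a: "a \<in> tuples r (carrier M)" "eventually (\<lambda>n. comp a n = x n) U"
    using lift_tuple[of x r] by blast
  from ev a(2) have ev': "eventually (\<lambda>n. holds (G n) \<phi> (comp a n) (comp b n) \<and>
      \<not> holds (G n) \<psi> (comp a n) (comp c n)) U"
  proof eventually_elim
    case (elim n)
    then show ?case using x[of n] by (auto simp: defset_def)
  qed
  then have "eventually (\<lambda>n. holds (G n) \<phi> (comp a n) (comp b n)) U"
    "eventually (\<lambda>n. \<not> holds (G n) \<psi> (comp a n) (comp c n)) U" by (auto simp: eventually_conj_iff)
  then have "a \<in> defset M r \<phi> b" "a \<notin> defset M r \<psi> c"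
    using a(1) los_holds[OF \<phi>(1) a(1) \<phi>(2)] los_holds[OF \<psi>(1) a(1) \<psi>(2)]
    by (auto simp: defset_def eventually_not)
  then show False using sub by blast
qed

end

subsection \<open>Universal closures\<close>

primrec clo :: "nat \<Rightarrow> gform \<Rightarrow> gform" where
  "clo 0 \<phi> = \<phi>"
| "clo (Suc m) \<phi> = clo m (Neg (Exi m (Neg \<phi>)))"

lemma fvars_clo: "fvars (clo m \<phi>) = fvars \<phi> - {..<m}"
  by (induction m arbitrary: \<phi>) (auto simp: lessThan_Suc)

lemma sat_clo: "sat G e (clo m \<phi>) \<longleftrightarrow>
    (\<forall>e'. (\<forall>i<m. e' i \<in> carrier G) \<longrightarrow> (\<forall>i\<ge>m. e' i = e i) \<longrightarrow> sat G e' \<phi>)"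
proof (induction m arbitrary: \<phi>)
  case 0
  show ?case by (auto intro: arg_cong[of _ _ "\<lambda>e. sat G e \<phi>"])
next
  case (Suc m)
  show ?case
    unfolding clo.simps Suc.IH
  proof (intro iffI allI impI)
    fix e' assume *: "\<forall>e'. (\<forall>i<m. e' i \<in> carrier G) \<longrightarrow> (\<forall>i\<ge>m. e' i = e i) \<longrightarrow>
        sat G e' (Neg (Exi m (Neg \<phi>)))"
      and e': "\<forall>i<Suc m. e' i \<in> carrier G" "\<forall>i\<ge>Suc m. e' i = e i"
    have "sat G (e'(m := e m)) (Neg (Exi m (Neg \<phi>)))"
      by (rule *[rule_format]) (use e' in auto)
    moreover have "e' m \<in> carrier G" using e' by simp
    ultimately have "sat G ((e'(m := e m))(m := e' m)) \<phi>" unfolding sat.simps by blast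
    then show "sat G e' \<phi>" by simp
  next
    fix e' assume *: "\<forall>e'. (\<forall>i<Suc m. e' i \<in> carrier G) \<longrightarrow> (\<forall>i\<ge>Suc m. e' i = e i) \<longrightarrow> sat G e' \<phi>"
      and e': "\<forall>i<m. e' i \<in> carrier G" "\<forall>i\<ge>m. e' i = e i"
    have "sat G (e'(m := a)) \<phi>" if "a \<in> carrier G" for a
      by (rule *[rule_format]) (use e' that in auto)
    then show "sat G e' (Neg (Exi m (Neg \<phi>)))" by simp
  qed
qed

text \<open>The universal closure of \<theta> belongs to the theory by Los's theorem, so it holds in
  every model, on whatever type.\<close>

lemma (in ultra) Th_transfer:
  assumes valid: "eventually (\<lambda>n. \<forall>e. (\<forall>i. e i \<in> carrier (G n)) \<longrightarrow> sat (G n) e \<theta>) U"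
    and N: "is_model N (Th M)" "\<And>i. i \<in> fvars \<theta> \<Longrightarrow> e i \<in> carrier N"
  shows "sat N e \<theta>"
proof -
  define m where "m = Suc (Max (insert 0 (fvars \<theta>)))"
  have m: "i < m" if "i \<in> fvars \<theta>" for i
    using that by (simp add: m_def less_Suc_eq_le)
  have fv: "fvars (clo m \<theta>) = {}" using m by (auto simp: fvars_clo)
  have "eventually (\<lambda>n. sat (G n) (\<lambda>i. urep (\<one>\<^bsub>M\<^esub>) n) (clo m \<theta>)) U"
    using valid
  proof eventually_elim
    case (elim n)
    show ?case unfolding sat_clo
    proof (intro allI impI)
      fix e' :: "nat \<Rightarrow> 'a" assume e': "\<forall>i<m. e' i \<in> carrier (G n)"
      let ?e = "\<lambda>i. if i < m then e' i else \<one>\<^bsub>G n\<^esub>"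
      have "sat (G n) ?e \<theta>" using e' grp[of n] elim by (simp add: group.is_monoid monoid.one_closed)
      also have "sat (G n) ?e \<theta> \<longleftrightarrow> sat (G n) e' \<theta>" by (rule sat_cong) (simp add: m)
      finally show "sat (G n) e' \<theta>" .
    qed
  qed
  then have "sat M (\<lambda>_. \<one>\<^bsub>M\<^esub>) (clo m \<theta>)" using fv by (subst los) auto
  then have "clo m \<theta> \<in> Th M" using fv by (simp add: Th_def)
  then have sN: "sat N (\<lambda>_. \<one>\<^bsub>N\<^esub>) (clo m \<theta>)" using N(1) by (simp add: is_model_def)
  have gN: "group N" using N(1) by (simp add: is_model_def)
  \<comment> \<open>The closure quantifies over all indices below \<open>m\<close>, also those not
    free in \<theta>; there the unit is a harmless element of the carrier.\<close>
  let ?e = "\<lambda>i. if i \<in> fvars \<theta> then e i else \<one>\<^bsub>N\<^esub>"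
  have "sat N ?e \<theta>"
    using gN N(2) m by (intro sN[unfolded sat_clo, rule_format])
      (force simp: group.is_monoid monoid.one_closed)+
  also have "sat N ?e \<theta> \<longleftrightarrow> sat N e \<theta>" by (rule sat_cong) simp
  finally show ?thesis .
qed

subsection \<open>Definability and stability\<close>

text \<open>A general model has no exponent \<open>p ^ n\<close>, so the two ends of the filtration
  become separate families of subgroups: the m-th powers and the elements killed by m.\<close>

definition Hsub :: "'a monoid \<Rightarrow> nat \<Rightarrow> bool \<Rightarrow> 'a set" where
  "Hsub G m b = (if b then (\<lambda>z. z [^]\<^bsub>G\<^esub> m) ` carrier G else {x \<in> carrier G. x [^]\<^bsub>G\<^esub> m = \<one>\<^bsub>G\<^esub>})"

lemma subgroup_Hsub:
  assumes "comm_group G"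
  shows "subgroup (Hsub G m b) G"
proof -
  interpret comm_group G by fact
  show ?thesis
  proof (cases b)
    case True
    have "\<one>\<^bsub>G\<^esub> \<in> (\<lambda>z. z [^]\<^bsub>G\<^esub> m) ` carrier G" by (metis image_eqI nat_pow_one one_closed)
    moreover have "inv\<^bsub>G\<^esub> a \<in> (\<lambda>z. z [^]\<^bsub>G\<^esub> m) ` carrier G" if "a \<in> (\<lambda>z. z [^]\<^bsub>G\<^esub> m) ` carrier G" for a
      using that by (auto simp: nat_pow_inv[symmetric])
    moreover have "a \<otimes>\<^bsub>G\<^esub> c \<in> (\<lambda>z. z [^]\<^bsub>G\<^esub> m) ` carrier G"
      if "a \<in> (\<lambda>z. z [^]\<^bsub>G\<^esub> m) ` carrier G" "c \<in> (\<lambda>z. z [^]\<^bsub>G\<^esub> m) ` carrier G" for a c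
      using that by (auto simp: nat_pow_distrib[symmetric])
    ultimately show ?thesis using True by (intro subgroupI) (auto simp: Hsub_def)
  next
    case False
    then show ?thesis
      by (intro subgroupI) (auto simp: Hsub_def nat_pow_inv nat_pow_distrib intro: exI[of _ "\<one>\<^bsub>G\<^esub>"])
  qed
qed

definition fresh :: "gterm \<Rightarrow> nat" where
  "fresh t = Suc (Max (insert 0 (tvars t)))"

lemma fresh: "fresh t \<notin> tvars t"
proof
  assume "fresh t \<in> tvars t"
  then have "fresh t \<le> Max (insert 0 (tvars t))" by (intro Max_ge) auto
  then show False by (simp add: fresh_def)
qed

definition afm :: "nat \<Rightarrow> atom \<Rightarrow> gform" where
  "afm p \<alpha> = (case \<alpha> of (b, k, t) \<Rightarrow>
     if b then Exi (fresh t) (Eq t (tpow (Var (fresh t)) (p ^ k))) else Eq (tpow t (p ^ k)) Unit)"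

lemma fvars_afm: "fvars (afm p (b, k, t)) \<subseteq> tvars t"
  using tvars_tpow[of t] tvars_tpow[of "Var (fresh t)"] by (auto simp: afm_def)

lemma sat_afm:
  assumes "tval G e t \<in> carrier G"
  shows "sat G e (afm p (b, k, t)) \<longleftrightarrow> tval G e t \<in> Hsub G (p ^ k) b"
proof -
  have "tval G (e(fresh t := a)) t = tval G e t" for a
    using fresh[of t] by (intro tval_cong) auto
  then show ?thesis using assms by (auto simp: afm_def Hsub_def tval_tpow)
qed

context zpn
begin

lemma sat_afm_Gn:
  assumes "env n e" "k \<le> n"
  shows "sat (Gn n) e (afm p (b, k, t)) \<longleftrightarrow> atm n e (b, k, t)"
proof -
  interpret homog "Gn n" p n by (rule homog)
  have pk: "int p ^ k = int (p ^ k)" by simp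
  have "torn (Gn n) p (lev n b k) = Hsub (Gn n) (p ^ k) b"
  proof (cases b)
    case True
    have "tor (n - k) = (\<lambda>z. z [^]\<^bsub>Gn n\<^esub> (p ^ k)) ` carrier (Gn n)"
    proof (intro equalityI subsetI)
      fix x assume "x \<in> tor (n - k)"
      then have "\<exists>y\<in>carrier (Gn n). x = y [^]\<^bsub>Gn n\<^esub> (int p ^ k)"
        using root[of x "n - k"] assms(2) by simp
      then show "x \<in> (\<lambda>z. z [^]\<^bsub>Gn n\<^esub> (p ^ k)) ` carrier (Gn n)"
        unfolding pk int_pow_int by blast
    next
      fix x assume "x \<in> (\<lambda>z. z [^]\<^bsub>Gn n\<^esub> (p ^ k)) ` carrier (Gn n)"
      then obtain z where z: "z \<in> carrier (Gn n)" "x = z [^]\<^bsub>Gn n\<^esub> (int p ^ k)"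
        unfolding pk int_pow_int by blast
      have "multiplicity (int p) (int p ^ k) = k"
        using prime_int_p by (intro multiplicity_same_power) auto
      then show "x \<in> tor (n - k)" using pow_in_tor[of "int p ^ k" z] z p_pos by simp
    qed
    then show ?thesis using True by (simp add: lev_def Hsub_def)
  next
    case False
    then have "lev n b k = k" by (simp add: lev_def)
    then show ?thesis using False unfolding torn_def Hsub_def by (simp only: pk int_pow_int if_False)
  qed
  then show ?thesis using tval_env[OF assms(1), of t] by (simp add: sat_afm atm_def)
qed

text \<open>Branch on one atom and continue with the correspondingly restricted predicate on
  patterns. The last conclusion concerns other groups, where levels of atoms make no sense but their
  formulas \<open>afm\<close> do; stability uses it.\<close>

lemma pattern_form:
  assumes "finite S"
  shows "\<exists>\<chi>. fvars \<chi> \<subseteq> avars S \<and>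
    (\<forall>n e. env n e \<longrightarrow> (\<forall>(b, k, t)\<in>S. k \<le> n) \<longrightarrow> (sat (Gn n) e \<chi> \<longleftrightarrow> Q {\<alpha>\<in>S. atm n e \<alpha>})) \<and>
    (\<forall>(N :: 'u monoid) e e'. (\<forall>\<alpha>\<in>S. sat N e (afm p \<alpha>) \<longleftrightarrow> sat N e' (afm p \<alpha>)) \<longrightarrow>
      (sat N e \<chi> \<longleftrightarrow> sat N e' \<chi>))"
  using assms
proof (induction S arbitrary: Q rule: finite_induct)
  case empty
  show ?case
    by (rule exI[of _ "if Q {} then Eq Unit Unit else Neg (Eq Unit Unit)"]) auto
next
  case (insert \<alpha> S)
  obtain b k t where \<alpha>: "\<alpha> = (b, k, t)" by (cases \<alpha>) auto
  obtain \<chi>1 where \<chi>1: "fvars \<chi>1 \<subseteq> avars S"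
    "\<And>n e. env n e \<Longrightarrow> (\<forall>(b, k, t)\<in>S. k \<le> n) \<Longrightarrow>
      (sat (Gn n) e \<chi>1 \<longleftrightarrow> Q (insert \<alpha> {\<beta>\<in>S. atm n e \<beta>}))"
    "\<And>(N :: 'u monoid) e e'. (\<forall>\<alpha>\<in>S. sat N e (afm p \<alpha>) \<longleftrightarrow> sat N e' (afm p \<alpha>)) \<Longrightarrow>
      (sat N e \<chi>1 \<longleftrightarrow> sat N e' \<chi>1)"
    using insert.IH[of "\<lambda>T. Q (insert \<alpha> T)"] by blast
  obtain \<chi>2 where \<chi>2: "fvars \<chi>2 \<subseteq> avars S"
    "\<And>n e. env n e \<Longrightarrow> (\<forall>(b, k, t)\<in>S. k \<le> n) \<Longrightarrow> (sat (Gn n) e \<chi>2 \<longleftrightarrow> Q {\<beta>\<in>S. atm n e \<beta>})"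
    "\<And>(N :: 'u monoid) e e'. (\<forall>\<alpha>\<in>S. sat N e (afm p \<alpha>) \<longleftrightarrow> sat N e' (afm p \<alpha>)) \<Longrightarrow>
      (sat N e \<chi>2 \<longleftrightarrow> sat N e' \<chi>2)"
    using insert.IH[of Q] by blast
  define \<chi> where "\<chi> = Neg (Conj (Neg (Conj (afm p \<alpha>) \<chi>1)) (Neg (Conj (Neg (afm p \<alpha>)) \<chi>2)))"
  have sat\<chi>: "sat H e \<chi> \<longleftrightarrow> (if sat H e (afm p \<alpha>) then sat H e \<chi>1 else sat H e \<chi>2)"
    for H :: "'u monoid" and e by (auto simp: \<chi>_def)
  have sat\<chi>': "sat H e \<chi> \<longleftrightarrow> (if sat H e (afm p \<alpha>) then sat H e \<chi>1 else sat H e \<chi>2)"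
    for H :: "(nat \<Rightarrow> int) monoid" and e by (auto simp: \<chi>_def)
  have "fvars \<chi> \<subseteq> avars (insert \<alpha> S)"
    using \<chi>1(1) \<chi>2(1) fvars_afm[of p b k t] by (auto simp: \<chi>_def avars_def \<alpha>)
  moreover have "sat (Gn n) e \<chi> \<longleftrightarrow> Q {\<beta>\<in>insert \<alpha> S. atm n e \<beta>}"
    if "env n e" "\<forall>(b, k, t)\<in>insert \<alpha> S. k \<le> n" for n e
  proof -
    have 1: "sat (Gn n) e (afm p \<alpha>) \<longleftrightarrow> atm n e \<alpha>" using that by (simp add: \<alpha> sat_afm_Gn)
    have 2: "\<forall>(b, k, t)\<in>S. k \<le> n" using that by simp
    have 3: "{\<beta>\<in>insert \<alpha> S. atm n e \<beta>} =
      (if atm n e \<alpha> then insert \<alpha> {\<beta>\<in>S. atm n e \<beta>} else {\<beta>\<in>S. atm n e \<beta>})" by auto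
    show ?thesis unfolding sat\<chi>' 1 3 using \<chi>1(2)[OF that(1) 2] \<chi>2(2)[OF that(1) 2] by simp
  qed
  moreover have "sat N e \<chi> \<longleftrightarrow> sat N e' \<chi>"
    if "\<forall>\<beta>\<in>insert \<alpha> S. sat N e (afm p \<beta>) \<longleftrightarrow> sat N e' (afm p \<beta>)" for N :: "'u monoid" and e e'
    unfolding sat\<chi> using \<chi>1(3)[of N e e'] \<chi>2(3)[of N e e'] that by simp
  ultimately show ?case by blast
qed

text \<open>\<open>Q'\<close> accepts the patterns realized at some \<open>n \<ge> N\<close> where
  \<open>Q (F n e)\<close> holds; since the pattern determines \<open>F\<close>, every realization
  gives the same answer.\<close>

lemma definable:
  assumes "finite S" "det S N F"
  shows "\<exists>\<chi> N'. fvars \<chi> \<subseteq> avars S \<and>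
    (\<forall>n\<ge>N'. \<forall>e. env n e \<longrightarrow> (sat (Gn n) e \<chi> \<longleftrightarrow> Q (F n e))) \<and>
    (\<forall>(N :: 'u monoid) e e'. (\<forall>\<alpha>\<in>S. sat N e (afm p \<alpha>) \<longleftrightarrow> sat N e' (afm p \<alpha>)) \<longrightarrow>
      (sat N e \<chi> \<longleftrightarrow> sat N e' \<chi>))"
proof -
  define Q' where "Q' T \<longleftrightarrow> (\<exists>n\<ge>N. \<exists>e. env n e \<and> {\<alpha>\<in>S. atm n e \<alpha>} = T \<and> Q (F n e))" for T
  have Q': "Q' {\<alpha>\<in>S. atm n e \<alpha>} \<longleftrightarrow> Q (F n e)" if "n \<ge> N" "env n e" for n e
  proof
    assume "Q' {\<alpha>\<in>S. atm n e \<alpha>}"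
    then obtain n' e' where *: "n' \<ge> N" "env n' e'" "{\<alpha>\<in>S. atm n' e' \<alpha>} = {\<alpha>\<in>S. atm n e \<alpha>}" "Q (F n' e')"
      by (auto simp: Q'_def)
    have "agree S n' e' n e" using *(3) by blast
    then have "F n' e' = F n e" by (rule detD[OF assms(2) *(1) that(1) *(2) that(2)])
    then show "Q (F n e)" using * by simp
  qed (use that in \<open>auto simp: Q'_def\<close>)
  obtain \<chi> where \<chi>: "fvars \<chi> \<subseteq> avars S"
    "\<And>n e. env n e \<Longrightarrow> (\<forall>(b, k, t)\<in>S. k \<le> n) \<Longrightarrow> (sat (Gn n) e \<chi> \<longleftrightarrow> Q' {\<alpha>\<in>S. atm n e \<alpha>})"
    "\<And>(N :: 'u monoid) e e'. (\<forall>\<alpha>\<in>S. sat N e (afm p \<alpha>) \<longleftrightarrow> sat N e' (afm p \<alpha>)) \<Longrightarrow>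
      (sat N e \<chi> \<longleftrightarrow> sat N e' \<chi>)"
    using pattern_form[OF assms(1), of Q'] by blast
  \<comment> \<open>The formula \<open>afm\<close> of an atom with exponent k expresses it only for
    \<open>k \<le> n\<close>.\<close>
  define N' where "N' = Max (insert N ((\<lambda>\<alpha>. fst (snd \<alpha>)) ` S))"
  have N': "N \<le> N'" "\<alpha> \<in> S \<Longrightarrow> fst (snd \<alpha>) \<le> N'" for \<alpha>
    using assms(1) by (auto simp: N'_def)
  have "sat (Gn n) e \<chi> \<longleftrightarrow> Q (F n e)" if "n \<ge> N'" "env n e" for n e
  proof -
    have "\<forall>(b, k, t)\<in>S. k \<le> n" using N'(2) that(1) by fastforce
    then show ?thesis using \<chi>(2)[OF that(2)] Q'[of n e] that N'(1) by simp
  qed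
  then show ?thesis using \<chi>(1,3) by blast
qed

definition ov :: "nat \<Rightarrow> 'b list \<Rightarrow> (nat \<Rightarrow> 'b) \<Rightarrow> nat \<Rightarrow> 'b" where
  "ov r x e = (\<lambda>i. if i < r then x ! i else e i)"

lemma card_cnt: "card {x \<in> tuples r (carrier (Gn n)). P n (ov r x e)} = cnt r P n e"
proof (induction r arbitrary: e)
  case 0
  have "{x \<in> tuples 0 (carrier (Gn n)). P n (ov 0 x e)} = (if P n e then {[]} else {})"
    by (auto simp: tuples_def ov_def)
  then show ?case by simp
next
  case (Suc r)
  interpret homog "Gn n" p n by (rule homog)
  define B where "B a = {x \<in> tuples r (carrier (Gn n)). P n (ov r x (e(r := a)))}" for a
  have finB: "finite (B a)" for a
    using finite_lists_length_eq[OF finite_carrier, of r]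
    by (rule finite_subset[rotated]) (auto simp: B_def tuples_def)
  have ov: "ov (Suc r) (x @ [a]) e = ov r x (e(r := a))" if "length x = r" for x a
    using that by (auto simp: ov_def fun_eq_iff nth_append less_Suc_eq)
  have "{x \<in> tuples (Suc r) (carrier (Gn n)). P n (ov (Suc r) x e)} =
    (\<Union>a\<in>carrier (Gn n). (\<lambda>x. x @ [a]) ` B a)" (is "?L = ?R")
  proof (intro equalityI subsetI)
    fix x assume x: "x \<in> ?L"
    then obtain y a where ya: "x = y @ [a]" by (cases x rule: rev_cases) (auto simp: tuples_def)
    then have "length y = r" "a \<in> carrier (Gn n)" "set y \<subseteq> carrier (Gn n)" using x by (auto simp: tuples_def)
    then show "x \<in> ?R" using x ya ov by (auto simp: B_def tuples_def)
  next
    fix x assume "x \<in> ?R"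
    then show "x \<in> ?L" using ov by (auto simp: B_def tuples_def)
  qed
  also have "card \<dots> = (\<Sum>a\<in>carrier (Gn n). card ((\<lambda>x. x @ [a]) ` B a))"
    using finite_carrier finB by (intro card_UN_disjoint) auto
  also have "\<dots> = (\<Sum>a\<in>carrier (Gn n). card (B a))"
    by (intro sum.cong refl card_image) (auto simp: inj_on_def)
  also have "\<dots> = cnt (Suc r) P n e" unfolding B_def Suc.IH cnt.simps ..
  finally show ?case .
qed

end

text \<open>Each relation is a disjoint union of rectangles, by \<open>rect\<close>. Ramsey makes
  its truth value constant on increasing and on decreasing pairs of a subsequence; completing
  rectangles shows the two constants equal, so P could not tell the order.\<close>

lemma no_ladder:
  fixes rel :: "nat \<Rightarrow> nat \<Rightarrow> 'i \<Rightarrow> bool"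
  assumes fin: "finite S"
    and rect: "\<And>\<alpha> i j k l. \<alpha> \<in> S \<Longrightarrow> rel i j \<alpha> \<Longrightarrow> rel k j \<alpha> \<Longrightarrow> rel k l \<alpha> \<Longrightarrow> rel i l \<alpha>"
    and P: "\<And>i j k l. (\<forall>\<alpha>\<in>S. rel i j \<alpha> \<longleftrightarrow> rel k l \<alpha>) \<Longrightarrow> P i j \<longleftrightarrow> P k l"
    and ord: "\<And>i j::nat. P i j \<longleftrightarrow> i < j"
  shows False
proof -
  \<comment> \<open>Both orders are recorded, so that one colour fixes increasing and decreasing
    pairs.\<close>
  define T where "T i j = ({\<alpha>\<in>S. rel i j \<alpha>}, {\<alpha>\<in>S. rel j i \<alpha>})" for i j
  have "finite (Pow S \<times> Pow S)" using fin by simp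
  then obtain h :: "'i set \<times> 'i set \<Rightarrow> nat" and m where h: "h ` (Pow S \<times> Pow S) = {i. i < m}" "inj_on h (Pow S \<times> Pow S)"
    using finite_imp_inj_to_nat_seg by metis
  have TS: "T i j \<in> Pow S \<times> Pow S" for i j by (auto simp: T_def)
  \<comment> \<open>\<open>Min\<close> and \<open>Max\<close> recover the ordered pair from a
    two-element set.\<close>
  define col where "col X = h (T (Min X) (Max X))" for X :: "nat set"
  have "\<forall>x\<in>UNIV. \<forall>y\<in>UNIV. x \<noteq> y \<longrightarrow> col {x, y} < m" using h(1) TS by (auto simp: col_def)
  then obtain Y t where Y: "infinite Y" "\<forall>x\<in>Y. \<forall>y\<in>Y. x \<noteq> y \<longrightarrow> col {x, y} = t"
    using Ramsey2[of "UNIV :: nat set" col m] by blast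
  define y where "y = enumerate Y"
  have y: "y i \<in> Y" "i < j \<Longrightarrow> y i < y j" for i j
    using Y(1) by (auto simp: y_def enumerate_in_set enumerate_mono)
  have TT: "T (y i) (y j) = T (y 0) (y 1)" if "i < j" for i j
  proof -
    have *: "h (T (y i) (y j)) = t" if "i < j" for i j
    proof -
      have "y i < y j" using y(2)[OF that] .
      then have "col {y i, y j} = t" "Min {y i, y j} = y i" "Max {y i, y j} = y j"
        using Y(2) y(1) by (auto simp: min_def max_def)
      then show ?thesis by (simp add: col_def)
    qed
    show ?thesis using inj_onD[OF h(2) _ TS TS] *[OF that] *[of 0 1] by simp
  qed
  have up: "\<alpha> \<in> S \<Longrightarrow> rel (y i) (y j) \<alpha> \<longleftrightarrow> rel (y 0) (y 1) \<alpha>"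
    and down: "\<alpha> \<in> S \<Longrightarrow> rel (y j) (y i) \<alpha> \<longleftrightarrow> rel (y 1) (y 0) \<alpha>" if "i < j" for i j \<alpha>
    using TT[OF that] unfolding T_def by blast+
  have "P (y 0) (y 1)" "\<not> P (y 1) (y 0)" using ord y(2)[of 0 1] by auto
  then obtain \<alpha> where \<alpha>: "\<alpha> \<in> S" "rel (y 0) (y 1) \<alpha> \<noteq> rel (y 1) (y 0) \<alpha>" using P by blast
  show False
  proof (cases "rel (y 0) (y 1) \<alpha>")
    case True
    \<comment> \<open>The corners (2,3), (0,3), (0,1) are increasing pairs, and the fourth corner
      (2,1) is a decreasing one.\<close>
    then have "rel (y 2) (y 1) \<alpha>"
      using rect[OF \<alpha>(1), of "y 2" "y 3" "y 0" "y 1"] up[of 2 3 \<alpha>] up[of 0 3 \<alpha>] \<alpha>(1) by simp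
    then show False using down[of 1 2 \<alpha>] \<alpha> True by simp
  next
    case False
    then have "rel (y 1) (y 0) \<alpha>" using \<alpha> by simp
    then have "rel (y 1) (y 2) \<alpha>"
      using rect[OF \<alpha>(1), of "y 1" "y 0" "y 3" "y 2"] down[of 0 3 \<alpha>] down[of 2 3 \<alpha>] \<alpha>(1) by simp
    then show False using up[of 1 2 \<alpha>] \<alpha> False by simp
  qed
qed

locale zpnu = zpn p + ultra U "Zpn_pow p" for p :: nat and U :: "nat filter"
begin

lemma eventually_ge: "eventually (\<lambda>n. N \<le> n) U"
proof -
  have "eventually (\<lambda>n. \<forall>k\<in>{..<N}. n \<noteq> k) U"
    using ultrafilter
    by (intro eventually_ball_finite) (auto simp: nonprincipal_ultrafilter_def eventually_not)
  then show ?thesis by eventually_elim (auto simp: not_less[symmetric])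
qed

lemma Th_transfer_ge:
  assumes "\<And>n e. n \<ge> K \<Longrightarrow> env n e \<Longrightarrow> sat (Gn n) e \<theta>"
    and "is_model N (Th M)" "\<And>i. i \<in> fvars \<theta> \<Longrightarrow> e i \<in> carrier N"
  shows "sat N e \<theta>"
proof (rule Th_transfer[OF _ assms(2,3)])
  show "eventually (\<lambda>n. \<forall>e. (\<forall>i. e i \<in> carrier (Gn n)) \<longrightarrow> sat (Gn n) e \<theta>) U"
    using eventually_ge[of K] by eventually_elim (use assms(1) in \<open>auto simp: env_def\<close>)
qed

lemma model_comm:
  assumes "is_model N (Th M)"
  shows "comm_group N"
proof (rule group.group_comm_groupI)
  show "group N" using assms by (simp add: is_model_def)
  fix x y assume xy: "x \<in> carrier N" "y \<in> carrier N"
  have "sat N (\<lambda>i. if i = 0 then x else y) (Eq (Mul (Var 0) (Var 1)) (Mul (Var 1) (Var 0)))"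
  proof (rule Th_transfer_ge[OF _ assms])
    fix n e assume e: "env n e"
    interpret comm_group "Gn n" by (rule comm_group_Zpn)
    show "sat (Gn n) e (Eq (Mul (Var 0) (Var 1)) (Mul (Var 1) (Var 0)))"
      using e m_comm by (simp add: env_def)
  qed (use xy in auto)
  then show "x \<otimes>\<^bsub>N\<^esub> y = y \<otimes>\<^bsub>N\<^esub> x" by simp
qed

theorem stable: "stable_theory TYPE('u) (Th M)"
  unfolding stable_theory_def
proof (intro allI impI notI)
  fix N :: "'u monoid" and r s \<phi>
  assume *: "is_model N (Th M) \<and> form2 r s \<phi>" and "order_property N r s \<phi>"
  then obtain a b where ab: "\<And>i::nat. a i \<in> tuples r (carrier N)" "\<And>i::nat. b i \<in> tuples s (carrier N)"
    and ord: "\<And>i j. holds N \<phi> (a i) (b j) \<longleftrightarrow> i < j" by (auto simp: order_property_def)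
  have mod: "is_model N (Th M)" and fv: "fvars \<phi> \<subseteq> {..<r + s}" using * by (auto simp: form2_def)
  interpret N: comm_group N by (rule model_comm[OF mod])
  obtain S K where S: "finite S" "avars S \<subseteq> fvars \<phi>" "det S K (\<lambda>n e. sat (Gn n) e \<phi>)"
    using sat_det by blast
  obtain \<chi> K' where \<chi>: "fvars \<chi> \<subseteq> avars S"
    "\<And>n e. n \<ge> K' \<Longrightarrow> env n e \<Longrightarrow> (sat (Gn n) e \<chi> \<longleftrightarrow> sat (Gn n) e \<phi>)"
    "\<And>(N :: 'u monoid) e e'. (\<forall>\<alpha>\<in>S. sat N e (afm p \<alpha>) \<longleftrightarrow> sat N e' (afm p \<alpha>)) \<Longrightarrow>
      (sat N e \<chi> \<longleftrightarrow> sat N e' \<chi>)"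
    using definable[OF S(1,3), of "\<lambda>x. x", where 'u = 'u] by blast
  have iff: "sat N e \<chi> \<longleftrightarrow> sat N e \<phi>" if "\<And>i. i \<in> fvars \<phi> \<Longrightarrow> e i \<in> carrier N" for e
  proof -
    \<comment> \<open>The equivalence of \<chi> and \<phi> in the primitive connectives; it holds in
      all \<open>Gn n\<close> with \<open>n \<ge> K'\<close> and is transferred to
      \<open>N\<close>.\<close>
    have "sat N e (Conj (Neg (Conj \<chi> (Neg \<phi>))) (Neg (Conj \<phi> (Neg \<chi>))))"
      by (rule Th_transfer_ge[OF _ mod, of K']) (use \<chi> S(2) that in auto)
    then show ?thesis by auto
  qed
  define E where "E i j = (\<lambda>k. (a i @ b j) ! k)" for i j
  have len: "length (a i) = r" "length (b j) = s" "set (a i) \<subseteq> carrier N" "set (b j) \<subseteq> carrier N" for i j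
    using ab by (auto simp: tuples_def)
  have Ecl: "E i j k \<in> carrier N" if "k < r + s" for i j k
  proof -
    have "E i j k \<in> set (a i @ b j)" unfolding E_def using that len by (intro nth_mem) simp
    then show ?thesis using len(3)[of i] len(4)[of j] by auto
  qed
  define rel where "rel i j \<alpha> \<longleftrightarrow> sat N (E i j) (afm p \<alpha>)" for i j \<alpha>
  show False
  proof (rule no_ladder[OF S(1), of rel "\<lambda>i j. holds N \<phi> (a i) (b j)"])
    show "holds N \<phi> (a i) (b j) \<longleftrightarrow> holds N \<phi> (a k) (b l)"
      if "\<forall>\<alpha>\<in>S. rel i j \<alpha> \<longleftrightarrow> rel k l \<alpha>" for i j k l
    proof -
      have "sat N (E i j) \<chi> \<longleftrightarrow> sat N (E k l) \<chi>" using \<chi>(3) that by (simp add: rel_def)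
      moreover have "sat N (E i j) \<chi> \<longleftrightarrow> sat N (E i j) \<phi>" "sat N (E k l) \<chi> \<longleftrightarrow> sat N (E k l) \<phi>"
        using fv Ecl by (auto intro!: iff)
      ultimately show ?thesis by (simp add: holds_def E_def)
    qed
    show "rel i l \<alpha>" if \<alpha>: "\<alpha> \<in> S" and rels: "rel i j \<alpha>" "rel k j \<alpha>" "rel k l \<alpha>" for \<alpha> i j k l
    proof -
      obtain c m t where \<alpha>_eq: "\<alpha> = (c, m, t)" by (cases \<alpha>) auto
      have tv: "tvars t \<subseteq> {..<r + s}" using \<alpha> S(2) fv by (fastforce simp: avars_def \<alpha>_eq)
      \<comment> \<open>By linearity the term is the product of a part depending on the tuple
        \<open>a i\<close> and a part depending on the tuple \<open>b j\<close>.\<close>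
      define f where "f i = tval N (\<lambda>k. if k < r then a i ! k else \<one>\<^bsub>N\<^esub>) t" for i
      define g where "g j = tval N (\<lambda>k. if k < r then \<one>\<^bsub>N\<^esub> else b j ! (k - r)) t" for j
      have acl: "k < r \<Longrightarrow> a i ! k \<in> carrier N" for i k
        using len(1,3)[of i] nth_mem[of k "a i"] by auto
      have bcl: "k < s \<Longrightarrow> b i ! k \<in> carrier N" for i k
        using len(2,4)[of i] nth_mem[of k "b i"] by auto
      have bcl': "k \<in> tvars t \<Longrightarrow> \<not> k < r \<Longrightarrow> b i ! (k - r) \<in> carrier N" for i k
        using tv by (intro bcl) auto
      have fg: "f i \<in> carrier N" "g i \<in> carrier N" for i
        unfolding f_def g_def using acl bcl' by (simp_all add: tval_closed[OF N.is_group])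
      have "tval N (E i j) t = f i \<otimes>\<^bsub>N\<^esub> g j" for i j
      proof -
        have "f i \<otimes>\<^bsub>N\<^esub> g j = tval N (\<lambda>k. (if k < r then a i ! k else \<one>\<^bsub>N\<^esub>) \<otimes>\<^bsub>N\<^esub>
            (if k < r then \<one>\<^bsub>N\<^esub> else b j ! (k - r))) t"
          unfolding f_def g_def using acl bcl' by (simp add: tval_mult[OF N.comm_group_axioms])
        also have "\<dots> = tval N (E i j) t"
          using acl bcl' len(1) by (intro tval_cong) (simp add: E_def nth_append)
        finally show ?thesis by simp
      qed
      then have rel: "rel i j \<alpha> \<longleftrightarrow> f i \<otimes>\<^bsub>N\<^esub> g j \<in> Hsub N (p ^ m) c" for i j
        unfolding rel_def \<alpha>_eq using fg by (simp add: sat_afm)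
      interpret H: subgroup "Hsub N (p ^ m) c" N by (rule subgroup_Hsub[OF N.comm_group_axioms])
      \<comment> \<open>Three corners of a rectangle in the subgroup give the fourth.\<close>
      have "(f i \<otimes>\<^bsub>N\<^esub> g j) \<otimes>\<^bsub>N\<^esub> inv\<^bsub>N\<^esub> (f k \<otimes>\<^bsub>N\<^esub> g j) \<otimes>\<^bsub>N\<^esub> (f k \<otimes>\<^bsub>N\<^esub> g l) \<in> Hsub N (p ^ m) c"
        using rels rel by simp
      also have "(f i \<otimes>\<^bsub>N\<^esub> g j) \<otimes>\<^bsub>N\<^esub> inv\<^bsub>N\<^esub> (f k \<otimes>\<^bsub>N\<^esub> g j) \<otimes>\<^bsub>N\<^esub> (f k \<otimes>\<^bsub>N\<^esub> g l) = f i \<otimes>\<^bsub>N\<^esub> g l"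
      proof -
        have "inv\<^bsub>N\<^esub> (f k \<otimes>\<^bsub>N\<^esub> g j) = inv\<^bsub>N\<^esub> (g j) \<otimes>\<^bsub>N\<^esub> inv\<^bsub>N\<^esub> (f k)"
          using fg by (simp add: N.inv_mult_group)
        then have "(f i \<otimes>\<^bsub>N\<^esub> g j) \<otimes>\<^bsub>N\<^esub> inv\<^bsub>N\<^esub> (f k \<otimes>\<^bsub>N\<^esub> g j) = f i \<otimes>\<^bsub>N\<^esub> inv\<^bsub>N\<^esub> (f k)"
          using fg by (simp add: N.m_assoc) (simp add: N.m_assoc[symmetric])
        then show ?thesis using fg by (simp add: N.m_assoc) (simp add: N.m_assoc[symmetric])
      qed
      finally show ?thesis by (simp add: rel)
    qed
    show "holds N \<phi> (a i) (b j) \<longleftrightarrow> i < j" for i j by (rule ord)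
  qed
qed

end

subsection \<open>Dimensions\<close>

abbreviation real_add :: "real monoid" where
  "real_add \<equiv> \<lparr>carrier = UNIV, monoid.mult = (+), one = 0\<rparr>"

lemma group_real_add: "group real_add"
  by (rule groupI) (auto simp: algebra_simps intro: exI[of _ "- x" for x])

text \<open>The additive group of the hyperreals is itself an ultraproduct of groups, so the facts
  on classes, representatives and products are inherited.\<close>

sublocale zpnu \<subseteq> R: ultra U "\<lambda>_. real_add"
  by (intro ultra.intro ultrafilter group_real_add)

context zpnu
begin

section \<open>Hyperreals modulo the finite ones\<close>

lemma R_fam: "f \<in> R.fam"
  by (simp add: R.fam_iff)

lemma R_M: "R.M = hyperreal U"
  by (simp add: hyperreal_def)

lemma urep_hclass: "eventually (\<lambda>n. urep (hclass U f) n = f n) U"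
  using R.urep_cls[OF R_fam] by (simp add: hclass_def)

lemma hclass_eq_iff: "hclass U f = hclass U g \<longleftrightarrow> eventually (\<lambda>n. f n = g n) U"
  using R.cls_eq_iff[OF R_fam R_fam] by (simp add: hclass_def)

lemma carrier_hyperreal: "carrier (hyperreal U) = range (hclass U)"
  using R.carrier_M R_fam by (auto simp: hclass_def[abs_def] R_M)

lemma mult_hyperreal: "hclass U f \<otimes>\<^bsub>hyperreal U\<^esub> hclass U g = hclass U (\<lambda>n. f n + g n)"
  using R.mult_cls[OF R_fam R_fam] by (simp add: hclass_def R_M)

lemma hle_hclass: "hle U (hclass U f) (hclass U g) \<longleftrightarrow> eventually (\<lambda>n. f n \<le> g n) U"
proof -
  note u = urep_hclass[of f] urep_hclass[of g]
  show ?thesis unfolding hle_def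
  proof
    assume "eventually (\<lambda>n. urep (hclass U f) n \<le> urep (hclass U g) n) U"
    then show "eventually (\<lambda>n. f n \<le> g n) U" using u by eventually_elim simp
  next
    assume "eventually (\<lambda>n. f n \<le> g n) U"
    then show "eventually (\<lambda>n. urep (hclass U f) n \<le> urep (hclass U g) n) U" using u by eventually_elim simp
  qed
qed

text \<open>The hull consists of the finite hyperreals; rounding passes between integer and real
  bounds.\<close>

lemma hclass_in_hull: "hclass U f \<in> convex_hull_ints U \<longleftrightarrow> (\<exists>K. eventually (\<lambda>n. \<bar>f n\<bar> \<le> K) U)"
proof
  assume "hclass U f \<in> convex_hull_ints U"
  then obtain k m :: int where "eventually (\<lambda>n. of_int k \<le> f n) U" "eventually (\<lambda>n. f n \<le> of_int m) U"
    by (auto simp: convex_hull_ints_def hle_hclass)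
  then have "eventually (\<lambda>n. \<bar>f n\<bar> \<le> max (- of_int k) (of_int m)) U" by eventually_elim auto
  then show "\<exists>K. eventually (\<lambda>n. \<bar>f n\<bar> \<le> K) U" by blast
next
  assume "\<exists>K. eventually (\<lambda>n. \<bar>f n\<bar> \<le> K) U"
  then obtain K where K: "eventually (\<lambda>n. \<bar>f n\<bar> \<le> K) U" by blast
  have c: "K \<le> of_int \<lceil>K\<rceil>" by (rule le_of_int_ceiling)
  from K have "eventually (\<lambda>n. of_int (- \<lceil>K\<rceil>) \<le> f n) U" 
    by eventually_elim (simp only: of_int_minus, use c in linarith)
  moreover from K have "eventually (\<lambda>n. f n \<le> of_int \<lceil>K\<rceil>) U"
    by eventually_elim (use c in linarith)
  ultimately show "hclass U f \<in> convex_hull_ints U"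
    unfolding convex_hull_ints_def by (auto simp: hle_hclass carrier_hyperreal simp del: of_int_minus)
qed

definition coset :: "(nat \<Rightarrow> real) \<Rightarrow> nat hyper set" where
  "coset f = convex_hull_ints U #>\<^bsub>hyperreal U\<^esub> hclass U f"

lemma coset_eq: "coset f = {hclass U g | g. \<exists>K. eventually (\<lambda>n. \<bar>g n - f n\<bar> \<le> K) U}"
proof (intro equalityI subsetI)
  fix \<alpha> assume "\<alpha> \<in> coset f"
  then obtain \<gamma> where \<gamma>: "\<gamma> \<in> convex_hull_ints U" "\<alpha> = \<gamma> \<otimes>\<^bsub>hyperreal U\<^esub> hclass U f"
    by (auto simp: coset_def r_coset_def)
  moreover obtain h where h: "\<gamma> = hclass U h" using \<gamma>(1) by (auto simp: convex_hull_ints_def carrier_hyperreal)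
  ultimately have "\<alpha> = hclass U (\<lambda>n. h n + f n)" "\<exists>K. eventually (\<lambda>n. \<bar>h n\<bar> \<le> K) U"
    by (auto simp: mult_hyperreal hclass_in_hull)
  then show "\<alpha> \<in> {hclass U g | g. \<exists>K. eventually (\<lambda>n. \<bar>g n - f n\<bar> \<le> K) U}"
    by (intro CollectI exI[of _ "\<lambda>n. h n + f n"]) auto
next
  fix \<alpha> assume "\<alpha> \<in> {hclass U g | g. \<exists>K. eventually (\<lambda>n. \<bar>g n - f n\<bar> \<le> K) U}"
  then obtain g where g: "\<alpha> = hclass U g" "\<exists>K. eventually (\<lambda>n. \<bar>g n - f n\<bar> \<le> K) U" by blast
  then have "hclass U (\<lambda>n. g n - f n) \<in> convex_hull_ints U" by (simp add: hclass_in_hull)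
  moreover have "\<alpha> = hclass U (\<lambda>n. g n - f n) \<otimes>\<^bsub>hyperreal U\<^esub> hclass U f"
    by (simp add: mult_hyperreal g)
  ultimately show "\<alpha> \<in> coset f" by (auto simp: coset_def r_coset_def)
qed

lemma coset_cong:
  assumes "eventually (\<lambda>n. \<bar>f n - g n\<bar> \<le> K) U"
  shows "coset f = coset g"
proof -
  have sub: "coset f \<subseteq> coset g" if fg: "eventually (\<lambda>n. \<bar>f n - g n\<bar> \<le> K) U" for f g
  proof
    fix \<alpha> assume "\<alpha> \<in> coset f"
    then obtain h L where h: "\<alpha> = hclass U h" "eventually (\<lambda>n. \<bar>h n - f n\<bar> \<le> L) U"
      by (auto simp: coset_eq)
    have "eventually (\<lambda>n. \<bar>h n - g n\<bar> \<le> L + K) U" using h(2) fg by eventually_elim auto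
    then show "\<alpha> \<in> coset g" using h(1) by (auto simp: coset_eq)
  qed
  have "eventually (\<lambda>n. \<bar>g n - f n\<bar> \<le> K) U" using assms by (simp add: abs_minus_commute)
  then show ?thesis using sub assms by blast
qed

lemma dims_eq: "dims U = insert None (range (Some \<circ> coset))"
proof -
  have "carrier (hyperreal U Mod convex_hull_ints U) = range coset"
    by (auto simp: FactGroup_def RCOSETS_def carrier_hyperreal coset_def)
  then show ?thesis by (simp add: dims_def image_comp)
qed

text \<open>Representatives of a coset differ by bounded functions, which accounts for the additive
  constant.\<close>

lemma dim_le_coset: "dim_le U (Some (coset f)) (Some (coset g)) \<longleftrightarrow>
  (\<exists>K. eventually (\<lambda>n. f n \<le> g n + K) U)"
proof
  assume "dim_le U (Some (coset f)) (Some (coset g))"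
  then obtain \<alpha> \<beta> where "\<alpha> \<in> coset f" "\<beta> \<in> coset g" "hle U \<alpha> \<beta>" by (auto simp: dim_le_def)
  moreover from this obtain f' g' where "\<alpha> = hclass U f'" "\<beta> = hclass U g'" by (auto simp: coset_eq)
  ultimately obtain K L where "eventually (\<lambda>n. f' n \<le> g' n) U"
    "eventually (\<lambda>n. \<bar>f' n - f n\<bar> \<le> K) U" "eventually (\<lambda>n. \<bar>g' n - g n\<bar> \<le> L) U"
  proof -
    assume *: "\<alpha> \<in> coset f" "\<beta> \<in> coset g" "hle U \<alpha> \<beta>" "\<alpha> = hclass U f'" "\<beta> = hclass U g'"
      and that: "\<And>K L. eventually (\<lambda>n. f' n \<le> g' n) U \<Longrightarrow>
        eventually (\<lambda>n. \<bar>f' n - f n\<bar> \<le> K) U \<Longrightarrow> eventually (\<lambda>n. \<bar>g' n - g n\<bar> \<le> L) U \<Longrightarrow> thesis"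
    have mem: "\<exists>K. eventually (\<lambda>n. \<bar>h' n - h n\<bar> \<le> K) U" if "hclass U h' \<in> coset h" for h h'
    proof -
      from that have "\<exists>k. hclass U h' = hclass U k \<and> (\<exists>K. eventually (\<lambda>n. \<bar>k n - h n\<bar> \<le> K) U)"
        unfolding coset_eq by simp
      then obtain k K where "eventually (\<lambda>n. h' n = k n) U" "eventually (\<lambda>n. \<bar>k n - h n\<bar> \<le> K) U"
        by (auto simp: hclass_eq_iff)
      then have "eventually (\<lambda>n. \<bar>h' n - h n\<bar> \<le> K) U" by eventually_elim simp
      then show ?thesis by blast
    qed
    show thesis using * mem[of f' f] mem[of g' g] that by (auto simp: hle_hclass)
  qed
  then have "eventually (\<lambda>n. f n \<le> g n + (K + L)) U" by eventually_elim auto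
  then show "\<exists>K. eventually (\<lambda>n. f n \<le> g n + K) U" by blast
next
  assume "\<exists>K. eventually (\<lambda>n. f n \<le> g n + K) U"
  then obtain K where K: "eventually (\<lambda>n. f n \<le> g n + K) U" by blast
  have "hclass U f \<in> coset f"
    unfolding coset_eq by (intro CollectI exI[of _ f] conjI exI[of _ 0]) auto
  moreover have "hclass U (\<lambda>n. g n + K) \<in> coset g"
    unfolding coset_eq by (intro CollectI exI[of _ "\<lambda>n. g n + K"] conjI exI[of _ "\<bar>K\<bar>"]) auto
  moreover have "hle U (hclass U f) (hclass U (\<lambda>n. g n + K))" using K by (simp add: hle_hclass)
  ultimately show "dim_le U (Some (coset f)) (Some (coset g))" by (auto simp: dim_le_def)
qed

lemma dim_le_None: "dim_le U None w" "dim_le U (Some P) None \<longleftrightarrow> False"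
  by (auto simp: dim_le_def)

lemma dim_le_trans:
  assumes "u \<in> dims U" "v \<in> dims U" "w \<in> dims U" "dim_le U u v" "dim_le U v w"
  shows "dim_le U u w"
proof (cases "u = None \<or> v = None \<or> w = None")
  case True
  then show ?thesis using assms(4,5) by (cases u; cases v; cases w) (auto simp: dim_le_None)
next
  case False
  then obtain f g h where fgh: "u = Some (coset f)" "v = Some (coset g)" "w = Some (coset h)"
    using assms(1-3) by (auto simp: dims_eq)
  then obtain K L where "eventually (\<lambda>n. f n \<le> g n + K) U" "eventually (\<lambda>n. g n \<le> h n + L) U"
    using assms(4,5) by (auto simp: dim_le_coset)
  then have "eventually (\<lambda>n. f n \<le> h n + (L + K)) U" by eventually_elim auto
  then show ?thesis using fgh by (auto simp: dim_le_coset)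
qed

section \<open>Dimensions of definable sets\<close>

abbreviation dcard :: "nat \<Rightarrow> gform \<Rightarrow> (nat \<Rightarrow> nat \<Rightarrow> int) set list \<Rightarrow> nat \<Rightarrow> nat" where
  "dcard r \<phi> b n \<equiv> card (defset (Gn n) r \<phi> (comp b n))"

lemma delta_eq: "delta U Gn r \<phi> b =
  (if eventually (\<lambda>n. dcard r \<phi> b n = 0) U then None else Some (coset (\<lambda>n. ln (real (dcard r \<phi> b n)))))"
proof -
  have "eventually (\<lambda>n. ln (urep (ucard U Gn r \<phi> b) n) = ln (real (dcard r \<phi> b n))) U"
    using urep_hclass[of "\<lambda>n. real (dcard r \<phi> b n)"] by eventually_elim (simp add: ucard_def)
  then have "hlog U (ucard U Gn r \<phi> b) = hclass U (\<lambda>n. ln (real (dcard r \<phi> b n)))"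
    by (simp add: hlog_def hclass_eq_iff)
  moreover have "ucard U Gn r \<phi> b = hclass U (\<lambda>_. 0) \<longleftrightarrow> eventually (\<lambda>n. dcard r \<phi> b n = 0) U"
    by (simp add: ucard_def hclass_eq_iff)
  ultimately show ?thesis by (simp add: delta_def coset_def)
qed

lemma delta_dims: "delta U Gn r \<phi> b \<in> dims U"
  by (simp add: delta_eq dims_eq)

lemma finite_defset: "finite (defset (Gn n) r \<phi> b)"
proof -
  interpret homog "Gn n" p n by (rule homog)
  show ?thesis
    using finite_lists_length_eq[OF finite_carrier, of r]
    by (rule finite_subset[rotated]) (auto simp: defset_def tuples_def)
qed

lemma delta_mono:
  assumes "eventually (\<lambda>n. defset (Gn n) r \<phi> (comp b n) \<subseteq> defset (Gn n) r \<psi> (comp c n)) U"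
  shows "dim_le U (delta U Gn r \<phi> b) (delta U Gn r \<psi> c)"
proof -
  have le: "eventually (\<lambda>n. dcard r \<phi> b n \<le> dcard r \<psi> c n) U"
    using assms by eventually_elim (intro card_mono finite_defset)
  show ?thesis
  proof (cases "eventually (\<lambda>n. dcard r \<phi> b n = 0) U")
    case True
    then show ?thesis by (simp add: delta_eq dim_le_None)
  next
    case False
    then have pos: "eventually (\<lambda>n. dcard r \<phi> b n \<noteq> 0) U" by (simp only: eventually_not simp_thms)
    have "eventually (\<lambda>n. dcard r \<psi> c n \<noteq> 0) U" using le pos by eventually_elim simp
    then have "\<not> eventually (\<lambda>n. dcard r \<psi> c n = 0) U" by (simp only: eventually_not simp_thms)
    moreover have "eventually (\<lambda>n. ln (real (dcard r \<phi> b n)) \<le> ln (real (dcard r \<psi> c n)) + 0) U"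
      using le pos by eventually_elim simp
    ultimately show ?thesis using False by (simp only: delta_eq if_False dim_le_coset) blast
  qed
qed

text \<open>The infimum is attained by the set itself: a definable superset in \<open>M\<close> is a
  superset in almost all factors, hence not of smaller dimension.\<close>

lemma delta_cut_defset:
  assumes "form2 r s \<phi>" "b \<in> tuples s (carrier M)"
  shows "delta_cut U Gn r (defset M r \<phi> b) = {w \<in> dims U. dim_le U (delta U Gn r \<phi> b) w}"
proof (intro equalityI subsetI)
  fix w assume "w \<in> delta_cut U Gn r (defset M r \<phi> b)"
  then obtain t \<psi> c where w: "w \<in> dims U" "form2 r t \<psi>" "c \<in> tuples t (carrier M)"
    "defset M r \<phi> b \<subseteq> defset M r \<psi> c" "dim_le U (delta U Gn r \<psi> c) w"
    by (auto simp: delta_cut_def)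
  have "dim_le U (delta U Gn r \<phi> b) (delta U Gn r \<psi> c)"
    by (rule delta_mono[OF defset_subset[OF assms w(2-4)]])
  then show "w \<in> {w \<in> dims U. dim_le U (delta U Gn r \<phi> b) w}"
    using dim_le_trans[OF delta_dims delta_dims w(1)] w(1,5) by blast
next
  fix w assume "w \<in> {w \<in> dims U. dim_le U (delta U Gn r \<phi> b) w}"
  then show "w \<in> delta_cut U Gn r (defset M r \<phi> b)"
    using assms unfolding delta_cut_def by blast
qed

text \<open>The function is the logarithm of \<open>(real p ^ n) powi hv n q\<close>.\<close>

definition dval :: "(nat \<times> int) option \<Rightarrow> nat dim" where
  "dval d = map_option (\<lambda>q. coset (\<lambda>n. ln (real p) * real n * real_of_int (hv n q))) d"

lemma eventually_sequentially_U: "eventually P sequentially \<Longrightarrow> eventually P U"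
  unfolding eventually_sequentially using eventually_ge by (metis (mono_tags, lifting) eventually_mono)

text \<open>Distinct levels eventually differ by at least 1 in \<open>hv n\<close>, hence their
  logarithms by at least \<open>ln (real p) * real n\<close>, which is unbounded.\<close>

lemma dim_le_dval: "dim_le U (dval d) (dval d') \<longleftrightarrow> d \<le> d'"
proof (cases "d = None \<or> d' = None")
  case True
  then show ?thesis by (cases d; cases d') (auto simp: dval_def dim_le_None)
next
  case False
  then obtain q q' where q: "d = Some q" "d' = Some q'" by auto
  have lnp: "ln (real p) > 0" using p_gt_1 by simp
  have lex: "eventually (\<lambda>n. hv n q \<le> hv n q' \<longleftrightarrow> q \<le> q') U"
    by (rule eventually_sequentially_U[OF eventually_lex])
  show ?thesis
  proof (cases "q \<le> q'")
    case True
    have "eventually (\<lambda>n. ln (real p) * real n * real_of_int (hv n q) \<le>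
        ln (real p) * real n * real_of_int (hv n q') + 0) U"
      using lex by eventually_elim (use True lnp in \<open>simp add: mult_left_mono\<close>)
    then have "dim_le U (dval d) (dval d')" unfolding q dval_def by (auto simp: dim_le_coset simp del: add_0_right)
    then show ?thesis using True q by simp
  next
    case F: False
    have "\<not> dim_le U (dval d) (dval d')"
    proof
      assume "dim_le U (dval d) (dval d')"
      then obtain K where K: "eventually (\<lambda>n. ln (real p) * real n * real_of_int (hv n q) \<le>
          ln (real p) * real n * real_of_int (hv n q') + K) U"
        unfolding q dval_def by (auto simp: dim_le_coset)
      obtain N where N: "K / ln (real p) < real N" using reals_Archimedean2 by blast
      have "eventually (\<lambda>n. False) U"
        using K lex eventually_ge[of N]
      proof eventually_elim
        case (elim n)
        then have "hv n q' + 1 \<le> hv n q" using F by simp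
        then have "real_of_int (hv n q') + 1 \<le> real_of_int (hv n q)" by linarith
        then have "ln (real p) * real n * (real_of_int (hv n q') + 1) \<le> ln (real p) * real n * real_of_int (hv n q)"
          using lnp by (intro mult_left_mono) auto
        then have "ln (real p) * real n \<le> K" using elim(1) by (simp add: algebra_simps)
        then have "real n \<le> K / ln (real p)" using lnp by (simp add: field_simps)
        then show False using N elim(3) by simp
      qed
      then show False using U_not_bot by (simp add: trivial_limit_def)
    qed
    then show ?thesis using F q by simp
  qed
qed

text \<open>The factor \<open>K\<close> changes the logarithm by at most \<open>ln K\<close>, which
  the convex hull absorbs.\<close>

lemma delta_bnd:
  assumes K: "K \<ge> 1" and ev: "eventually (\<lambda>n. bnd K n d (real (dcard r \<phi> b n))) U"
  shows "delta U Gn r \<phi> b = dval d"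
proof (cases d)
  case None
  from ev have "eventually (\<lambda>n. dcard r \<phi> b n = 0) U" by eventually_elim (simp add: None bnd_def)
  then show ?thesis by (simp add: delta_eq None dval_def)
next
  case (Some q)
  define X where "X n = (real p ^ n) powi hv n q" for n
  have X: "X n > 0" "ln (X n) = ln (real p) * real n * real_of_int (hv n q)" for n
  proof -
    have "X n = (real p ^ n) powr real_of_int (hv n q)"
      using p_pos by (simp add: X_def powr_real_of_int')
    then show "ln (X n) = ln (real p) * real n * real_of_int (hv n q)"
      using p_pos by (simp add: ln_powr ln_realpow)
  qed (use p_pos in \<open>simp add: X_def\<close>)
  from ev have both: "eventually (\<lambda>n. dcard r \<phi> b n \<noteq> 0 \<and>
      \<bar>ln (real (dcard r \<phi> b n)) - ln (real p) * real n * real_of_int (hv n q)\<bar> \<le> ln K) U"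
  proof eventually_elim
    case (elim n)
    have b: "X n / K \<le> real (dcard r \<phi> b n)" "real (dcard r \<phi> b n) \<le> K * X n"
      using elim by (auto simp: bnd_def Some X_def)
    have "0 < X n / K" using X(1)[of n] K by simp
    then have pos: "0 < real (dcard r \<phi> b n)" using b(1) by linarith
    have "ln (X n / K) \<le> ln (real (dcard r \<phi> b n))" using b(1) \<open>0 < X n / K\<close> pos by simp
    moreover have "ln (real (dcard r \<phi> b n)) \<le> ln (K * X n)" using b(2) pos by simp
    ultimately show ?case using X[of n] K pos by (simp add: ln_div ln_mult abs_le_iff)
  qed
  then have "eventually (\<lambda>n. dcard r \<phi> b n \<noteq> 0) U" by eventually_elim simp
  then have nz: "\<not> eventually (\<lambda>n. dcard r \<phi> b n = 0) U" by (simp only: eventually_not simp_thms)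
  from both have "eventually (\<lambda>n. \<bar>ln (real (dcard r \<phi> b n)) - ln (real p) * real n * real_of_int (hv n q)\<bar> \<le> ln K) U"
    by eventually_elim simp
  from coset_cong[OF this] show ?thesis using nz by (simp add: delta_eq Some dval_def)
qed

section \<open>Environments of parameters and (DC)\<close>

lemma eventually_eq_const:
  assumes "finite W" "eventually (\<lambda>n. f n \<in> W) U"
  shows "\<exists>d\<in>W. eventually (\<lambda>n. f n = d) U"
proof (rule ccontr)
  assume "\<not> ?thesis"
  then have "\<forall>d\<in>W. eventually (\<lambda>n. f n \<noteq> d) U" by (simp add: eventually_not)
  then have "eventually (\<lambda>n. \<forall>d\<in>W. f n \<noteq> d) U" using assms(1) by (intro eventually_ball_finite)
  with assms(2) have "eventually (\<lambda>n. False) U" by eventually_elim blast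
  then show False using U_not_bot by (simp add: trivial_limit_def)
qed

text \<open>Units fill the other positions because \<open>env\<close> asks for values everywhere;
  the first r positions are overwritten when tuples are counted.\<close>

definition benv :: "nat \<Rightarrow> nat \<Rightarrow> (nat \<Rightarrow> int) list \<Rightarrow> nat \<Rightarrow> nat \<Rightarrow> int" where
  "benv r n b = (\<lambda>i. if r \<le> i \<and> i < r + length b then b ! (i - r) else \<one>\<^bsub>Gn n\<^esub>)"

lemma one_carrier: "\<one>\<^bsub>Gn n\<^esub> \<in> carrier (Gn n)"
  by (simp add: group.is_monoid monoid.one_closed)

lemma env_benv: "b \<in> tuples s (carrier (Gn n)) \<Longrightarrow> env n (benv r n b)"
  unfolding env_def benv_def tuples_def using one_carrier[of n] by (auto simp: subset_iff)

lemma card_defset: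
  assumes "form2 r s \<phi>" "b \<in> tuples s (carrier (Gn n))"
  shows "card (defset (Gn n) r \<phi> b) = cnt r (\<lambda>n e. sat (Gn n) e \<phi>) n (benv r n b)"
proof -
  have "holds (Gn n) \<phi> x b \<longleftrightarrow> sat (Gn n) (ov r x (benv r n b)) \<phi>" if "x \<in> tuples r (carrier (Gn n))" for x
    unfolding holds_def using that assms
    by (intro sat_cong) (auto simp: ov_def benv_def nth_append tuples_def form2_def)
  then have "defset (Gn n) r \<phi> b = {x \<in> tuples r (carrier (Gn n)). sat (Gn n) (ov r x (benv r n b)) \<phi>}"
    unfolding defset_def by blast
  then show ?thesis using card_cnt[of r n "\<lambda>n e. sat (Gn n) e \<phi>"] by simp
qed

lemma cnt_cong:
  assumes "\<And>e. env n e \<Longrightarrow> P n e \<longleftrightarrow> P' n e" "env n e"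
  shows "cnt r P n e = cnt r P' n e"
  using assms(2) by (induction r arbitrary: e) (auto simp: assms(1) env_upd intro!: sum.cong)

definition aren :: "(nat \<Rightarrow> nat) \<Rightarrow> atom \<Rightarrow> atom" where
  "aren f \<alpha> = (case \<alpha> of (b, k, t) \<Rightarrow> (b, k, tren f t))"

lemma det_ren:
  assumes "det S N F"
  shows "det (aren f ` S) N (\<lambda>n e. F n (e \<circ> f))"
proof -
  have atm: "atm n e (aren f \<alpha>) \<longleftrightarrow> atm n (e \<circ> f) \<alpha>" for n e \<alpha>
    by (cases \<alpha>) (simp add: atm_def aren_def tval_tren)
  show ?thesis unfolding det_def
  proof (intro allI impI)
    fix n n' e e' assume *: "N \<le> n" "N \<le> n'" "env n e" "env n' e'" "agree (aren f ` S) n e n' e'"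
    have "env n (e \<circ> f)" "env n' (e' \<circ> f)" using *(3,4) by (auto simp: env_def)
    moreover have "agree S n (e \<circ> f) n' (e' \<circ> f)" using *(5) by (simp add: atm)
    ultimately show "F n (e \<circ> f) = F n' (e' \<circ> f)" by (rule detD[OF assms *(1,2)])
  qed
qed

lemma avars_ren: "avars (aren f ` S) = f ` avars S"
proof -
  have "tvars (snd (snd (aren f \<alpha>))) = f ` tvars (snd (snd \<alpha>))" for \<alpha>
    by (cases \<alpha>) (simp add: aren_def tvars_tren)
  then show ?thesis by (simp add: avars_def image_UN)
qed

lemma avars_Un: "avars (S \<union> T) = avars S \<union> avars T"
  by (simp add: avars_def)

lemma det_avars:
  assumes "det S N F" "n \<ge> N" "env n e" "env n e'" "\<And>i. i \<in> avars S \<Longrightarrow> e i = e' i"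
  shows "F n e = F n e'"
proof (rule detD[OF assms(1,2,2,3,4)])
  show "agree S n e n e'"
  proof
    fix \<alpha> assume "\<alpha> \<in> S"
    moreover obtain b k t where \<alpha>: "\<alpha> = (b, k, t)" by (cases \<alpha>) auto
    ultimately have "tval (Gn n) e t = tval (Gn n) e' t"
      using assms(5) by (intro tval_cong) (force simp: avars_def)
    then show "atm n e \<alpha> \<longleftrightarrow> atm n e' \<alpha>" by (simp add: atm_def \<alpha>)
  qed
qed

text \<open>A function with values in the finite set \<open>W\<close> is constant on a set of the
  ultrafilter, and the constant value is the dimension. Agreement of \<chi> with \<open>P\<close>
  from \<open>L\<close> on suffices, since final segments belong to the ultrafilter.\<close>

lemma counted_delta:
  assumes P: "counted W \<Sigma>' r r S P" and W: "finite W" and \<chi>: "form2 r s \<chi>"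
    and eq: "\<And>n e. n \<ge> L \<Longrightarrow> env n e \<Longrightarrow> (sat (Gn n) e \<chi> \<longleftrightarrow> P n e)"
  shows "\<exists>S' N F. finite S' \<and> avars S' \<subseteq> avars S - {..<r} \<and> det S' N F \<and> (\<forall>b\<in>tuples s (carrier M).
    \<exists>d\<in>W. eventually (\<lambda>n. F n (benv r n (comp b n)) = d) U \<and> delta U Gn r \<chi> b = dval d)"
proof -
  obtain S' N K F where F: "finite S'" "avars S' \<subseteq> avars S - {..<r}" "det S' N F" "K \<ge> 1"
    "\<forall>n\<ge>N. \<forall>e. env n e \<longrightarrow> F n e \<in> W \<and> bnd K n (F n e) (real (cnt r P n e))"
    using P unfolding counted_def by (elim exE conjE) (rule that)
  have "\<exists>d\<in>W. eventually (\<lambda>n. F n (benv r n (comp b n)) = d) U \<and> delta U Gn r \<chi> b = dval d"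
    if b: "b \<in> tuples s (carrier M)" for b
  proof -
    have ev: "eventually (\<lambda>n. F n (benv r n (comp b n)) \<in> W \<and>
        bnd K n (F n (benv r n (comp b n))) (real (dcard r \<chi> b n))) U"
      using eventually_ge[of "max N L"]
    proof eventually_elim
      case (elim n)
      have t: "comp b n \<in> tuples s (carrier (Gn n))" using b by (rule comp_tuples)
      have "dcard r \<chi> b n = cnt r (\<lambda>n e. sat (Gn n) e \<chi>) n (benv r n (comp b n))"
        by (rule card_defset[OF \<chi> t])
      also have "\<dots> = cnt r P n (benv r n (comp b n))"
        using eq elim by (intro cnt_cong env_benv[OF t]) auto
      finally show ?case using F(5)[rule_format, OF _ env_benv[OF t]] elim by simp
    qed
    then have in_W: "eventually (\<lambda>n. F n (benv r n (comp b n)) \<in> W) U" by eventually_elim blast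
    obtain d where d: "d \<in> W" "eventually (\<lambda>n. F n (benv r n (comp b n)) = d) U"
      using eventually_eq_const[OF W in_W] by blast
    have "eventually (\<lambda>n. bnd K n d (real (dcard r \<chi> b n))) U" using ev d(2) by eventually_elim auto
    then have "delta U Gn r \<chi> b = dval d" by (rule delta_bnd[OF F(4)])
    then show ?thesis using d by blast
  qed
  then show ?thesis using F(1-3) by blast
qed

lemma dimension:
  assumes "form2 r s \<phi>"
  shows "\<exists>S N F. finite S \<and> avars S \<subseteq> {r..<r + s} \<and> det S N F \<and> (\<forall>b\<in>tuples s (carrier M).
    \<exists>d. eventually (\<lambda>n. F n (benv r n (comp b n)) = d) U \<and> delta U Gn r \<phi> b = dval d)"
proof -
  obtain S0 N0 where S0: "finite S0" "avars S0 \<subseteq> fvars \<phi>" "det S0 N0 (\<lambda>n e. sat (Gn n) e \<phi>)"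
    using sat_det by blast
  obtain W \<Sigma>' where W: "finite W" "counted W \<Sigma>' r r S0 (\<lambda>n e. sat (Gn n) e \<phi>)"
    using count[of "shp r ` S0" r r] S0(1,3) by blast
  have "avars S0 - {..<r} \<subseteq> {r..<r + s}" using S0(2) assms by (fastforce simp: form2_def)
  then show ?thesis using counted_delta[OF W(2,1) assms, of 0] by (meson order_trans)
qed

theorem cond_DC: "condition_DC U Gn"
  unfolding condition_DC_def Let_def
proof (intro allI impI)
  fix r s t \<phi> \<psi> assume *: "form2 r s \<phi> \<and> form2 r t \<psi>"
  obtain S N F where 1: "finite S" "avars S \<subseteq> {r..<r + s}" "det S N F" 
    "\<And>b. b \<in> tuples s (carrier M) \<Longrightarrow>
      \<exists>d. eventually (\<lambda>n. F n (benv r n (comp b n)) = d) U \<and> delta U Gn r \<phi> b = dval d"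
    using dimension[OF conjunct1[OF *]] by blast
  obtain S' N' F' where 2: "finite S'" "avars S' \<subseteq> {r..<r + t}" "det S' N' F'" 
    "\<And>b. b \<in> tuples t (carrier M) \<Longrightarrow>
      \<exists>d. eventually (\<lambda>n. F' n (benv r n (comp b n)) = d) U \<and> delta U Gn r \<psi> b = dval d"
    using dimension[OF conjunct2[OF *]] by blast
  \<comment> \<open>In \<chi> the parameters of \<phi> come first and those of \<psi> follow from
    position s on, whereas \<open>F\<close> and \<open>F'\<close> both read theirs from position r
    on.\<close>
  define f where "f i = i - r" for i :: nat
  define g where "g i = s + (i - r)" for i :: nat
  define S2 where "S2 = aren f ` S \<union> aren g ` S'"
  define Q where "Q n e \<longleftrightarrow> F n (e \<circ> f) \<le> F' n (e \<circ> g)" for n e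
  have "det S2 (max N N') Q"
    unfolding S2_def Q_def[abs_def] by (rule det_comp2[OF det_ren[OF 1(3)] det_ren[OF 2(3)]])
  moreover have finS2: "finite S2" using 1(1) 2(1) by (simp add: S2_def)
  ultimately obtain \<chi> L where \<chi>: "fvars \<chi> \<subseteq> avars S2"
    "\<And>n e. n \<ge> L \<Longrightarrow> env n e \<Longrightarrow> (sat (Gn n) e \<chi> \<longleftrightarrow> Q n e)"
    using definable[of S2 "max N N'" Q "\<lambda>x. x"] finS2 by blast
  have "avars S2 \<subseteq> f ` avars S \<union> g ` avars S'" unfolding S2_def avars_Un avars_ren ..
  also have "\<dots> \<subseteq> {..<s + t}" using 1(2) 2(2) by (fastforce simp: f_def g_def)
  finally have f2: "form2 s t \<chi>" using \<chi>(1) by (simp add: form2_def)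
  have "holds M \<chi> a b \<longleftrightarrow> dim_le U (delta U Gn r \<phi> a) (delta U Gn r \<psi> b)"
    if a: "a \<in> tuples s (carrier M)" and b: "b \<in> tuples t (carrier M)" for a b
  proof -
    obtain d where d: "eventually (\<lambda>n. F n (benv r n (comp a n)) = d) U" "delta U Gn r \<phi> a = dval d"
      using 1(4)[OF a] by blast
    obtain d' where d': "eventually (\<lambda>n. F' n (benv r n (comp b n)) = d') U" "delta U Gn r \<psi> b = dval d'"
      using 2(4)[OF b] by blast
    have ev: "eventually (\<lambda>n. holds (Gn n) \<chi> (comp a n) (comp b n) \<longleftrightarrow> d \<le> d') U"
      using d(1) d'(1) eventually_ge[of "max L (max N N')"]
    proof eventually_elim
      case (elim n)
      have ta: "comp a n \<in> tuples s (carrier (Gn n))" and tb: "comp b n \<in> tuples t (carrier (Gn n))"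
        using a b by (auto intro: comp_tuples)
      define e where "e = benv 0 n (comp a n @ comp b n)"
      have len: "length (comp a n) = s" "length (comp b n) = t" using ta tb by (auto simp: tuples_def)
      have e: "env n e" unfolding e_def
        by (rule env_benv[of _ "s + t"]) (use ta tb in \<open>auto simp: tuples_def\<close>)
      have efg: "env n (e \<circ> f)" "env n (e \<circ> g)" using e by (auto simp: env_def)
      have "holds (Gn n) \<chi> (comp a n) (comp b n) \<longleftrightarrow> sat (Gn n) e \<chi>"
        unfolding holds_def using f2 len by (intro sat_cong) (auto simp: e_def benv_def form2_def)
      also have "\<dots> \<longleftrightarrow> F n (e \<circ> f) \<le> F' n (e \<circ> g)" using \<chi>(2)[OF _ e] elim(3) by (simp add: Q_def)
      \<comment> \<open>The atoms of \<open>S\<close> mention only positions r to r + s - 1, where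
        both environments carry \<open>a\<close>; elsewhere they may differ.\<close>
      also have "F n (e \<circ> f) = F n (benv r n (comp a n))"
      proof (rule det_avars[OF 1(3) _ efg(1) env_benv[OF ta]])
        show "N \<le> n" using elim(3) by simp
        show "(e \<circ> f) i = benv r n (comp a n) i" if "i \<in> avars S" for i
        proof -
          have "i \<in> {r..<r + s}" using 1(2) that by blast
          then obtain j where "i = r + j" "j < s" by (auto simp: le_iff_add)
          then show ?thesis using len by (simp add: e_def benv_def f_def nth_append)
        qed
      qed
      also have "F' n (e \<circ> g) = F' n (benv r n (comp b n))"
      proof (rule det_avars[OF 2(3) _ efg(2) env_benv[OF tb]])
        show "N' \<le> n" using elim(3) by simp
        show "(e \<circ> g) i = benv r n (comp b n) i" if "i \<in> avars S'" for i
        proof -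
          have "i \<in> {r..<r + t}" using 2(2) that by blast
          then obtain j where "i = r + j" "j < t" by (auto simp: le_iff_add)
          then show ?thesis using len by (simp add: e_def benv_def g_def nth_append)
        qed
      qed
      finally show ?case using elim(1,2) by simp
    qed
    have "holds M \<chi> a b \<longleftrightarrow> eventually (\<lambda>n. holds (Gn n) \<chi> (comp a n) (comp b n)) U"
      by (rule los_holds[OF f2 a b])
    also have "\<dots> \<longleftrightarrow> d \<le> d'"
    proof
      assume "eventually (\<lambda>n. holds (Gn n) \<chi> (comp a n) (comp b n)) U"
      with ev have "eventually (\<lambda>n. d \<le> d') U" by eventually_elim simp
      then show "d \<le> d'" using U_not_bot by (simp add: eventually_const_iff)
    next
      assume "d \<le> d'"
      with ev show "eventually (\<lambda>n. holds (Gn n) \<chi> (comp a n) (comp b n)) U" by simp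
    qed
    finally show ?thesis by (simp add: d(2) d'(2) dim_le_dval)
  qed
  then show "\<exists>\<chi>. form2 s t \<chi> \<and> (\<forall>a\<in>tuples s (carrier M). \<forall>b\<in>tuples t (carrier M).
      holds M \<chi> a b \<longleftrightarrow> dim_le U (delta U Gn r \<phi> a) (delta U Gn r \<psi> b))"
    using f2 by blast
qed

end

section \<open>Conjunctions of instances and (A)\<close>

lemma nth_concat_uniform:
  assumes "\<forall>b\<in>set bs. length b = s" "j < length bs" "k < s"
  shows "concat bs ! (j * s + k) = bs ! j ! k"
  using assms
proof (induction bs arbitrary: j)
  case (Cons b bs)
  then show ?case by (cases j) (auto simp: nth_append algebra_simps)
qed simp

lemma length_concat_uniform: "\<forall>b\<in>set bs. length b = s \<Longrightarrow> length (concat bs) = length bs * s"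
  by (induction bs) auto

context zpnu
begin

lemma shp_aren:
  assumes "\<And>i k. i < r \<Longrightarrow> f k = i \<longleftrightarrow> k = i"
  shows "shp r (aren f \<alpha>) = shp r \<alpha>"
proof -
  obtain b k t where \<alpha>: "\<alpha> = (b, k, t)" by (cases \<alpha>) auto
  have "coef i (tren f t) = coef i t" if "i < r" for i using assms that by (intro coef_tren)
  then show ?thesis by (auto simp: shp_def aren_def \<alpha> fun_eq_iff)
qed

lemma avars_UN: "avars (\<Union>j\<in>J. T j) = (\<Union>j\<in>J. avars (T j))"
  by (auto simp: avars_def)

text \<open>A finite conjunction of instances of \<open>\<phi>\<close> involves arbitrarily many atoms, but their shapes are
  those of the atoms for \<open>\<phi>\<close>, so that the dimension stays in a finite set.\<close>

lemma realizations_cut: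
  assumes \<phi>: "form2 r s \<phi>"
  shows "\<exists>W. finite W \<and> (\<forall>B. finite B \<longrightarrow> B \<subseteq> tuples s (carrier M) \<longrightarrow>
    (\<exists>d\<in>W. delta_cut U Gn r (realizations M r \<phi> B) = {w \<in> dims U. dim_le U (dval d) w}))"
proof -
  obtain S0 N0 where S0: "finite S0" "avars S0 \<subseteq> fvars \<phi>" "det S0 N0 (\<lambda>n e. sat (Gn n) e \<phi>)"
    using sat_det by blast
  obtain W \<Sigma>' where W: "finite W"
    and c: "\<And>S N P. finite S \<Longrightarrow> shp r ` S \<subseteq> shp r ` S0 \<Longrightarrow> det S N P \<Longrightarrow> counted W \<Sigma>' r r S P"
    using count[of "shp r ` S0" r r] S0(1) by blast
  have "\<exists>d\<in>W. delta_cut U Gn r (realizations M r \<phi> B) = {w \<in> dims U. dim_le U (dval d) w}"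
    if B: "finite B" "B \<subseteq> tuples s (carrier M)" for B
  proof -
    obtain bs where bs: "set bs = B" using finite_list[OF B(1)] by blast
    define l where "l = length bs"
    \<comment> \<open>The j-th instance reads its parameters from the j-th block of length s, while
      all instances share the first r variables.\<close>
    define f where "f j i = (if i < r then i else i + j * s)" for j i :: nat
    define S1 where "S1 = (\<Union>j\<in>{..<l}. aren (f j) ` S0)"
    define P where "P n e \<longleftrightarrow> (\<forall>j<l. sat (Gn n) (e \<circ> f j) \<phi>)" for n e
    have finS1: "finite S1" using S0(1) by (simp add: S1_def)
    have det_j: "det S1 N0 (\<lambda>n e. sat (Gn n) (e \<circ> f j) \<phi>)" if "j < l" for j
      by (rule det_mono[OF det_ren[OF S0(3)]]) (use that in \<open>auto simp: S1_def\<close>)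
    have detP: "det S1 N0 P" unfolding det_def
    proof (intro allI impI)
      fix n n' e e'
      assume *: "N0 \<le> n" "N0 \<le> n'" "env n e" "env n' e'" "agree S1 n e n' e'"
      have "sat (Gn n) (e \<circ> f j) \<phi> = sat (Gn n') (e' \<circ> f j) \<phi>" if "j < l" for j
        by (rule detD[OF det_j[OF that] *])
      then show "P n e = P n' e'" by (simp add: P_def)
    qed
    have fi: "f j k = i \<longleftrightarrow> k = i" if "i < r" for i j k using that by (auto simp: f_def)
    \<comment> \<open>Renaming moves only parameters, so no new shape arises however many instances
      there are, and \<open>c\<close> yields the same \<open>W\<close>.\<close>
    have sh: "shp r ` S1 \<subseteq> shp r ` S0" using shp_aren[OF fi] by (auto simp: S1_def)
    obtain \<chi> L where \<chi>: "fvars \<chi> \<subseteq> avars S1"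
      "\<And>n e. n \<ge> L \<Longrightarrow> env n e \<Longrightarrow> (sat (Gn n) e \<chi> \<longleftrightarrow> P n e)"
      using definable[OF finS1 detP, of "\<lambda>x. x"] by blast
    have "avars S1 \<subseteq> {..<r + l * s}"
    proof -
      have "f j i < r + l * s" if "j < l" "i \<in> avars S0" for i j
      proof -
        have "i < r + s" using that(2) S0(2) \<phi> by (auto simp: form2_def)
        moreover have "Suc j * s \<le> l * s" using that(1) by (intro mult_right_mono) auto
        ultimately show ?thesis by (auto simp: f_def)
      qed
      then show ?thesis unfolding S1_def avars_UN avars_ren by auto
    qed
    then have f\<chi>: "form2 r (l * s) \<chi>" using \<chi>(1) by (auto simp: form2_def)
    have bs_in: "\<forall>b\<in>set bs. b \<in> tuples s (carrier M)" using B(2) bs by auto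
    then have lens: "\<forall>b\<in>set bs. length b = s" by (auto simp: tuples_def)
    define cb where "cb = concat bs"
    have cb: "cb \<in> tuples (l * s) (carrier M)"
      using length_concat_uniform[OF lens] bs_in by (auto simp: cb_def l_def tuples_def)
    have real: "realizations M r \<phi> B = defset M r \<chi> cb"
    proof -
      have "holds M \<chi> x cb \<longleftrightarrow> (\<forall>b\<in>B. holds M \<phi> x b)" if x: "x \<in> tuples r (carrier M)" for x
      proof -
        have "holds M \<chi> x cb \<longleftrightarrow> eventually (\<lambda>n. holds (Gn n) \<chi> (comp x n) (comp cb n)) U"
          by (rule los_holds[OF f\<chi> x cb])
        also have "\<dots> \<longleftrightarrow> eventually (\<lambda>n. \<forall>j\<in>{..<l}. holds (Gn n) \<phi> (comp x n) (comp (bs ! j) n)) U"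
        proof -
          have "holds (Gn n) \<chi> (comp x n) (comp cb n) \<longleftrightarrow>
            (\<forall>j\<in>{..<l}. holds (Gn n) \<phi> (comp x n) (comp (bs ! j) n))" if "L \<le> n" for n
          proof -
            have tx: "comp x n \<in> tuples r (carrier (Gn n))" and tb: "comp cb n \<in> tuples (l * s) (carrier (Gn n))"
              using x cb by (auto intro: comp_tuples)
            have len: "length (comp x n) = r" "length (comp cb n) = l * s" using tx tb by (auto simp: tuples_def)
            define e where "e = benv 0 n (comp x n @ comp cb n)"
            have e: "env n e" unfolding e_def
              by (rule env_benv[of _ "r + l * s"]) (use tx tb in \<open>auto simp: tuples_def\<close>)
            have "holds (Gn n) \<chi> (comp x n) (comp cb n) \<longleftrightarrow> sat (Gn n) e \<chi>"
              unfolding holds_def using f\<chi> len by (intro sat_cong) (auto simp: e_def benv_def form2_def)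
            also have "\<dots> \<longleftrightarrow> P n e" by (rule \<chi>(2)[OF that e])
            also have "\<dots> \<longleftrightarrow> (\<forall>j\<in>{..<l}. holds (Gn n) \<phi> (comp x n) (comp (bs ! j) n))"
            proof -
              have "sat (Gn n) (e \<circ> f j) \<phi> \<longleftrightarrow> holds (Gn n) \<phi> (comp x n) (comp (bs ! j) n)" if j: "j < l" for j
                unfolding holds_def
              proof (rule sat_cong)
                fix i assume "i \<in> fvars \<phi>"
                then have i: "i < r + s" using \<phi> by (auto simp: form2_def)
                have lj: "length (bs ! j) = s" using lens j by (simp add: l_def)
                have Suc_j: "Suc j * s \<le> l * s" using j by (intro mult_right_mono) auto
                show "(e \<circ> f j) i = (comp x n @ comp (bs ! j) n) ! i"
                proof (cases "i < r")
                  case True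
                  then show ?thesis using len by (simp add: e_def benv_def f_def nth_append)
                next
                  case False
                  then obtain k where k: "i = r + k" "k < s" using i by (auto simp: not_less le_iff_add)
                  have lt: "j * s + k < l * s" using k(2) Suc_j by simp
                  have "(e \<circ> f j) i = comp cb n ! (j * s + k)"
                    using len lt k by (simp add: e_def benv_def f_def nth_append add.commute add.left_commute)
                  also have "\<dots> = urep (cb ! (j * s + k)) n" using lt len by simp
                  also have "cb ! (j * s + k) = bs ! j ! k"
                    unfolding cb_def using lens j k(2) by (intro nth_concat_uniform) (auto simp: l_def)
                  finally show ?thesis using k lj len by (simp add: nth_append)
                qed
              qed
              then show ?thesis by (auto simp: P_def)
            qed
            finally show ?thesis .
          qed
          then have "eventually (\<lambda>n. holds (Gn n) \<chi> (comp x n) (comp cb n) \<longleftrightarrow>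
            (\<forall>j\<in>{..<l}. holds (Gn n) \<phi> (comp x n) (comp (bs ! j) n))) U"
            using eventually_ge[of L] by (rule eventually_mono[rotated])
          then show ?thesis by (rule eventually_cong) simp
        qed
        also have "\<dots> \<longleftrightarrow> (\<forall>j\<in>{..<l}. eventually (\<lambda>n. holds (Gn n) \<phi> (comp x n) (comp (bs ! j) n)) U)"
          by (rule eventually_ball_finite_distrib) simp
        also have "\<dots> \<longleftrightarrow> (\<forall>j\<in>{..<l}. holds M \<phi> x (bs ! j))"
          using los_holds[OF \<phi> x] bs_in by (simp add: l_def)
        also have "\<dots> \<longleftrightarrow> (\<forall>b\<in>B. holds M \<phi> x b)"
          unfolding bs[symmetric] all_set_conv_all_nth by (simp add: l_def Ball_def)
        finally show ?thesis .
      qed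
      then show ?thesis by (auto simp: realizations_def defset_def)
    qed
    obtain d where "d \<in> W" "delta U Gn r \<chi> cb = dval d"
      using counted_delta[OF c[OF finS1 sh detP] W f\<chi> \<chi>(2)] cb by blast
    then show ?thesis using delta_cut_defset[OF f\<chi> cb] real by auto
  qed
  then show ?thesis using W by blast
qed

theorem cond_A: "condition_A U Gn"
  unfolding condition_A_def Let_def
proof (intro allI impI notI)
  fix r s \<phi> assume \<phi>: "form2 r s \<phi>"
  assume "\<exists>B. \<forall>i::nat. finite (B i) \<and> B i \<subseteq> tuples s (carrier M) \<and> realizations M r \<phi> (B i) \<noteq> {} \<and>
    B i \<subseteq> B (Suc i) \<and> cut_less (delta_cut U Gn r (realizations M r \<phi> (B (Suc i))))
      (delta_cut U Gn r (realizations M r \<phi> (B i)))"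
  then obtain B where B: "\<And>i::nat. finite (B i)" "\<And>i. B i \<subseteq> tuples s (carrier M)"
    "\<And>i. cut_less (delta_cut U Gn r (realizations M r \<phi> (B (Suc i)))) (delta_cut U Gn r (realizations M r \<phi> (B i)))"
    by blast
  define cut where "cut i = delta_cut U Gn r (realizations M r \<phi> (B i))" for i
  obtain W where W: "finite W"
    "\<And>B. finite B \<Longrightarrow> B \<subseteq> tuples s (carrier M) \<Longrightarrow>
      \<exists>d\<in>W. delta_cut U Gn r (realizations M r \<phi> B) = {w \<in> dims U. dim_le U (dval d) w}"
    using realizations_cut[OF \<phi>] by blast
  \<comment> \<open>Cuts are represented by upper sets, so a decreasing sequence of cuts is an
    increasing sequence of sets.\<close>
  have "strict_mono cut"
    using B(3) by (simp add: strict_mono_Suc_iff cut_less_def cut_def)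
  then have "inj cut" by (rule strict_mono_imp_inj_on)
  moreover have "range cut \<subseteq> (\<lambda>d. {w \<in> dims U. dim_le U (dval d) w}) ` W"
    using W(2)[OF B(1,2)] by (auto simp: cut_def)
  then have "finite (range cut)" using W(1) finite_surj by blast
  ultimately show False using finite_imageD by blast
qed

end

subsection \<open>Countable elementary substructures\<close>

instance gterm :: countable
  by countable_datatype

instance gform :: countable
  by countable_datatype

text \<open>The witness property also gives closure under the operations, through equations that a
  product or an inverse satisfies.\<close>

lemma Tarski_Vaught:
  assumes G: "group G" and A: "A \<subseteq> carrier G" "A \<noteq> {}"
    and wit': "\<forall>\<phi> i e a. (\<forall>j. e j \<in> A) \<longrightarrow> a \<in> carrier G \<longrightarrow> sat G (e(i := a)) \<phi> \<longrightarrow>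
      (\<exists>b\<in>A. sat G (e(i := b)) \<phi>)"
  shows "subgroup A G" and "(\<And>j. e j \<in> A) \<Longrightarrow> sat (G\<lparr>carrier := A\<rparr>) e \<phi> \<longleftrightarrow> sat G e \<phi>"
proof -
  interpret group G by (rule G)
  note wit = wit'[rule_format]
  show sub: "subgroup A G"
  proof (rule subgroupI)
    fix x y assume x: "x \<in> A" and y: "y \<in> A"
    then have cl: "x \<in> carrier G" "y \<in> carrier G" using A by auto
    show "inv\<^bsub>G\<^esub> x \<in> A"
      using wit[of "\<lambda>_. x" "inv\<^bsub>G\<^esub> x" 0 "Eq (Var 0) (Inv (Var 1))"] x cl by auto
    show "x \<otimes>\<^bsub>G\<^esub> y \<in> A"
      using wit[of "\<lambda>i. if i = 1 then x else y" "x \<otimes>\<^bsub>G\<^esub> y" 0 "Eq (Var 0) (Mul (Var 1) (Var 2))"] x y cl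
      by auto
  qed (use A in auto)
  have tval: "tval (G\<lparr>carrier := A\<rparr>) e t = tval G e t \<and> tval G e t \<in> A" if "\<And>j. e j \<in> A" for e t
    using that
    by (induction t)
      (auto simp: m_inv_consistent[OF sub] subgroup.one_closed[OF sub] subgroup.m_closed[OF sub]
        subgroup.m_inv_closed[OF sub])
  show "(\<And>j. e j \<in> A) \<Longrightarrow> sat (G\<lparr>carrier := A\<rparr>) e \<phi> \<longleftrightarrow> sat G e \<phi>"
  proof (induction \<phi> arbitrary: e)
    case (Exi i \<phi>)
    have IH: "sat (G\<lparr>carrier := A\<rparr>) (e(i := a)) \<phi> \<longleftrightarrow> sat G (e(i := a)) \<phi>" if "a \<in> A" for a
      by (rule Exi.IH) (use Exi.prems that in auto)
    show ?case
    proof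
      assume "sat (G\<lparr>carrier := A\<rparr>) e (Exi i \<phi>)"
      then show "sat G e (Exi i \<phi>)" using IH A by auto
    next
      assume "sat G e (Exi i \<phi>)"
      then obtain a where "a \<in> carrier G" "sat G (e(i := a)) \<phi>" by auto
      then obtain b where "b \<in> A" "sat G (e(i := b)) \<phi>" using wit[of e a i \<phi>] Exi.prems by blast
      then show "sat (G\<lparr>carrier := A\<rparr>) e (Exi i \<phi>)" using IH by auto
    qed
  qed (simp_all add: tval)
qed

text \<open>Close under chosen witnesses \<omega> times. The choice takes a finite list in place of
  an environment, which keeps every stage countable; a formula sees only finitely many
  variables.\<close>

lemma Skolem_hull:
  assumes G: "group G" and B: "B \<subseteq> carrier G" "countable B"
  shows "\<exists>A. countable A \<and> B \<subseteq> A \<and> A \<subseteq> carrier G \<and> A \<noteq> {} \<and>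
    (\<forall>\<phi> i e a. (\<forall>j. e j \<in> A) \<longrightarrow> a \<in> carrier G \<longrightarrow> sat G (e(i := a)) \<phi> \<longrightarrow>
      (\<exists>b\<in>A. sat G (e(i := b)) \<phi>))"
proof -
  interpret group G by (rule G)
  define lenv where "lenv l = (\<lambda>j. if j < length l then l ! j else \<one>\<^bsub>G\<^esub>)" for l
  define w where "w \<phi> i l = (if \<exists>a. a \<in> carrier G \<and> sat G ((lenv l)(i := a)) \<phi>
    then SOME a. a \<in> carrier G \<and> sat G ((lenv l)(i := a)) \<phi> else \<one>\<^bsub>G\<^esub>)" for \<phi> i l
  have w: "w \<phi> i l \<in> carrier G" "a \<in> carrier G \<Longrightarrow> sat G ((lenv l)(i := a)) \<phi> \<Longrightarrow>
      sat G ((lenv l)(i := w \<phi> i l)) \<phi>" for \<phi> i l a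
    using someI_ex[of "\<lambda>a. a \<in> carrier G \<and> sat G ((lenv l)(i := a)) \<phi>"] by (auto simp: w_def)
  define X where "X = rec_nat (insert \<one>\<^bsub>G\<^esub> B) (\<lambda>_ Y. Y \<union> (\<lambda>(\<phi>, i, l). w \<phi> i l) ` (UNIV \<times> UNIV \<times> lists Y))"
  have X: "X 0 = insert \<one>\<^bsub>G\<^esub> B" "X (Suc k) = X k \<union> (\<lambda>(\<phi>, i, l). w \<phi> i l) ` (UNIV \<times> UNIV \<times> lists (X k))" for k
    by (simp_all add: X_def)
  have Xm: "X k \<subseteq> X l" if "k \<le> l" for k l
    using that by (rule lift_Suc_mono_le[rotated]) (auto simp: X)
  have Xc: "countable (X k)" for k using B by (induction k) (auto simp: X)
  have Xs: "X k \<subseteq> carrier G" for k using B w(1) by (induction k) (auto simp: X)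
  define A where "A = (\<Union>k. X k)"
  have "\<exists>b\<in>A. sat G (e(i := b)) \<phi>"
    if e: "\<forall>j. e j \<in> A" and a: "a \<in> carrier G" and s: "sat G (e(i := a)) \<phi>" for \<phi> i e a
  proof -
    define m where "m = Suc (Max (insert 0 (fvars \<phi>)))"
    have m: "j < m" if "j \<in> fvars \<phi>" for j using that by (simp add: m_def less_Suc_eq_le)
    define l where "l = map e [0..<m]"
    have "\<forall>j. \<exists>k. e j \<in> X k" using e by (simp add: A_def)
    from choice[OF this] obtain K where K: "e j \<in> X (K j)" for j by blast
    define k where "k = Max (insert 0 (K ` {..<m}))"
    have "e j \<in> X k" if "j < m" for j
      using K[of j] Xm[of "K j" k] that by (auto simp: k_def)
    then have l: "l \<in> lists (X k)" by (auto simp: l_def)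
    have env: "sat G ((lenv l)(i := b)) \<phi> \<longleftrightarrow> sat G (e(i := b)) \<phi>" for b
      by (rule sat_cong) (use m in \<open>auto simp: lenv_def l_def\<close>)
    have "w \<phi> i l \<in> X (Suc k)" using l unfolding X by force
    then show ?thesis using w(2)[OF a, of l i \<phi>] s env by (auto simp: A_def)
  qed
  note wit = this
  have "countable A" using Xc by (simp add: A_def)
  moreover have "B \<subseteq> A" "A \<noteq> {}" using X(1) by (auto simp: A_def)
  moreover have "A \<subseteq> carrier G" using Xs by (auto simp: A_def)
  ultimately show ?thesis using wit by (intro exI[of _ A] conjI allI impI)
qed

lemma transport_group:
  assumes "group H" "countable (carrier H)" "infinite (UNIV :: 'u set)"
  shows "\<exists>(N :: 'u monoid) h. group N \<and> h \<in> iso N H"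
proof -
  interpret H: group H by fact
  obtain f :: "nat \<Rightarrow> 'u" where f: "inj f" using infinite_countable_subset[OF assms(3)] by blast
  define g where "g = f \<circ> to_nat_on (carrier H)"
  have g: "inj_on g (carrier H)"
    unfolding g_def using assms(2) f by (intro comp_inj_on) (auto intro: inj_on_subset)
  define h where "h = inv_into (carrier H) g"
  have hg: "h (g x) = x" if "x \<in> carrier H" for x using g that by (simp add: h_def)
  define N :: "'u monoid" where
    "N = \<lparr>carrier = g ` carrier H, monoid.mult = (\<lambda>x y. g (h x \<otimes>\<^bsub>H\<^esub> h y)), one = g \<one>\<^bsub>H\<^esub>\<rparr>"
  have "group N"
  proof (rule groupI)
    show "\<exists>y\<in>carrier N. y \<otimes>\<^bsub>N\<^esub> x = \<one>\<^bsub>N\<^esub>" if "x \<in> carrier N" for x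
      using that by (auto simp: N_def hg intro!: bexI[of _ "inv\<^bsub>H\<^esub> (h x)"])
  qed (auto simp: N_def hg H.m_assoc)
  moreover have "h \<in> iso N H"
    using g by (auto simp: iso_def hom_def bij_betw_def inj_on_def N_def hg image_image)
  ultimately show ?thesis by blast
qed

text \<open>Brings an elementary submodel containing prescribed elements to the type
  \<open>'u\<close>. Only values at free variables are constrained, because environments made from
  lists are arbitrary beyond their length.\<close>

theorem Loewenheim_Skolem:
  assumes G: "group G" and B: "B \<subseteq> carrier G" "countable B" and inf: "infinite (UNIV :: 'u set)"
  shows "\<exists>(N :: 'u monoid) h. group N \<and> inj_on h (carrier N) \<and> h ` carrier N \<subseteq> carrier G \<and>
    B \<subseteq> h ` carrier N \<and>
    (\<forall>\<phi> e. (\<forall>i\<in>fvars \<phi>. e i \<in> carrier N) \<longrightarrow> (sat N e \<phi> \<longleftrightarrow> sat G (h \<circ> e) \<phi>))"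
proof -
  obtain A where A: "countable A" "B \<subseteq> A" "A \<subseteq> carrier G" "A \<noteq> {}"
    and wit: "\<forall>\<phi> i e a. (\<forall>j. e j \<in> A) \<longrightarrow> a \<in> carrier G \<longrightarrow> sat G (e(i := a)) \<phi> \<longrightarrow>
      (\<exists>b\<in>A. sat G (e(i := b)) \<phi>)"
    using Skolem_hull[OF G B] by blast
  note TV = Tarski_Vaught[OF G A(3,4) wit]
  define H where "H = G\<lparr>carrier := A\<rparr>"
  have H: "group H" unfolding H_def using TV(1) G by (rule subgroup.subgroup_is_group)
  obtain N :: "'u monoid" and h where N: "group N" "h \<in> iso N H"
    using transport_group[OF H _ inf] A(1) by (auto simp: H_def)
  have bij: "bij_betw h (carrier N) A" using N(2) by (simp add: iso_def H_def)
  have "sat N e \<phi> \<longleftrightarrow> sat G (h \<circ> e) \<phi>" if e: "\<forall>i\<in>fvars \<phi>. e i \<in> carrier N" for \<phi> e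
  proof -
    let ?e = "\<lambda>i. if i \<in> fvars \<phi> then e i else \<one>\<^bsub>N\<^esub>"
    have cl: "?e i \<in> carrier N" for i using e N(1) by (simp add: group.is_monoid monoid.one_closed)
    have "sat N e \<phi> \<longleftrightarrow> sat N ?e \<phi>" by (rule sat_cong) simp
    also have "\<dots> \<longleftrightarrow> sat H (h \<circ> ?e) \<phi>" using sat_iso[OF N(1) H N(2) cl] by simp
    also have "\<dots> \<longleftrightarrow> sat G (h \<circ> ?e) \<phi>"
    proof -
      have hA: "(h \<circ> ?e) i \<in> A" for i unfolding o_apply by (rule bij_betwE[OF bij, rule_format, OF cl])
      show ?thesis unfolding H_def by (rule TV(2), rule hA)
    qed
    also have "\<dots> \<longleftrightarrow> sat G (h \<circ> e) \<phi>" by (rule sat_cong) simp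
    finally show ?thesis .
  qed
  then show ?thesis using N(1) bij A(2,3) by (intro exI[of _ N] exI[of _ h]) (auto simp: bij_betw_def)
qed

subsection \<open>Failure of superstability\<close>

text \<open>Congruence of x and y modulo the subgroup of q-th powers.\<close>

definition dvd_form :: "nat \<Rightarrow> gform" where
  "dvd_form q = Exi 2 (Eq (Var 0) (Mul (Var 1) (tpow (Var 2) q)))"

lemma form2_dvd_form: "form2 1 1 (dvd_form q)"
  using tvars_tpow[of "Var 2" q] by (auto simp: form2_def dvd_form_def)

lemma holds_dvd_form:
  "holds G (dvd_form q) [x] [y] \<longleftrightarrow> (\<exists>z\<in>carrier G. x = y \<otimes>\<^bsub>G\<^esub> z [^]\<^bsub>G\<^esub> q)"
proof -
  have "tval G e (Var 0) = e 0" "tval G e (Var 1) = e 1" for e by auto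
  moreover have "([x] @ [y]) ! 0 = x" "([x] @ [y]) ! 1 = y" by auto
  ultimately show ?thesis unfolding holds_def dvd_form_def by (simp add: tval_tpow)
qed

context zpn
begin

text \<open>With \<open>\<epsilon>\<^sub>j\<close> the standard basis, \<open>cc m i = \<epsilon>\<^sub>0 + p \<epsilon>\<^sub>1 + \<dots> + p\<^bsup>m-1\<^esup> \<epsilon>\<^bsub>m-1\<^esub> + p\<^sup>m \<epsilon>\<^bsub>m+i\<^esub>\<close>, so that
  \<open>cc m 0 = bb (m + 1)\<close>. The elements \<open>cc m i\<close> for varying \<open>i\<close> are conjugate over \<open>bb 0, \<dots>, bb m\<close>, but
  pairwise incongruent modulo \<open>p\<^bsup>m+1\<^esup>\<close>.\<close>

definition cc :: "nat \<Rightarrow> nat \<Rightarrow> nat \<Rightarrow> nat \<Rightarrow> int" where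
  "cc m i n = (\<lambda>j\<in>{..<n}. if j < m then int p ^ j else if j = m + i then int p ^ m else 0)"

definition bb :: "nat \<Rightarrow> nat \<Rightarrow> nat \<Rightarrow> int" where
  "bb k n = (\<lambda>j\<in>{..<n}. if j < k then int p ^ j else 0)"

lemma pow_less: "j < n \<Longrightarrow> int p ^ j < int p ^ n"
  using p_gt_1 by (intro power_strict_increasing) auto

lemma bb_carrier: "bb k n \<in> carrier (Gn n)"
  unfolding carrier_Zpn[OF p_pos] using pow_less p_pos by (auto simp: bb_def)

lemma cc_carrier: "cc m i n \<in> carrier (Gn n)"
proof -
  have "int p ^ m < int p ^ n" if "m + i < n" using that by (intro pow_less) simp
  then show ?thesis unfolding carrier_Zpn[OF p_pos] using pow_less p_pos by (auto simp: cc_def)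
qed

lemma mult_pow_Zpn:
  assumes "z \<in> carrier (Gn n)"
  shows "y \<otimes>\<^bsub>Gn n\<^esub> z [^]\<^bsub>Gn n\<^esub> (p ^ q) = (\<lambda>j\<in>{..<n}. (y j + int p ^ q * z j) mod int p ^ n)"
  unfolding mult_Zpn nat_pow_Zpn[OF assms p_pos] by (auto simp: fun_eq_iff mod_simps)

lemma bb_chain:
  assumes "m < k"
  shows "holds (Gn n) (dvd_form (p ^ Suc m)) [bb k n] [bb (Suc m) n]"
  unfolding holds_dvd_form
proof
  \<comment> \<open>The part of \<open>bb k\<close> beyond coordinate m, divided by
    \<open>p ^ Suc m\<close>.\<close>
  let ?z = "\<lambda>j\<in>{..<n}. if m < j \<and> j < k then int p ^ (j - Suc m) else 0"
  have "int p ^ (j - Suc m) < int p ^ n" if "j < n" for j using that by (intro pow_less) simp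
  then show z: "?z \<in> carrier (Gn n)" unfolding carrier_Zpn[OF p_pos] using p_pos by auto
  show "bb k n = bb (Suc m) n \<otimes>\<^bsub>Gn n\<^esub> ?z [^]\<^bsub>Gn n\<^esub> (p ^ Suc m)"
    unfolding mult_pow_Zpn[OF z]
  proof
    fix j
    have "bb k n j = (bb (Suc m) n j + int p ^ Suc m * ?z j) mod int p ^ n" if j: "j < n"
    proof -
      have "int p ^ Suc m * int p ^ (j - Suc m) = int p ^ j" if "m < j"
        using that by (simp only: power_add[symmetric]) simp
      then have "bb (Suc m) n j + int p ^ Suc m * ?z j = bb k n j"
        using assms j by (auto simp: bb_def simp del: power_Suc)
      then show ?thesis using bb_carrier[of k n] j unfolding carrier_Zpn[OF p_pos] by (auto simp: PiE_iff)
    qed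
    then show "bb k n j = (\<lambda>j\<in>{..<n}. (bb (Suc m) n j + int p ^ Suc m * ?z j) mod int p ^ n) j"
      by (simp add: bb_def)
  qed
qed

text \<open>At coordinate m + i the two congruences would give x both residues \<open>p ^ m\<close>
  and 0 modulo \<open>p ^ Suc m\<close>.\<close>

lemma cc_disjoint:
  assumes "i \<noteq> i'" "m + i < n"
    and "holds (Gn n) (dvd_form (p ^ Suc m)) [x] [cc m i n]"
    and "holds (Gn n) (dvd_form (p ^ Suc m)) [x] [cc m i' n]"
  shows False
proof -
  obtain z where z: "z \<in> carrier (Gn n)" "x = cc m i n \<otimes>\<^bsub>Gn n\<^esub> z [^]\<^bsub>Gn n\<^esub> (p ^ Suc m)"
    using assms(3) unfolding holds_dvd_form by blast
  obtain z' where z': "z' \<in> carrier (Gn n)" "x = cc m i' n \<otimes>\<^bsub>Gn n\<^esub> z' [^]\<^bsub>Gn n\<^esub> (p ^ Suc m)"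
    using assms(4) unfolding holds_dvd_form by blast
  define j where "j = m + i"
  have j: "j < n" "\<not> j < m" "j \<noteq> m + i'" using assms(1,2) by (auto simp: j_def)
  have "x j = (int p ^ m + int p ^ Suc m * z j) mod int p ^ n"
    using fun_cong[OF z(2), of j] j(1,2) unfolding mult_pow_Zpn[OF z(1)] by (simp add: cc_def j_def)
  moreover have "x j = (int p ^ Suc m * z' j) mod int p ^ n"
    using fun_cong[OF z'(2), of j] j unfolding mult_pow_Zpn[OF z'(1)] by (simp add: cc_def)
  ultimately have "(int p ^ m + int p ^ Suc m * z j) mod int p ^ n = (int p ^ Suc m * z' j) mod int p ^ n"
    by (rule trans[OF sym])
  then have "int p ^ n dvd (int p ^ m + int p ^ Suc m * z j) - int p ^ Suc m * z' j"
    by (simp only: mod_eq_dvd_iff)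
  moreover have "int p ^ Suc m dvd int p ^ n" using assms(2) by (intro le_imp_power_dvd) simp
  ultimately have "int p ^ Suc m dvd (int p ^ m + int p ^ Suc m * z j) - int p ^ Suc m * z' j"
    by (rule dvd_trans[rotated])
  then have "int p ^ Suc m dvd int p ^ m + int p ^ Suc m * (z j - z' j)"
    by (simp add: algebra_simps)
  then have "int p ^ Suc m dvd int p ^ m" by (metis dvd_add_times_triv_right_iff mult.commute)
  then have "int p ^ Suc m \<le> int p ^ m" using p_pos by (intro zdvd_imp_le) auto
  then show False using pow_less[of m "Suc m"] by simp
qed

lemma swap_iso:
  assumes "a < n" "b < n"
  defines "\<tau> \<equiv> \<lambda>j. if j = a then b else if j = b then a else j"
  shows "(\<lambda>f. \<lambda>j\<in>{..<n}. f (\<tau> j)) \<in> iso (Gn n) (Gn n)"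
proof -
  have \<tau>: "\<tau> (\<tau> j) = j" "j < n \<Longrightarrow> \<tau> j < n" for j using assms by (auto simp: \<tau>_def)
  have "(\<lambda>f. \<lambda>j\<in>{..<n}. f (\<tau> j)) \<in> hom (Gn n) (Gn n)"
    using \<tau> unfolding hom_def carrier_Zpn[OF p_pos] mult_Zpn by (auto simp: fun_eq_iff PiE_iff)
  moreover have "bij_betw (\<lambda>f. \<lambda>j\<in>{..<n}. f (\<tau> j)) (carrier (Gn n)) (carrier (Gn n))"
    unfolding carrier_Zpn[OF p_pos]
    by (rule bij_betw_byWitness[where f' = "\<lambda>f. \<lambda>j\<in>{..<n}. f (\<tau> j)"])
      (use \<tau> in \<open>auto simp: fun_eq_iff PiE_iff extensional_def\<close>)
  ultimately show ?thesis by (simp add: iso_def)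
qed

text \<open>Exchanging the coordinates m and m + i carries \<open>cc m i\<close> to
  \<open>bb (Suc m)\<close> and fixes each \<open>bb k\<close> with \<open>k \<le> m\<close>, which
  vanishes at both.\<close>

lemma cc_conjugate:
  assumes n: "m + i < n" and ks: "\<forall>k\<in>set ks. k \<le> m" and \<theta>: "form2 1 (length ks) \<theta>"
  shows "holds (Gn n) \<theta> [cc m i n] (map (\<lambda>k. bb k n) ks) \<longleftrightarrow>
    holds (Gn n) \<theta> [bb (Suc m) n] (map (\<lambda>k. bb k n) ks)"
proof -
  define \<tau> where "\<tau> = (\<lambda>j. if j = m then m + i else if j = m + i then m else j)"
  define \<sigma> where "\<sigma> = (\<lambda>f :: nat \<Rightarrow> int. \<lambda>j\<in>{..<n}. f (\<tau> j))"
  have iso: "\<sigma> \<in> iso (Gn n) (Gn n)" unfolding \<sigma>_def \<tau>_def using n by (intro swap_iso) auto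
  have \<sigma>c: "\<sigma> (cc m i n) = bb (Suc m) n"
    using n by (auto simp: \<sigma>_def \<tau>_def cc_def bb_def fun_eq_iff)
  have \<sigma>b: "\<sigma> (bb k n) = bb k n" if "k \<le> m" for k
    using n that by (auto simp: \<sigma>_def \<tau>_def bb_def fun_eq_iff)
  let ?e = "nth ([cc m i n] @ map (\<lambda>k. bb k n) ks)"
  have lt: "j < Suc (length ks)" if "j \<in> fvars \<theta>" for j using \<theta> that by (auto simp: form2_def)
  have "sat (Gn n) (\<sigma> \<circ> ?e) \<theta> \<longleftrightarrow> sat (Gn n) ?e \<theta>"
  proof (rule sat_iso[OF group_Zpn group_Zpn iso])
    fix j assume "j \<in> fvars \<theta>"
    then show "?e j \<in> carrier (Gn n)" using lt[of j] cc_carrier bb_carrier by (cases j) auto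
  qed
  moreover have "sat (Gn n) (\<sigma> \<circ> ?e) \<theta> \<longleftrightarrow> sat (Gn n) (nth ([bb (Suc m) n] @ map (\<lambda>k. bb k n) ks)) \<theta>"
  proof (rule sat_cong)
    fix j assume "j \<in> fvars \<theta>"
    then show "(\<sigma> \<circ> ?e) j = ([bb (Suc m) n] @ map (\<lambda>k. bb k n) ks) ! j"
      using lt[of j] \<sigma>c \<sigma>b ks by (cases j) auto
  qed
  ultimately show ?thesis by (simp add: holds_def)
qed

end

text \<open>A limit type of the sequence \<beta> contains, for every m, the congruence to \<beta> (m
  + 1) modulo \<open>p ^ Suc m\<close>, so it forks over every finite part of \<beta>. All this
  happens in one countable model that contains the classes of all \<open>bb k\<close> and
  \<open>cc m i\<close>.\<close>

lemma (in zpnu) not_superstable: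
  assumes inf: "infinite (UNIV :: 'u set)"
  shows "\<not> superstable_theory TYPE('u) (Th M)"
proof -
  have fam: "bb k \<in> fam" "cc m i \<in> fam" for k m i using bb_carrier cc_carrier by (auto simp: fam_iff)
  define X where "X = range (\<lambda>(m, i). cls (cc m i)) \<union> range (\<lambda>k. cls (bb k))"
  have X: "X \<subseteq> carrier M" "countable X" using fam by (auto simp: X_def carrier_M)
  obtain N :: "'u monoid" and h where N: "group N" "inj_on h (carrier N)" "h ` carrier N \<subseteq> carrier M"
    "X \<subseteq> h ` carrier N"
    and el: "\<And>\<phi> e. (\<forall>i\<in>fvars \<phi>. e i \<in> carrier N) \<Longrightarrow> (sat N e \<phi> \<longleftrightarrow> sat M (h \<circ> e) \<phi>)"
    using Loewenheim_Skolem[OF group_M X inf] by blast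
  \<comment> \<open>Families that name elements of \<open>N\<close> by means of \<open>g\<close>;
    through these names truth in \<open>N\<close> becomes truth in almost all
    \<open>Gn n\<close>.\<close>
  define good where "good f \<longleftrightarrow> f \<in> fam \<and> cls f \<in> h ` carrier N" for f
  define g where "g f = inv_into (carrier N) h (cls f)" for f
  have g: "g f \<in> carrier N" "h (g f) = cls f" if "good f" for f
    using that inv_into_into[of "cls f" h "carrier N"] f_inv_into_f[of "cls f" h "carrier N"]
    by (auto simp: good_def g_def)
  have good_bc: "good (bb k)" "good (cc m i)" for k m i
  proof -
    have "cls (bb k) \<in> X" by (simp add: X_def)
    moreover have "cls (cc m i) \<in> X" unfolding X_def by (rule UnI1, rule range_eqI[of _ _ "(m, i)"]) simp
    ultimately show "good (bb k)" "good (cc m i)" using fam N(4) unfolding good_def by blast+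
  qed
  have good_ex: "\<exists>f. good f \<and> g f = x" if "x \<in> carrier N" for x
  proof -
    have hx: "h x \<in> carrier M" using N(3) that by blast
    have "good (urep (h x))" using urep_fam[OF hx] cls_urep[OF hx] that by (simp add: good_def)
    moreover have "g (urep (h x)) = x" using cls_urep[OF hx] N(2) that by (simp add: g_def)
    ultimately show ?thesis by blast
  qed
  have holdsN: "holds N \<phi> (map g xs) (map g ys) \<longleftrightarrow>
      eventually (\<lambda>n. holds (Gn n) \<phi> (map (\<lambda>f. f n) xs) (map (\<lambda>f. f n) ys)) U"
    if \<phi>: "form2 (length xs) (length ys) \<phi>" and gd: "\<forall>f\<in>set xs \<union> set ys. good f" for \<phi> xs ys
  proof -
    let ?zs = "xs @ ys"
    have lt: "i < length ?zs" if "i \<in> fvars \<phi>" for i using \<phi> that by (auto simp: form2_def)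
    have gi: "good (?zs ! i)" if "i \<in> fvars \<phi>" for i using gd lt[OF that] nth_mem[of i ?zs] by auto
    define F where "F i = (if i \<in> fvars \<phi> then ?zs ! i else (\<lambda>n. \<one>\<^bsub>Gn n\<^esub>))" for i
    have F: "F i \<in> fam" for i using gi[of i] one_fam by (auto simp: F_def good_def)
    have nth_map_zs: "(map g xs @ map g ys) ! i = g (?zs ! i)" if "i \<in> fvars \<phi>" for i
      using lt[OF that] by (simp flip: map_append)
    have "holds N \<phi> (map g xs) (map g ys) \<longleftrightarrow> sat M (h \<circ> nth (map g xs @ map g ys)) \<phi>"
      unfolding holds_def using nth_map_zs g(1)[OF gi] by (intro el) simp
    also have "\<dots> \<longleftrightarrow> sat M (\<lambda>i. cls (F i)) \<phi>"
      using nth_map_zs g(2)[OF gi] by (intro sat_cong) (simp add: F_def)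
    also have "\<dots> \<longleftrightarrow> eventually (\<lambda>n. sat (Gn n) (\<lambda>i. F i n) \<phi>) U" by (rule los_cls[OF F])
    also have "(\<lambda>n. sat (Gn n) (\<lambda>i. F i n) \<phi>) =
        (\<lambda>n. holds (Gn n) \<phi> (map (\<lambda>f. f n) xs) (map (\<lambda>f. f n) ys))"
      unfolding holds_def using lt by (intro ext sat_cong) (simp add: F_def flip: map_append)
    finally show ?thesis .
  qed
  have model: "is_model N (Th M)"
  proof -
    have "sat N (\<lambda>_. \<one>\<^bsub>N\<^esub>) \<phi>" if "\<phi> \<in> Th M" for \<phi>
    proof -
      have "fvars \<phi> = {}" "sat M (\<lambda>_. \<one>\<^bsub>M\<^esub>) \<phi>" using that by (auto simp: Th_def)
      then show ?thesis using el[of \<phi>] sat_cong[of \<phi> "h \<circ> (\<lambda>_. \<one>\<^bsub>N\<^esub>)" "\<lambda>_. \<one>\<^bsub>M\<^esub>" M] by auto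
    qed
    then show ?thesis using N(1) by (simp add: is_model_def)
  qed
  define \<beta> where "\<beta> k = g (bb k)" for k
  define \<gamma> where "\<gamma> m i = g (cc m i)" for m i
  have \<beta>\<gamma>: "\<beta> k \<in> carrier N" "\<gamma> m i \<in> carrier N" for k m i using g good_bc by (auto simp: \<beta>_def \<gamma>_def)
  define B where "B = range \<beta>"
  \<comment> \<open>The limit of the types of \<beta> k along \<open>U\<close>, which is reused as
    an ultrafilter on the indices k; this makes \<open>q\<close> complete and finitely satisfiable
    in the sequence.\<close>
  define q where "q = {(\<phi>, b). (\<phi>, b) \<in> instances 1 B \<and> eventually (\<lambda>k. holds N \<phi> [\<beta> k] b) U}"
  have "complete_type N 1 B q"
    unfolding complete_type_def
  proof (intro conjI allI impI ballI)
    show "q \<subseteq> instances 1 B" by (auto simp: q_def)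
    show "\<exists>x\<in>tuples 1 (carrier N). \<forall>(\<phi>, b)\<in>p0. holds N \<phi> x b" if p0: "finite p0 \<and> p0 \<subseteq> q" for p0
    proof -
      have "eventually (\<lambda>k. \<forall>\<pi>\<in>p0. holds N (fst \<pi>) [\<beta> k] (snd \<pi>)) U"
        using p0 by (intro eventually_ball_finite) (auto simp: q_def)
      then obtain k where "\<forall>\<pi>\<in>p0. holds N (fst \<pi>) [\<beta> k] (snd \<pi>)"
        using U_not_bot eventually_happens by blast
      then show ?thesis using \<beta>\<gamma>(1) by (intro bexI[of _ "[\<beta> k]"]) (auto simp: tuples_def)
    qed
    show "case \<pi> of (\<phi>, b) \<Rightarrow> (\<phi>, b) \<in> q \<or> (Neg \<phi>, b) \<in> q" if "\<pi> \<in> instances 1 B" for \<pi>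
    proof -
      obtain \<phi> b where \<pi>: "\<pi> = (\<phi>, b)" by (cases \<pi>) auto
      have "(\<phi>, b) \<in> instances 1 B" "(Neg \<phi>, b) \<in> instances 1 B"
        using that by (auto simp: instances_def form2_def \<pi>)
      moreover have "eventually (\<lambda>k. holds N \<phi> [\<beta> k] b) U \<or> eventually (\<lambda>k. holds N (Neg \<phi>) [\<beta> k] b) U"
        using eventually_not[of "\<lambda>k. holds N \<phi> [\<beta> k] b"] by (auto simp: holds_def)
      ultimately show ?thesis by (auto simp: \<pi> q_def)
    qed
  qed
  moreover have "forks_over N 1 A q" if A: "finite A" "A \<subseteq> B" for A
  proof -
    obtain C where C: "finite C" "A = \<beta> ` C"
      using finite_subset_image[OF A(1), of \<beta> UNIV] A(2) by (auto simp: B_def)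
    \<comment> \<open>All parameters in \<open>A\<close> are among \<beta> 0, ..., \<beta> m, the
      elements over which the \<gamma> m i are conjugate.\<close>
    define m where "m = Max (insert 0 C)"
    have m: "k \<le> m" if "k \<in> C" for k using C(1) that by (simp add: m_def)
    let ?\<psi> = "dvd_form (p ^ Suc m)"
    have \<psi>: "form2 1 1 ?\<psi>" by (rule form2_dvd_form)
    have in_q: "(?\<psi>, [\<beta> (Suc m)]) \<in> q"
    proof -
      have "holds N ?\<psi> [\<beta> k] [\<beta> (Suc m)]" if "Suc m \<le> k" for k
        using holdsN[of "[bb k]" "[bb (Suc m)]" ?\<psi>] \<psi> good_bc(1) bb_chain[of m k] that by (simp add: \<beta>_def)
      then have "eventually (\<lambda>k. holds N ?\<psi> [\<beta> k] [\<beta> (Suc m)]) U"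
        using eventually_ge[of "Suc m"] by (auto elim: eventually_mono)
      then show ?thesis using \<psi> by (auto simp: q_def instances_def B_def)
    qed
    \<comment> \<open>The sequence witnessing division already lies in \<open>N\<close>, so no
      proper extension is called for.\<close>
    have elem: "elem_embedding id N N" by (simp add: elem_embedding_def)
    have same: "same_type N A [\<gamma> m i] [\<beta> (Suc m)]" for i
      unfolding same_type_def
    proof (intro conjI allI impI ballI)
      fix t \<theta> a assume \<theta>: "form2 (length [\<gamma> m i]) t \<theta>" and a: "a \<in> tuples t A"
      have "a \<in> lists (\<beta> ` C)" using a C(2) by (simp add: tuples_def lists_eq_set)
      then obtain ks where ks: "a = map \<beta> ks" "set ks \<subseteq> C"
        unfolding lists_image by (auto simp: lists_eq_set)
      have len: "length ks = t" using a ks by (simp add: tuples_def)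
      have a_eq: "a = map g (map bb ks)" using ks by (simp add: \<beta>_def)
      have \<theta>': "form2 1 (length ks) \<theta>" using \<theta> len by simp
      have "holds N \<theta> [\<gamma> m i] a \<longleftrightarrow>
          eventually (\<lambda>n. holds (Gn n) \<theta> [cc m i n] (map (\<lambda>k. bb k n) ks)) U"
        using holdsN[of "[cc m i]" "map bb ks" \<theta>] \<theta>' good_bc by (auto simp: a_eq \<gamma>_def o_def)
      also have "\<dots> \<longleftrightarrow> eventually (\<lambda>n. holds (Gn n) \<theta> [bb (Suc m) n] (map (\<lambda>k. bb k n) ks)) U"
      proof (rule eventually_cong[OF eventually_ge[of "Suc (m + i)"]])
        fix n assume "Suc (m + i) \<le> n"
        then show "holds (Gn n) \<theta> [cc m i n] (map (\<lambda>k. bb k n) ks) \<longleftrightarrow>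
            holds (Gn n) \<theta> [bb (Suc m) n] (map (\<lambda>k. bb k n) ks)"
          using ks(2) m \<theta>' by (intro cc_conjugate) auto
      qed
      also have "\<dots> \<longleftrightarrow> holds N \<theta> [\<beta> (Suc m)] a"
        using holdsN[of "[bb (Suc m)]" "map bb ks" \<theta>] \<theta>' good_bc by (auto simp: a_eq \<beta>_def o_def)
      finally show "holds N \<theta> [\<gamma> m i] a \<longleftrightarrow> holds N \<theta> [\<beta> (Suc m)] a" .
    qed simp
    have disj: False
      if i: "i \<noteq> i'" and x: "x \<in> tuples 1 (carrier N)"
        and hold: "holds N ?\<psi> x [\<gamma> m i]" "holds N ?\<psi> x [\<gamma> m i']" for i i' x
    proof -
      obtain y where y: "x = [y]" "y \<in> carrier N" using x by (auto simp: tuples_def length_Suc_conv)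
      obtain f where f: "good f" "g f = y" using good_ex[OF y(2)] by blast
      have "eventually (\<lambda>n. holds (Gn n) ?\<psi> [f n] [cc m i n]) U"
        "eventually (\<lambda>n. holds (Gn n) ?\<psi> [f n] [cc m i' n]) U"
        using holdsN[of "[f]" "[cc m i]" ?\<psi>] holdsN[of "[f]" "[cc m i']" ?\<psi>] \<psi> f good_bc hold
        by (auto simp: y(1) \<gamma>_def)
      then have "eventually (\<lambda>n. False) U" using eventually_ge[of "Suc (m + i)"]
      proof eventually_elim
        case (elim n)
        then show ?case using cc_disjoint[OF i, of m n "f n"] by simp
      qed
      then show False using U_not_bot by (simp add: trivial_limit_def)
    qed
    have divides: "divides_over N 1 A ?\<psi> [\<beta> (Suc m)]"
      unfolding divides_over_def
    \<comment> \<open>The congruence classes are pairwise disjoint, hence 2-inconsistency.\<close>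
    proof (intro exI[of _ N] exI[of _ id] exI[of _ 2] exI[of _ "\<lambda>i. [\<gamma> m i]"] conjI allI impI)
      show "[\<gamma> m i] \<in> tuples (length [\<beta> (Suc m)]) (carrier N)" for i
        using \<beta>\<gamma> by (simp add: tuples_def)
      show "same_type N (id ` A) [\<gamma> m i] (map id [\<beta> (Suc m)])" for i using same by simp
      show "\<not> (\<exists>x\<in>tuples 1 (carrier N). \<forall>i\<in>I. holds N ?\<psi> x [\<gamma> m i])"
        if "finite I \<and> card I = 2" for I
        using that disj by (auto simp: card_2_iff)
    qed (rule N(1) elem)+
    show ?thesis
      unfolding forks_over_def
      by (intro exI[of _ N] exI[of _ id] exI[of _ "{(?\<psi>, [\<beta> (Suc m)])}"])
        (use N(1) elem in_q \<psi> \<beta>\<gamma> divides in auto)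
  qed
  moreover have "B \<subseteq> carrier N" using \<beta>\<gamma> by (auto simp: B_def)
  ultimately show ?thesis using model unfolding superstable_theory_def by blast
qed

theorem theorem4p19:
  fixes p :: nat and U :: "nat filter"
  assumes "prime p"
    and "nonprincipal_ultrafilter U"
    and "infinite (UNIV :: 'u set)"
  shows "stable_theory TYPE('u) (Th (ultraproduct U (Zpn_pow p))) \<and>
         \<not> superstable_theory TYPE('u) (Th (ultraproduct U (Zpn_pow p))) \<and>
         condition_A U (Zpn_pow p) \<and>
         condition_DC U (Zpn_pow p)"
proof -
  interpret zpnu p U
    by (intro zpnu.intro zpn.intro ultra.intro assms group_Zpn)
  show ?thesis using stable not_superstable[OF assms(3)] cond_A cond_DC by blast
qed

end
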